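(* Let $A$ be a finitely generated left-orderable group and $C$ a subgroup of $A$ such that $A$ is Hucha with respect to $C$ and $C$ is Prieto. Then: (i) for every injective homomorphism $\varphi:C\to A$, the HNN extension $A*_C t=\langle A,t \mid tct^{-1}=\varphi(c),\ c\in C\rangle$, if left-orderable, is Hucha; (ii) for every finitely generated group $B$ containing a copy of $C$, the amalgamated free product $A*_C B$, if left-orderable, is Hucha.
   Context: A positive cone of a group $G$ is a subsemigroup $P\subseteq G$ with $G=P\sqcup P^{-1}\sqcup\{1\}$; $G$ is left-orderable if it has one. For a finitely generated group $G$ with finite symmetric generating set $X$, $d_X$ is the word metric. An $r$-path is a finite sequence $g_0,\dots,g_n$ with $d_X(g_i,g_{i+1})\le r$. A subset $S$ coarsely connected if for some $r$ any two of its points are joined by an $r$-path inside $S$. A set $S$ $r$-disconnects subsets $H_1,H_2$ if every $r$-path starting in $H_1$ and ending in $H_2$ contains an element of $S$; $S$ $r$-disconnects $P$ if there are $u,v\in P$ such that $S$ $r$-disconnects $\{u\}$ and $\{v\}$. For a positive cone $P$ and subgroup $H$, a negative swamp of width $r$ for $H$ is a set $S\subseteq P^{-1}$ that $r$-disconnects $P$ and $r$-disconnects $g_1H$ and $g_2H$ for some $g_1,g_2\in G$. A finitely generated left-orderable group $G$ is Hucha with respect to a family $\mathcal{H}$ of subgroups if, for some finite generating set $X$ (the property is independent of $X$), for every positive cone $P$, every $H\in\mathcal{H}$ and every $r>0$ there is a negative swamp of width $r$ for $H$ in $\Gamma(G,X)$; Hucha with respect to $H$ means with respect to $\{H\}$,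 and Hucha means Hucha with respect to the trivial subgroup. A finitely generated left-orderable group is Prieto if all its positive cones are coarsely connected (with respect to a word metric from a finite generating set). *)

theory Defs
  imports "HOL-Algebra.Algebra"
begin

definition fin_gen_set :: "('a, 'b) monoid_scheme \<Rightarrow> 'a set \<Rightarrow> bool" where
  "fin_gen_set G Xg \<longleftrightarrow> finite Xg \<and> Xg \<subseteq> carrier G \<and> (\<forall>x\<in>Xg. m_inv G x \<in> Xg)
     \<and> generate G Xg = carrier G"

definition finitely_generated :: "('a, 'b) monoid_scheme \<Rightarrow> bool" where
  "finitely_generated G \<longleftrightarrow> group G \<and> (\<exists>Xg. fin_gen_set G Xg)"

definition wdist :: "('a, 'b) monoid_scheme \<Rightarrow> 'a set \<Rightarrow> 'a \<Rightarrow> 'a \<Rightarrow> nat" where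
  "wdist G Xg g h = (LEAST n. \<exists>xs. length xs = n \<and> set xs \<subseteq> Xg \<and>
       h = monoid.mult G g (foldr (\<lambda>x y. monoid.mult G x y) xs (monoid.one G)))"

definition rpath :: "('a, 'b) monoid_scheme \<Rightarrow> 'a set \<Rightarrow> real \<Rightarrow> 'a list \<Rightarrow> bool" where
  "rpath G Xg r ps \<longleftrightarrow> ps \<noteq> [] \<and> set ps \<subseteq> carrier G \<and>
     (\<forall>i. Suc i < length ps \<longrightarrow> real (wdist G Xg (ps ! i) (ps ! Suc i)) \<le> r)"

definition coarsely_connected :: "('a, 'b) monoid_scheme \<Rightarrow> 'a set \<Rightarrow> 'a set \<Rightarrow> bool" where
  "coarsely_connected G Xg S \<longleftrightarrow> (\<exists>r. \<forall>u\<in>S. \<forall>v\<in>S. \<exists>ps.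
      rpath G Xg r ps \<and> set ps \<subseteq> S \<and> hd ps = u \<and> last ps = v)"

definition r_disconnects :: "('a, 'b) monoid_scheme \<Rightarrow> 'a set \<Rightarrow> real \<Rightarrow> 'a set \<Rightarrow> 'a set \<Rightarrow> 'a set \<Rightarrow> bool" where
  "r_disconnects G Xg r S H1 H2 \<longleftrightarrow> (\<forall>ps. rpath G Xg r ps \<and> hd ps \<in> H1 \<and> last ps \<in> H2 \<longrightarrow> set ps \<inter> S \<noteq> {})"

definition inv_set :: "('a, 'b) monoid_scheme \<Rightarrow> 'a set \<Rightarrow> 'a set" where
  "inv_set G P = (\<lambda>x. m_inv G x) ` P"

definition pos_cone :: "('a, 'b) monoid_scheme \<Rightarrow> 'a set \<Rightarrow> bool" where
  "pos_cone G P \<longleftrightarrow> P \<subseteq> carrier G \<and> (\<forall>x\<in>P. \<forall>y\<in>P. monoid.mult G x y \<in> P) \<and>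
     carrier G = P \<union> inv_set G P \<union> {monoid.one G} \<and>
     P \<inter> inv_set G P = {} \<and> monoid.one G \<notin> P \<and> monoid.one G \<notin> inv_set G P"

definition left_orderable :: "('a, 'b) monoid_scheme \<Rightarrow> bool" where
  "left_orderable G \<longleftrightarrow> group G \<and> (\<exists>P. pos_cone G P)"

definition neg_swamp :: "('a, 'b) monoid_scheme \<Rightarrow> 'a set \<Rightarrow> 'a set \<Rightarrow> 'a set \<Rightarrow> real \<Rightarrow> 'a set \<Rightarrow> bool" where
  "neg_swamp G Xg P H r S \<longleftrightarrow> S \<subseteq> inv_set G P \<and>
     (\<exists>u\<in>P. \<exists>v\<in>P. r_disconnects G Xg r S {u} {v}) \<and>
     (\<exists>g1\<in>carrier G. \<exists>g2\<in>carrier G. r_disconnects G Xg r S (l_coset G g1 H) (l_coset G g2 H))"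

definition hucha_wrt :: "('a, 'b) monoid_scheme \<Rightarrow> 'a set set \<Rightarrow> bool" where
  "hucha_wrt G \<H> \<longleftrightarrow> left_orderable G \<and> (\<forall>H\<in>\<H>. subgroup H G) \<and>
     (\<exists>Xg. fin_gen_set G Xg \<and> (\<forall>P. pos_cone G P \<longrightarrow> (\<forall>H\<in>\<H>. \<forall>r>0. \<exists>S. neg_swamp G Xg P H r S)))"

definition hucha :: "('a, 'b) monoid_scheme \<Rightarrow> bool" where
  "hucha G \<longleftrightarrow> hucha_wrt G {{monoid.one G}}"

definition prieto :: "('a, 'b) monoid_scheme \<Rightarrow> bool" where
  "prieto G \<longleftrightarrow> left_orderable G \<and>
     (\<exists>Xg. fin_gen_set G Xg \<and> (\<forall>P. pos_cone G P \<longrightarrow> coarsely_connected G Xg P))"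

inductive pres_eq :: "('l \<Rightarrow> bool) \<Rightarrow> ('l list \<Rightarrow> 'l list \<Rightarrow> bool) \<Rightarrow> 'l list \<Rightarrow> 'l list \<Rightarrow> bool"
  for L R where
  base: "R u v \<Longrightarrow> pres_eq L R u v"
| refl: "\<forall>l\<in>set w. L l \<Longrightarrow> pres_eq L R w w"
| sym: "pres_eq L R u v \<Longrightarrow> pres_eq L R v u"
| trans: "pres_eq L R u v \<Longrightarrow> pres_eq L R v w \<Longrightarrow> pres_eq L R u w"
| ctxt: "pres_eq L R u v \<Longrightarrow> \<forall>l\<in>set w1. L l \<Longrightarrow> \<forall>l\<in>set w2. L l \<Longrightarrow>
           pres_eq L R (w1 @ u @ w2) (w1 @ v @ w2)"

definition pres_monoid :: "('l \<Rightarrow> bool) \<Rightarrow> ('l list \<Rightarrow> 'l list \<Rightarrow> bool) \<Rightarrow> 'l list set monoid" where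
  "pres_monoid L R = \<lparr> carrier = {w. \<forall>l\<in>set w. L l} // {(u, v). pres_eq L R u v},
     monoid.mult = (\<lambda>U V. {w. \<exists>u\<in>U. \<exists>v\<in>V. pres_eq L R (u @ v) w}),
     monoid.one = {w. pres_eq L R [] w} \<rparr>"

text \<open>HNN extension A *_C t: generators the elements of A (Inl a) and t (Inr True), t^-1 (Inr False);
  relations: multiplication table of A, t t^-1 = 1 = t^-1 t, t c t^-1 = phi c for c in C.\<close>
definition hnn_letter :: "('a, 'b) monoid_scheme \<Rightarrow> ('a + bool) \<Rightarrow> bool" where
  "hnn_letter A l = (case l of Inl a \<Rightarrow> a \<in> carrier A | Inr _ \<Rightarrow> True)"

inductive hnn_rel :: "('a, 'b) monoid_scheme \<Rightarrow> 'a set \<Rightarrow> ('a \<Rightarrow> 'a) \<Rightarrow> ('a + bool) list \<Rightarrow> ('a + bool) list \<Rightarrow> bool"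
  for A C \<phi> where
  mul: "a \<in> carrier A \<Longrightarrow> b \<in> carrier A \<Longrightarrow> hnn_rel A C \<phi> [Inl a, Inl b] [Inl (monoid.mult A a b)]"
| one: "hnn_rel A C \<phi> [Inl (monoid.one A)] []"
| tinv1: "hnn_rel A C \<phi> [Inr True, Inr False] []"
| tinv2: "hnn_rel A C \<phi> [Inr False, Inr True] []"
| conj: "c \<in> C \<Longrightarrow> hnn_rel A C \<phi> [Inr True, Inl c, Inr False] [Inl (\<phi> c)]"

definition HNN :: "('a, 'b) monoid_scheme \<Rightarrow> 'a set \<Rightarrow> ('a \<Rightarrow> 'a) \<Rightarrow> ('a + bool) list set monoid" where
  "HNN A C \<phi> = pres_monoid (hnn_letter A) (hnn_rel A C \<phi>)"

definition amalg_letter :: "('a, 'b) monoid_scheme \<Rightarrow> ('c, 'd) monoid_scheme \<Rightarrow> ('a + 'c) \<Rightarrow> bool" where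
  "amalg_letter A B l = (case l of Inl a \<Rightarrow> a \<in> carrier A | Inr b \<Rightarrow> b \<in> carrier B)"

inductive amalg_rel :: "('a, 'b) monoid_scheme \<Rightarrow> 'a set \<Rightarrow> ('c, 'd) monoid_scheme \<Rightarrow> ('a \<Rightarrow> 'c)
    \<Rightarrow> ('a + 'c) list \<Rightarrow> ('a + 'c) list \<Rightarrow> bool"
  for A C B \<psi> where
  mulA: "a \<in> carrier A \<Longrightarrow> a' \<in> carrier A \<Longrightarrow> amalg_rel A C B \<psi> [Inl a, Inl a'] [Inl (monoid.mult A a a')]"
| mulB: "b \<in> carrier B \<Longrightarrow> b' \<in> carrier B \<Longrightarrow> amalg_rel A C B \<psi> [Inr b, Inr b'] [Inr (monoid.mult B b b')]"
| oneA: "amalg_rel A C B \<psi> [Inl (monoid.one A)] []"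
| oneB: "amalg_rel A C B \<psi> [Inr (monoid.one B)] []"
| ident: "c \<in> C \<Longrightarrow> amalg_rel A C B \<psi> [Inl c] [Inr (\<psi> c)]"

definition AMALG :: "('a, 'b) monoid_scheme \<Rightarrow> 'a set \<Rightarrow> ('c, 'd) monoid_scheme \<Rightarrow> ('a \<Rightarrow> 'c)
    \<Rightarrow> ('a + 'c) list set monoid" where
  "AMALG A C B \<psi> = pres_monoid (amalg_letter A B) (amalg_rel A C B \<psi>)"

end

(* Enlarging a swamp to the whole negative cone, a group is Hucha iff no positive cone P admits a
   finite set F such that any two elements of P are joined inside P u {1} by steps from F.

   Let G be one of the two extensions and P a positive cone of G.  If A x is bounded above for all x
   in G, then some translate of A, thickened by a ball, is negative.  It separates a half space of
   the Bass-Serre tree from its complement, and neither is bounded above, since G is covered by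
   finitely many translates of either.  Otherwise, after conjugating P, the subgroup A is cofinal
   and contains some y above a given ball.  Then right multiplication by y pushes each path inside
   P u {1}, refined to single generators, into P u {1}.  Every excursion of the refined path out of
   A leaves and re-enters through one coset a K with K isomorphic to C, and the Prieto property of
   C replaces it by a path inside that coset, with a step bound independent of the excursion.  So
   a coarsely connected P would give a coarsely connected positive cone of A.

   A half space exists because C and its image under phi are proper: otherwise A would be Prieto. *)

theory Submission
  imports Defs
begin


section \<open>Word metrics and steps by finite sets\<close>

text \<open>Replacing an excursion needs its end points, which the refined path reaches only as
  points \<open>h\<close> with \<open>h y >= 1\<close>; such points need not be nonnegative. The
  path is therefore followed in the set of all these \<open>h\<close>. Its trace on \<open>A\<close>
  is a left translate of the nonnegative part of a cone of \<open>A\<close>, but of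
  \<open>A \<inter> y P y^-1\<close> instead of \<open>A \<inter> P\<close>. The conjugate suits the
  cosets as well: \<open>(a k) y\<close> is \<open>a y\<close> times the conjugate
  \<open>y^-1 k y\<close>, so multipliers that are nonnegative for the same conjugated cone stay in
  the set. Since the extensions are defined by presentations, no tree is given. Its branches at
  \<open>A\<close> are read off from normal forms, whose uniqueness comes from van der Waerden's
  method: letters act on reduced words and relators act trivially. Both kinds of extension are
  handled at once as paths in a graph of groups with one edge and its inverse, on one vertex or on
  two. Right multiplication alters words at their end, so the first syllable, which names the
  branch, can change only by passing through \<open>A\<close>.\<close>

definition wprod :: "('a, 'b) monoid_scheme \<Rightarrow> 'a list \<Rightarrow> 'a" where
  "wprod G xs = foldr (\<otimes>\<^bsub>G\<^esub>) xs \<one>\<^bsub>G\<^esub>"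

definition wball :: "('a, 'b) monoid_scheme \<Rightarrow> 'a set \<Rightarrow> nat \<Rightarrow> 'a set" where
  "wball G Y n = wprod G ` {xs. set xs \<subseteq> Y \<and> length xs \<le> n}"

text \<open>Steps multiply on the right, so left translations carry step paths to step paths. A
  finite set \<open>F\<close> of multipliers replaces a word metric together with a radius, which
  removes the choice of generators.\<close>

definition fstep :: "('a, 'b) monoid_scheme \<Rightarrow> 'a set \<Rightarrow> 'a set \<Rightarrow> ('a \<times> 'a) set" where
  "fstep G F S = {(g, h). g \<in> S \<and> h \<in> S \<and> (\<exists>f\<in>F. h = g \<otimes>\<^bsub>G\<^esub> f)}"

lemma finite_wball: "finite Y \<Longrightarrow> finite (wball G Y n)"
  unfolding wball_def by (intro finite_imageI finite_lists_length_le)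

lemma fstep_mono: "F \<subseteq> F' \<Longrightarrow> S \<subseteq> S' \<Longrightarrow> fstep G F S \<subseteq> fstep G F' S'"
  unfolding fstep_def by blast

lemma fstep_rtrancl_mono:
  "(u, v) \<in> (fstep G F S)\<^sup>* \<Longrightarrow> F \<subseteq> F' \<Longrightarrow> S \<subseteq> S' \<Longrightarrow> (u, v) \<in> (fstep G F' S')\<^sup>*"
  using rtrancl_mono[OF fstep_mono] by blast

context group
begin

lemma wprod_closed: "set xs \<subseteq> carrier G \<Longrightarrow> wprod G xs \<in> carrier G"
  by (induction xs) (auto simp: wprod_def)

lemma wprod_Cons: "wprod G (x # xs) = x \<otimes> wprod G xs"
  by (simp add: wprod_def)

lemma wprod_append:
  "set xs \<subseteq> carrier G \<Longrightarrow> set ys \<subseteq> carrier G \<Longrightarrow> wprod G (xs @ ys) = wprod G xs \<otimes> wprod G ys"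
proof (induction xs)
  case Nil
  then show ?case using wprod_closed[of ys] by (simp add: wprod_def)
next
  case (Cons x xs)
  then show ?case using wprod_closed[of xs] wprod_closed[of ys]
    by (simp add: wprod_Cons m_assoc)
qed

lemma wball_closed: "Y \<subseteq> carrier G \<Longrightarrow> wball G Y n \<subseteq> carrier G"
  unfolding wball_def using wprod_closed by auto

lemma wball_mono: "n \<le> k \<Longrightarrow> wball G Y n \<subseteq> wball G Y k"
  unfolding wball_def by (rule image_mono) auto

lemma generate_eq_wprod:
  assumes "Y \<subseteq> carrier G" and "\<forall>x\<in>Y. inv x \<in> Y"
  shows "generate G Y = wprod G ` {xs. set xs \<subseteq> Y}"
proof
  show "generate G Y \<subseteq> wprod G ` {xs. set xs \<subseteq> Y}"
  proof
    fix g assume "g \<in> generate G Y"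
    then show "g \<in> wprod G ` {xs. set xs \<subseteq> Y}"
    proof induction
      case one
      have "wprod G [] = \<one>" by (simp add: wprod_def)
      then show ?case by (metis (mono_tags) empty_set empty_subsetI image_eqI mem_Collect_eq)
    next
      case (incl h)
      have "wprod G [h] = h" using incl assms by (auto simp: wprod_def)
      then show ?case using incl by (intro image_eqI[of _ _ "[h]"]) auto
    next
      case (inv h)
      have "wprod G [inv h] = inv h" using inv assms by (auto simp: wprod_def)
      then show ?case using inv assms by (intro image_eqI[of _ _ "[inv h]"]) auto
    next
      case (eng h1 h2)
      then obtain xs ys where "h1 = wprod G xs" "h2 = wprod G ys" "set xs \<subseteq> Y" "set ys \<subseteq> Y"
        by auto
      then show ?case using wprod_append[of xs ys] assms(1)
        by (intro image_eqI[of _ _ "xs @ ys"]) auto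
    qed
  qed
  have "wprod G xs \<in> generate G Y" if "set xs \<subseteq> Y" for xs
    using that
  proof (induction xs)
    case Nil
    then show ?case by (simp add: wprod_def generate.one)
  next
    case (Cons x xs)
    then show ?case unfolding wprod_Cons by (intro generate.eng) (auto intro: generate.incl)
  qed
  then show "wprod G ` {xs. set xs \<subseteq> Y} \<subseteq> generate G Y" by auto
qed

lemma wdist_le:
  assumes "set xs \<subseteq> Y" and "h = g \<otimes> wprod G xs"
  shows "wdist G Y g h \<le> length xs"
  unfolding wdist_def by (rule Least_le) (use assms in \<open>auto simp: wprod_def\<close>)

lemma fin_gen_set_wprod:
  assumes "fin_gen_set G Y" and "g \<in> carrier G"
  obtains xs where "set xs \<subseteq> Y" and "g = wprod G xs"
  using generate_eq_wprod[of Y] assms unfolding fin_gen_set_def by auto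

text \<open>\<open>wdist\<close> is a least number and meaningful only if some word exists;
  generation supplies one, so the least length is attained.\<close>

lemma wdist_wprod:
  assumes "fin_gen_set G Y" and "g \<in> carrier G" and "h \<in> carrier G"
  obtains xs where "length xs = wdist G Y g h" and "set xs \<subseteq> Y" and "h = g \<otimes> wprod G xs"
proof -
  obtain ys where "set ys \<subseteq> Y" "inv g \<otimes> h = wprod G ys"
    using fin_gen_set_wprod[of Y "inv g \<otimes> h"] assms by auto
  then have "\<exists>n xs. length xs = n \<and> set xs \<subseteq> Y \<and> h = g \<otimes> foldr (\<otimes>) xs \<one>"
    using assms by (metis inv_solve_left wprod_def m_closed inv_closed)
  from LeastI_ex[OF this] show ?thesis
    using that unfolding wdist_def wprod_def by auto
qed

lemma finite_subset_wball:
  assumes "fin_gen_set G Y" and "finite F" and "F \<subseteq> carrier G"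
  shows "\<exists>n. F \<subseteq> wball G Y n"
  using assms(2,3)
proof (induction F)
  case empty
  then show ?case by simp
next
  case (insert f F)
  then obtain n where n: "F \<subseteq> wball G Y n" by auto
  obtain xs where xs: "set xs \<subseteq> Y" "f = wprod G xs"
    using fin_gen_set_wprod[OF assms(1), of f] insert.prems by auto
  have "f \<in> wball G Y (max n (length xs))" unfolding wball_def using xs by auto
  moreover have "F \<subseteq> wball G Y (max n (length xs))" using n wball_mono[of n "max n (length xs)"] by auto
  ultimately show ?case by blast
qed

end

section \<open>Paths with bounded jumps versus steps by a finite set\<close>

lemma path_rtrancl:
  assumes "ps \<noteq> []" and "\<And>i. Suc i < length ps \<Longrightarrow> (ps ! i, ps ! Suc i) \<in> R"
  shows "(hd ps, last ps) \<in> R\<^sup>*"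
  using assms
proof (induction ps rule: induct_list012)
  case (3 x y zs)
  have "(x, y) \<in> R" using "3.prems"(2)[of 0] by simp
  moreover have "(hd (y # zs), last (y # zs)) \<in> R\<^sup>*"
  proof (rule "3.IH"(2))
    show "((y # zs) ! i, (y # zs) ! Suc i) \<in> R" if "Suc i < length (y # zs)" for i
      using "3.prems"(2)[of "Suc i"] that by simp
  qed simp
  ultimately show ?case by simp
qed auto

text \<open>Word distances are integers, so the real bound \<open>r\<close> may be replaced by its
  floor, and a shortest word between neighbours is a multiplier in the ball of that radius.\<close>

lemma rpath_imp_fsteps:
  fixes G (structure)
  assumes "group G" and "fin_gen_set G Y" and "rpath G Y r ps" and "set ps \<subseteq> S"
  shows "(hd ps, last ps) \<in> (fstep G (wball G Y (nat \<lfloor>r\<rfloor>)) S)\<^sup>*"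
proof (rule path_rtrancl)
  interpret group G by fact
  show "ps \<noteq> []" using assms(3) unfolding rpath_def by simp
  fix i assume i: "Suc i < length ps"
  have c: "ps ! i \<in> carrier G" "ps ! Suc i \<in> carrier G" "ps ! i \<in> S" "ps ! Suc i \<in> S"
    using assms(3,4) i nth_mem[of i ps] nth_mem[of "Suc i" ps] unfolding rpath_def by auto
  obtain xs where xs: "length xs = wdist G Y (ps ! i) (ps ! Suc i)" "set xs \<subseteq> Y"
    "ps ! Suc i = ps ! i \<otimes> wprod G xs"
    using wdist_wprod[OF assms(2) c(1,2)] by blast
  have "real (length xs) \<le> r" using assms(3) i xs(1) unfolding rpath_def by auto
  then have "length xs \<le> nat \<lfloor>r\<rfloor>" by linarith
  then have "wprod G xs \<in> wball G Y (nat \<lfloor>r\<rfloor>)" unfolding wball_def using xs by auto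
  then show "(ps ! i, ps ! Suc i) \<in> fstep G (wball G Y (nat \<lfloor>r\<rfloor>)) S"
    unfolding fstep_def using c xs by auto
qed

lemma fsteps_imp_rpath:
  fixes G (structure)
  assumes "group G" and "S \<subseteq> carrier G" and "u \<in> S"
    and "(u, v) \<in> (fstep G (wball G Y n) S)\<^sup>*"
  shows "\<exists>ps. rpath G Y n ps \<and> set ps \<subseteq> S \<and> hd ps = u \<and> last ps = v"
  using assms(4)
proof (induction rule: rtrancl_induct)
  case base
  show ?case by (rule exI[of _ "[u]"]) (use assms in \<open>auto simp: rpath_def\<close>)
next
  case (step v w)
  interpret group G by fact
  obtain ps where ps: "rpath G Y n ps" "set ps \<subseteq> S" "hd ps = u" "last ps = v" using step by auto
  obtain xs where xs: "set xs \<subseteq> Y" "length xs \<le> n" "w = v \<otimes> wprod G xs" and w: "w \<in> S"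
    using step(2) unfolding fstep_def wball_def by auto
  have d: "wdist G Y v w \<le> n" using wdist_le[OF xs(1,3)] xs(2) by simp
  have "ps \<noteq> []" using ps unfolding rpath_def by auto
  have "rpath G Y n (ps @ [w])"
    unfolding rpath_def
  proof (intro conjI allI impI)
    show "set (ps @ [w]) \<subseteq> carrier G" using ps w assms(2) by auto
    fix i assume i: "Suc i < length (ps @ [w])"
    show "real (wdist G Y ((ps @ [w]) ! i) ((ps @ [w]) ! Suc i)) \<le> real n"
    proof (cases "Suc i < length ps")
      case True
      then show ?thesis using ps(1) unfolding rpath_def by (auto simp: nth_append)
    next
      case False
      then have "Suc i = length ps" using i by simp
      then have "i = length ps - 1" by simp
      then have "ps ! i = v" using ps(4) \<open>ps \<noteq> []\<close> last_conv_nth by metis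
      then show ?thesis using d \<open>Suc i = length ps\<close> by (auto simp: nth_append)
    qed
  qed simp
  then show ?case using ps w \<open>ps \<noteq> []\<close> by (intro exI[of _ "ps @ [w]"]) auto
qed

text \<open>A path that avoids the negative cone avoids every swamp, because swamps consist of
  negative elements.\<close>

lemma hucha_wrt_finite_steps:
  assumes "group G" and "hucha_wrt G {H}" and "pos_cone G P" and "finite F" and "F \<subseteq> carrier G"
  shows "\<exists>u\<in>P. \<exists>v\<in>P. (u, v) \<notin> (fstep G F (carrier G - inv_set G P))\<^sup>*"
proof -
  interpret group G by fact
  obtain Y where Y: "fin_gen_set G Y" "\<And>r. r > 0 \<Longrightarrow> \<exists>S. neg_swamp G Y P H r S"
    using assms(2,3) unfolding hucha_wrt_def by auto
  obtain n where n: "F \<subseteq> wball G Y n" using finite_subset_wball[OF Y(1) assms(4,5)] by blast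
  \<comment> \<open>The width is \<open>Suc n\<close> because swamps are provided only for positive
    \<open>r\<close>, and \<open>n\<close> may be zero.\<close>
  obtain S where "neg_swamp G Y P H (real (Suc n)) S" using Y(2)[of "real (Suc n)"] by auto
  then obtain u v where uv: "S \<subseteq> inv_set G P" "u \<in> P" "v \<in> P"
    "r_disconnects G Y (real (Suc n)) S {u} {v}"
    unfolding neg_swamp_def by auto
  have "False" if a: "(u, v) \<in> (fstep G F (carrier G - inv_set G P))\<^sup>*"
  proof -
    have "(u, v) \<in> (fstep G (wball G Y (Suc n)) (carrier G - inv_set G P))\<^sup>*"
      by (rule fstep_rtrancl_mono[OF a]) (use n wball_mono[of n "Suc n" Y] in auto)
    moreover have "u \<in> carrier G - inv_set G P" using assms(3) uv(2) unfolding pos_cone_def by auto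
    ultimately obtain ps where "rpath G Y (Suc n) ps" "set ps \<subseteq> carrier G - inv_set G P"
      "hd ps = u" "last ps = v"
      using fsteps_imp_rpath[OF assms(1), of "carrier G - inv_set G P" u v Y "Suc n"] by auto
    then show False using uv unfolding r_disconnects_def by blast
  qed
  then show ?thesis using uv by blast
qed

text \<open>In this form the Prieto property transfers along injective homomorphisms without a
  choice of generators for the image.\<close>

definition prieto_fin :: "('a, 'b) monoid_scheme \<Rightarrow> bool" where
  "prieto_fin G \<longleftrightarrow> (\<forall>P. pos_cone G P \<longrightarrow>
     (\<exists>F. finite F \<and> F \<subseteq> carrier G \<and> (\<forall>u\<in>P. \<forall>v\<in>P. (u, v) \<in> (fstep G F P)\<^sup>*)))"

lemma prieto_imp_prieto_fin:
  assumes "prieto G"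
  shows "prieto_fin G"
  unfolding prieto_fin_def
proof (intro allI impI)
  fix P assume P: "pos_cone G P"
  interpret group G using assms unfolding prieto_def left_orderable_def by simp
  obtain Y r where Y: "fin_gen_set G Y"
    and r: "\<And>u v. u \<in> P \<Longrightarrow> v \<in> P \<Longrightarrow> \<exists>ps. rpath G Y r ps \<and> set ps \<subseteq> P \<and> hd ps = u \<and> last ps = v"
    using assms P unfolding prieto_def coarsely_connected_def by metis
  have "(u, v) \<in> (fstep G (wball G Y (nat \<lfloor>r\<rfloor>)) P)\<^sup>*" if "u \<in> P" "v \<in> P" for u v
    using r[OF that] rpath_imp_fsteps[OF is_group Y, of r] by auto
  moreover have "finite (wball G Y (nat \<lfloor>r\<rfloor>))" "wball G Y (nat \<lfloor>r\<rfloor>) \<subseteq> carrier G"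
    using Y finite_wball wball_closed unfolding fin_gen_set_def by auto
  ultimately show "\<exists>F. finite F \<and> F \<subseteq> carrier G \<and> (\<forall>u\<in>P. \<forall>v\<in>P. (u, v) \<in> (fstep G F P)\<^sup>*)"
    by blast
qed

text \<open>Cosets of the trivial subgroup are points, so the pair \<open>u\<close>,
  \<open>v\<close> separated inside \<open>P\<close> also serves as the pair of separated
  cosets.\<close>

lemma huchaI:
  fixes G (structure)
  assumes "left_orderable G" and "fin_gen_set G Y"
    and steps: "\<And>P F. pos_cone G P \<Longrightarrow> finite F \<Longrightarrow> F \<subseteq> carrier G \<Longrightarrow>
      \<exists>u\<in>P. \<exists>v\<in>P. (u, v) \<notin> (fstep G F (carrier G - inv_set G P))\<^sup>*"
  shows "hucha G"
proof -
  interpret group G using assms unfolding left_orderable_def by simp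
  have "\<exists>S. neg_swamp G Y P {\<one>} r S" if P: "pos_cone G P" for P r
  proof -
    have F: "finite (wball G Y (nat \<lfloor>r\<rfloor>))" "wball G Y (nat \<lfloor>r\<rfloor>) \<subseteq> carrier G"
      using assms(2) finite_wball wball_closed unfolding fin_gen_set_def by auto
    obtain u v where uv: "u \<in> P" "v \<in> P"
      "(u, v) \<notin> (fstep G (wball G Y (nat \<lfloor>r\<rfloor>)) (carrier G - inv_set G P))\<^sup>*"
      using steps[OF P F] by blast
    have c: "u \<in> carrier G" "v \<in> carrier G" using P uv unfolding pos_cone_def by auto
    have "set ps \<inter> inv_set G P \<noteq> {}" if "rpath G Y r ps" "hd ps = u" "last ps = v" for ps
    proof
      assume "set ps \<inter> inv_set G P = {}"
      then have "set ps \<subseteq> carrier G - inv_set G P" using that(1) unfolding rpath_def by auto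
      from rpath_imp_fsteps[OF is_group assms(2) that(1) this] show False using uv that by simp
    qed
    then have d: "r_disconnects G Y r (inv_set G P) {u} {v}"
      unfolding r_disconnects_def by auto
    moreover have "u <# {\<one>} = {u}" "v <# {\<one>} = {v}" using c by (auto simp: l_coset_def)
    ultimately show ?thesis unfolding neg_swamp_def using uv c by (metis order_refl)
  qed
  moreover have "subgroup {\<one>} G" by (rule triv_subgroup)
  ultimately show ?thesis using assms(1,2) unfolding hucha_def hucha_wrt_def by auto
qed


section \<open>Positive cones\<close>

text \<open>The elements \<ge> 1 of the left-invariant order, in which
  \<open>inv f \<otimes> g \<in> nneg G P\<close> says \<open>f \<le> g\<close>. The complement form
  matches the points that a path avoiding the negative cone may visit.\<close>

definition nneg :: "('a, 'b) monoid_scheme \<Rightarrow> 'a set \<Rightarrow> 'a set" where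
  "nneg G P = carrier G - inv_set G P"

context group
begin

lemma mult_inv_cancel: "x \<in> carrier G \<Longrightarrow> y \<in> carrier G \<Longrightarrow> x \<otimes> (inv x \<otimes> y) = y"
  and inv_mult_cancel: "x \<in> carrier G \<Longrightarrow> y \<in> carrier G \<Longrightarrow> inv x \<otimes> (x \<otimes> y) = y"
  by (simp_all add: m_assoc[symmetric])

text \<open>Pointwise conditions on inverses replace \<open>inv_set\<close>; in this form a cone
  pulls back along an injective homomorphism.\<close>

lemma pos_cone_iff:
  "pos_cone G P \<longleftrightarrow> P \<subseteq> carrier G \<and> (\<forall>x\<in>P. \<forall>y\<in>P. x \<otimes> y \<in> P) \<and> \<one> \<notin> P \<and>
     (\<forall>g\<in>carrier G. g \<noteq> \<one> \<longrightarrow> g \<in> P \<or> inv g \<in> P) \<and> (\<forall>g\<in>P. inv g \<notin> P)"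
  (is "?L \<longleftrightarrow> ?R")
proof
  assume L: ?L
  have "inv g \<notin> P" if "g \<in> P" for g
    using L that unfolding pos_cone_def inv_set_def by (metis (no_types) disjoint_iff imageI inv_inv subset_iff)
  moreover have "g \<in> P \<or> inv g \<in> P" if "g \<in> carrier G" "g \<noteq> \<one>" for g
  proof -
    have "g \<in> P \<or> g \<in> inv_set G P" using L that unfolding pos_cone_def by auto
    then show ?thesis using L unfolding pos_cone_def inv_set_def by auto
  qed
  ultimately show ?R using L unfolding pos_cone_def by auto
next
  assume R: ?R
  have "g \<in> inv_set G P \<longleftrightarrow> g \<in> carrier G \<and> inv g \<in> P" for g
    using R unfolding inv_set_def by (metis (no_types, lifting) image_iff inv_closed inv_inv subset_iff)
  then show ?L unfolding pos_cone_def using R by auto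
qed

context
  fixes P assumes P: "pos_cone G P"
begin

lemma cone_closed: "g \<in> P \<Longrightarrow> g \<in> carrier G"
  using P unfolding pos_cone_def by auto

lemma nneg_iff: "g \<in> nneg G P \<longleftrightarrow> g \<in> P \<or> g = \<one>"
  using P unfolding pos_cone_def nneg_def by auto

lemma nneg_closed: "g \<in> nneg G P \<Longrightarrow> g \<in> carrier G"
  unfolding nneg_def by auto

lemma nneg_mult: "g \<in> nneg G P \<Longrightarrow> h \<in> nneg G P \<Longrightarrow> g \<otimes> h \<in> nneg G P"
  using P cone_closed unfolding nneg_iff pos_cone_def by auto

lemma cone_mult_nneg: "g \<in> P \<Longrightarrow> h \<in> nneg G P \<Longrightarrow> g \<otimes> h \<in> P"
  using P cone_closed[of g] unfolding nneg_iff pos_cone_def by auto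

lemma inv_mem_cone_iff: "g \<in> carrier G \<Longrightarrow> inv g \<in> P \<longleftrightarrow> g \<notin> nneg G P"
  using P unfolding nneg_iff pos_cone_iff by (metis inv_one)

lemma nneg_total: "g \<in> carrier G \<Longrightarrow> g \<in> nneg G P \<or> inv g \<in> nneg G P"
  using inv_mem_cone_iff nneg_iff by blast

lemma nneg_trans:
  assumes "inv f \<otimes> g \<in> nneg G P" and "inv g \<otimes> h \<in> nneg G P"
    and "f \<in> carrier G" and "g \<in> carrier G" and "h \<in> carrier G"
  shows "inv f \<otimes> h \<in> nneg G P"
proof -
  have "inv f \<otimes> h = (inv f \<otimes> g) \<otimes> (inv g \<otimes> h)"
    using assms by (simp add: m_assoc mult_inv_cancel inv_mult_cancel)
  then show ?thesis using nneg_mult[OF assms(1,2)] by simp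
qed

text \<open>The order is total, so the larger of the new element and the previous bound
  works.\<close>

lemma finite_upper_bound:
  assumes "finite F" and "F \<subseteq> carrier G"
  shows "\<exists>m\<in>carrier G. \<forall>f\<in>F. inv f \<otimes> m \<in> nneg G P"
  using assms
proof (induction F)
  case (insert f F)
  then obtain m where m: "m \<in> carrier G" "\<forall>f\<in>F. inv f \<otimes> m \<in> nneg G P" by auto
  have f: "f \<in> carrier G" "F \<subseteq> carrier G" using insert by auto
  have "inv (inv m \<otimes> f) = inv f \<otimes> m" using f m by (simp add: inv_mult_group)
  then consider "inv f \<otimes> m \<in> nneg G P" | "inv m \<otimes> f \<in> nneg G P"
    using nneg_total[of "inv m \<otimes> f"] f m by auto
  then show ?case
  proof cases
    case 1
    then show ?thesis using m by auto
  next
    case 2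
    then have "\<forall>g\<in>F. inv g \<otimes> f \<in> nneg G P" using m f nneg_trans by blast
    then show ?thesis using f by (intro bexI[of _ f]) (auto simp: nneg_iff)
  qed
qed auto

end

section \<open>Cones and step paths under homomorphisms, translation and refinement\<close>

lemma pos_cone_vimage:
  assumes P: "pos_cone G P" and H: "group H" and f: "f \<in> hom H G" "inj_on f (carrier H)"
  shows "pos_cone H {a \<in> carrier H. f a \<in> P}"
    and "nneg H {a \<in> carrier H. f a \<in> P} = {a \<in> carrier H. f a \<in> nneg G P}"
proof -
  interpret H: group H by fact
  interpret f: group_hom H G f using H is_group f(1) by (simp add: group_hom_def group_hom_axioms_def)
  have ker: "f a = \<one> \<longleftrightarrow> a = \<one>\<^bsub>H\<^esub>" if "a \<in> carrier H" for a
    using that f.hom_one f(2) H.one_closed by (metis inj_onD)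
  show *: "pos_cone H {a \<in> carrier H. f a \<in> P}"
    using P ker unfolding pos_cone_iff H.pos_cone_iff by auto
  show "nneg H {a \<in> carrier H. f a \<in> P} = {a \<in> carrier H. f a \<in> nneg G P}"
    using nneg_iff[OF P] H.nneg_iff[OF *] ker by auto
qed

text \<open>Conjugates of a cone are handled as its preimages under this homomorphism, by
  \<open>pos_cone_vimage\<close>.\<close>

lemma conj_hom:
  assumes "y \<in> carrier G"
  shows "(\<lambda>g. inv y \<otimes> g \<otimes> y) \<in> hom G G" and "inj_on (\<lambda>g. inv y \<otimes> g \<otimes> y) (carrier G)"
proof -
  show "(\<lambda>g. inv y \<otimes> g \<otimes> y) \<in> hom G G"
    using assms by (auto simp: hom_def m_assoc mult_inv_cancel inv_mult_cancel)
  show "inj_on (\<lambda>g. inv y \<otimes> g \<otimes> y) (carrier G)"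
    using assms by (auto simp: inj_on_def)
qed

lemma fsteps_translate:
  assumes "(u, v) \<in> (fstep G F S)\<^sup>*" and "a \<in> carrier G" and "S \<subseteq> carrier G" and "F \<subseteq> carrier G"
    and "\<And>s. s \<in> S \<Longrightarrow> a \<otimes> s \<in> S'"
  shows "(a \<otimes> u, a \<otimes> v) \<in> (fstep G F S')\<^sup>*"
  using assms(1)
proof induction
  case (step v w)
  then obtain f where f: "v \<in> S" "w \<in> S" "f \<in> F" "w = v \<otimes> f" unfolding fstep_def by auto
  then have "v \<in> carrier G" "f \<in> carrier G" using assms by auto
  then have "a \<otimes> w = (a \<otimes> v) \<otimes> f" using f(4) assms(2) by (simp add: m_assoc)
  then have "(a \<otimes> v, a \<otimes> w) \<in> fstep G F S'" unfolding fstep_def using assms(5) f(1-3) by blast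
  then show ?case using step by auto
qed simp

lemma fsteps_sym:
  assumes "(u, v) \<in> (fstep G F S)\<^sup>*" and "S \<subseteq> carrier G" and "F \<subseteq> carrier G" and "\<And>f. f \<in> F \<Longrightarrow> inv f \<in> F"
  shows "(v, u) \<in> (fstep G F S)\<^sup>*"
proof -
  have "sym (fstep G F S)"
  proof (rule symI)
    fix g h assume "(g, h) \<in> fstep G F S"
    then obtain f where f: "g \<in> S" "h \<in> S" "f \<in> F" "h = g \<otimes> f" unfolding fstep_def by auto
    then have "g \<in> carrier G" "f \<in> carrier G" using assms(2,3) by auto
    then have "g = h \<otimes> inv f" unfolding f(4) by (simp add: m_assoc)
    then show "(h, g) \<in> fstep G F S" unfolding fstep_def using f assms(4) by auto
  qed
  then show ?thesis using assms(1) sym_rtrancl[of "fstep G F S"] by (meson symE)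
qed

text \<open>A step by \<open>f\<close> is spelled out letter by letter. The new intermediate points
  are \<open>g\<close> times a prefix of a word of length at most \<open>n\<close>, so they lie in
  \<open>S\<close> times the ball, which \<open>Q\<close> contains.\<close>

lemma fsteps_refine:
  assumes steps: "(u, v) \<in> (fstep G F S)\<^sup>*"
    and Y: "Y \<subseteq> carrier G" and S: "S \<subseteq> carrier G" and F: "F \<subseteq> wball G Y n"
    and Q: "\<And>g w. g \<in> S \<Longrightarrow> w \<in> wball G Y n \<Longrightarrow> g \<otimes> w \<in> Q"
  shows "(u, v) \<in> (fstep G Y Q)\<^sup>*"
  using steps
proof induction
  case (step v w)
  then obtain f where f: "v \<in> S" "w \<in> S" "f \<in> F" "w = v \<otimes> f" unfolding fstep_def by auto
  then obtain xs where xs: "set xs \<subseteq> Y" "length xs \<le> n" "f = wprod G xs"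
    using F unfolding wball_def by auto
  have v: "v \<in> carrier G" using f S by auto
  have "(v, v \<otimes> wprod G xs) \<in> (fstep G Y Q)\<^sup>*"
    using xs(1,2)
  proof (induction xs rule: rev_induct)
    case Nil
    then show ?case using v by (simp add: wprod_def)
  next
    case (snoc x xs)
    have *: "v \<otimes> wprod G ys \<in> Q" if "set ys \<subseteq> Y" "length ys \<le> n" for ys
      using Q[OF f(1), of "wprod G ys"] that unfolding wball_def by auto
    have x: "x \<in> Y" "x \<in> carrier G" "set xs \<subseteq> carrier G" using snoc.prems Y by auto
    have "wprod G (xs @ [x]) = wprod G xs \<otimes> x"
      using wprod_append[of xs "[x]"] x by (simp add: wprod_def)
    then have "v \<otimes> wprod G (xs @ [x]) = (v \<otimes> wprod G xs) \<otimes> x"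
      using x v wprod_closed[of xs] by (simp add: m_assoc)
    then have "(v \<otimes> wprod G xs, v \<otimes> wprod G (xs @ [x])) \<in> fstep G Y Q"
      unfolding fstep_def using *[of xs] *[of "xs @ [x]"] snoc.prems x(1) by auto
    then show ?case using snoc by (auto intro: rtrancl_into_rtrancl)
  qed
  then show ?case using step(3) xs(3) f(4) by (metis rtrancl_trans)
qed simp

text \<open>Connectivity of the cone says nothing about the identity, so some positive
  \<open>p\<close> is added as a step from it. With an empty cone the identity is the only
  nonnegative element.\<close>

lemma coset_fsteps:
  assumes P: "pos_cone G P" and "prieto_fin G"
  shows "\<exists>F. finite F \<and> F \<subseteq> carrier G \<and> (\<forall>k\<in>nneg G P. (\<one>, k) \<in> (fstep G F (nneg G P))\<^sup>*)"
proof (cases "P = {}")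
  case True
  then have "nneg G P = {\<one>}" using nneg_iff[OF P] by auto
  then show ?thesis by (intro exI[of _ "{}"]) auto
next
  case False
  then obtain p where p: "p \<in> P" by auto
  obtain F where F: "finite F" "F \<subseteq> carrier G" "\<And>u v. u \<in> P \<Longrightarrow> v \<in> P \<Longrightarrow> (u, v) \<in> (fstep G F P)\<^sup>*"
    using assms unfolding prieto_fin_def by metis
  have "(\<one>, k) \<in> (fstep G (insert p F) (nneg G P))\<^sup>*" if "k \<in> nneg G P" for k
  proof (cases "k = \<one>")
    case False
    then have "(p, k) \<in> (fstep G F P)\<^sup>*" using F(3) p that nneg_iff[OF P] by auto
    then have "(p, k) \<in> (fstep G (insert p F) (nneg G P))\<^sup>*"
      by (rule fstep_rtrancl_mono) (auto simp: nneg_iff[OF P])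
    moreover have "(\<one>, p) \<in> fstep G (insert p F) (nneg G P)"
      using p nneg_iff[OF P] cone_closed[OF P] unfolding fstep_def by auto
    ultimately show ?thesis by auto
  qed simp
  then show ?thesis using F(1,2) p cone_closed[OF P] by (intro exI[of _ "insert p F"]) auto
qed

end

text \<open>Cones of the image pull back to \<open>H\<close> and step paths push forward. This
  covers the second edge group of an HNN extension, the image of \<open>C\<close> under
  \<open>\<phi>\<close>.\<close>

lemma prieto_fin_image:
  fixes A (structure)
  assumes H: "group H" and A: "group A" and f: "f \<in> hom H A" "inj_on f (carrier H)" and pr: "prieto_fin H"
  shows "prieto_fin (A\<lparr>carrier := f ` carrier H\<rparr>)"
  unfolding prieto_fin_def
proof (intro allI impI)
  let ?I = "A\<lparr>carrier := f ` carrier H\<rparr>"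
  interpret f: group_hom H A f using H A f by (simp add: group_hom_def group_hom_axioms_def)
  have I: "group ?I" using f.H.subgroup_imp_group[OF f.img_is_subgroup] .
  have fI: "f \<in> hom H ?I" by (rule homI) auto
  fix P assume P: "pos_cone ?I P"
  define P0 where "P0 = {a \<in> carrier H. f a \<in> P}"
  have P0: "pos_cone H P0" unfolding P0_def using group.pos_cone_vimage(1)[OF I P H fI f(2)] .
  have PI: "P = f ` P0" using P unfolding P0_def pos_cone_def by auto
  obtain F where F: "finite F" "F \<subseteq> carrier H" "\<And>u v. u \<in> P0 \<Longrightarrow> v \<in> P0 \<Longrightarrow> (u, v) \<in> (fstep H F P0)\<^sup>*"
    using pr P0 unfolding prieto_fin_def by metis
  have "(f u, f v) \<in> (fstep ?I (f ` F) P)\<^sup>*" if "(u, v) \<in> (fstep H F P0)\<^sup>*" for u v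
    using that
  proof induction
    case (step v w)
    then obtain x where x: "v \<in> P0" "w \<in> P0" "x \<in> F" "w = v \<otimes>\<^bsub>H\<^esub> x" unfolding fstep_def by auto
    then have "v \<in> carrier H" "x \<in> carrier H" using F(2) unfolding P0_def by auto
    then have "f w = f v \<otimes> f x" using x(4) by simp
    moreover have "f v \<in> P" "f w \<in> P" unfolding PI using x(1,2) by blast+
    ultimately have "(f v, f w) \<in> fstep ?I (f ` F) P" unfolding fstep_def using x(3) by auto
    then show ?case using step by auto
  qed simp
  then have "\<forall>u\<in>P. \<forall>v\<in>P. (u, v) \<in> (fstep ?I (f ` F) P)\<^sup>*" using F(3) unfolding PI by blast
  then show "\<exists>F. finite F \<and> F \<subseteq> carrier ?I \<and> (\<forall>u\<in>P. \<forall>v\<in>P. (u, v) \<in> (fstep ?I F P)\<^sup>*)"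
    using F(1,2) by (intro exI[of _ "f ` F"]) auto
qed

lemma rtrancl_crossing:
  assumes "(u, v) \<in> R\<^sup>*" and "u \<in> H" and "v \<notin> H"
  shows "\<exists>(a, b)\<in>R. a \<in> H \<and> b \<notin> H"
  using assms by (induction rule: rtrancl_induct) auto

section \<open>Subgroups acting as a vertex of a tree\<close>

text \<open>\<open>lab g\<close> names the branch of the tree at the vertex \<open>\<iota> A\<close> that contains \<open>g\<close>, and the coset
  \<open>Z l\<close> is where the branch \<open>l\<close> is attached.\<close>

locale tree_labelling = group G for G :: "('g, 'h) monoid_scheme" (structure) +
  fixes A :: "('a, 'b) monoid_scheme" and \<iota> :: "'a \<Rightarrow> 'g" and Y and lab :: "'g \<Rightarrow> 'l option"
    and Z and \<K>
  assumes A: "group A"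
    and hom: "\<iota> \<in> hom A G" and inj: "inj_on \<iota> (carrier A)"
    and gens: "fin_gen_set G Y"
    and lab_None: "\<And>g. g \<in> carrier G \<Longrightarrow> lab g = None \<longleftrightarrow> g \<in> \<iota> ` carrier A"
    and exit: "\<And>g y l. g \<in> carrier G \<Longrightarrow> y \<in> Y \<Longrightarrow> lab g = None \<Longrightarrow> lab (g \<otimes> y) = Some l
      \<Longrightarrow> g \<in> \<iota> ` Z l"
    and stay: "\<And>g y l l'. g \<in> carrier G \<Longrightarrow> y \<in> Y \<Longrightarrow> lab g = Some l \<Longrightarrow> lab (g \<otimes> y) = Some l'
      \<Longrightarrow> l' = l"
    and coset: "\<And>g l. g \<in> carrier G \<Longrightarrow> lab g = Some l \<Longrightarrow> \<exists>a\<in>carrier A. \<exists>K\<in>\<K>. Z l = a <#\<^bsub>A\<^esub> K"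
    and finite_K: "finite \<K>"
    and K: "\<And>K. K \<in> \<K> \<Longrightarrow> subgroup K A \<and> prieto_fin (A\<lparr>carrier := K\<rparr>)"
    and A_steps: "\<And>P F. pos_cone A P \<Longrightarrow> finite F \<Longrightarrow> F \<subseteq> carrier A \<Longrightarrow>
      \<exists>u\<in>P. \<exists>v\<in>P. (u, v) \<notin> (fstep A F (nneg A P))\<^sup>*"
    and halves: "\<iota> ` carrier A \<noteq> carrier G \<Longrightarrow> \<exists>l0. \<exists>f\<in>carrier G. \<exists>f1\<in>carrier G. \<exists>f2\<in>carrier G.
      (\<forall>h\<in>carrier G. lab h = Some l0 \<longrightarrow> lab (f \<otimes> h) \<noteq> Some l0) \<and>
      (\<forall>g\<in>carrier G. \<exists>h\<in>carrier G. lab h = Some l0 \<and> (g = f1 \<otimes> h \<or> g = f2 \<otimes> h))"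
begin

sublocale A: group A by (rule A)

sublocale \<iota>: group_hom A G \<iota>
  using A is_group hom by (simp add: group_hom_def group_hom_axioms_def)

lemma Y_closed: "Y \<subseteq> carrier G" "finite Y" "y \<in> Y \<Longrightarrow> inv y \<in> Y"
  using gens unfolding fin_gen_set_def by auto

text \<open>\<open>Y\<close> is symmetric, so an entry read backwards is an exit.\<close>

lemma enter:
  assumes "g \<in> carrier G" and "y \<in> Y" and "lab g = Some l" and "lab (g \<otimes> y) = None"
  shows "g \<otimes> y \<in> \<iota> ` Z l"
proof -
  have y: "y \<in> carrier G" using Y_closed assms by auto
  have "(g \<otimes> y) \<otimes> inv y = g" using assms y by (simp add: m_assoc)
  then show ?thesis using exit[of "g \<otimes> y" "inv y" l] assms y Y_closed(3) by auto
qed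

lemma Z_closed:
  assumes "g \<in> carrier G" and "lab g = Some l"
  shows "Z l \<subseteq> carrier A"
proof -
  obtain a K where "a \<in> carrier A" "K \<in> \<K>" and Z: "Z l = a <#\<^bsub>A\<^esub> K" using coset[OF assms] by blast
  then have "K \<subseteq> carrier A" using K subgroup.subset by blast
  then show ?thesis unfolding Z using A.l_coset_subset_G \<open>a \<in> carrier A\<close> by simp
qed

text \<open>\<open>A_steps\<close> is applied to the conjugated cone \<open>PA\<close> and a step
  set \<open>FA\<close> built from \<open>F\<close>; the unreachable pair found there is moved into
  \<open>P\<close> by conjugation with \<open>y0\<close>.\<close>

lemma cofinal_case:
  assumes P: "pos_cone G P" and F: "finite F" "F \<subseteq> carrier G"
    and cof: "\<And>m. m \<in> carrier G \<Longrightarrow> \<exists>a\<in>carrier A. inv m \<otimes> \<iota> a \<in> nneg G P"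
  shows "\<exists>u\<in>P. \<exists>v\<in>P. (u, v) \<notin> (fstep G F (nneg G P))\<^sup>*"
proof -
  note Pc = cone_closed[OF P] and Niff = nneg_iff[OF P] and Nc = nneg_closed[OF P] and Nm = nneg_mult[OF P]
  obtain n where n: "F \<subseteq> wball G Y n" using finite_subset_wball[OF gens F] by auto
  have W: "finite (wball G Y n)" "wball G Y n \<subseteq> carrier G"
    using finite_wball wball_closed Y_closed by auto
  \<comment> \<open>The inverses of the ball are bounded because
    \<open>inv w \<le> m \<le> y\<close> amounts to \<open>1 \<le> w y\<close> for every
    \<open>w\<close> in the ball.\<close>
  obtain m where m: "m \<in> carrier G" "\<forall>f\<in>m_inv G ` wball G Y n. inv f \<otimes> m \<in> nneg G P"
    using finite_upper_bound[OF P, of "m_inv G ` wball G Y n"] W by auto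
  obtain y0 where y0: "y0 \<in> carrier A" "inv m \<otimes> \<iota> y0 \<in> nneg G P" using cof[OF m(1)] by auto
  define y where "y = \<iota> y0"
  have y: "y \<in> carrier G" unfolding y_def using y0 by auto
  have wy: "w \<otimes> y \<in> nneg G P" if "w \<in> wball G Y n" for w
  proof -
    have w: "w \<in> carrier G" using that W by auto
    have "inv (inv w) \<otimes> m \<in> nneg G P" using m that by blast
    then have "inv (inv w) \<otimes> y \<in> nneg G P"
      using nneg_trans[OF P, of "inv w" m y] w m y y0(2) unfolding y_def by auto
    then show ?thesis using w by simp
  qed
  have "\<one> \<in> wball G Y n" unfolding wball_def by (rule image_eqI[of _ _ "[]"]) (auto simp: wprod_def)
  then have yN: "y \<in> nneg G P" using wy[of \<one>] y by simp
  define c where "c = (\<lambda>g. inv y \<otimes> g \<otimes> y)"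
  define c\<iota> where "c\<iota> = c \<circ> \<iota>"
  have c\<iota>: "c\<iota> \<in> hom A G" "inj_on c\<iota> (carrier A)"
  proof -
    show "c\<iota> \<in> hom A G" unfolding c\<iota>_def
      using conj_hom(1)[OF y] hom unfolding c_def by (auto simp: hom_def Pi_iff)
    have "inj_on c (\<iota> ` carrier A)"
      using conj_hom(2)[OF y] unfolding c_def by (rule inj_on_subset) auto
    then show "inj_on c\<iota> (carrier A)" unfolding c\<iota>_def using inj by (rule comp_inj_on[rotated])
  qed
  interpret c\<iota>: group_hom A G c\<iota>
    using A is_group c\<iota> by (simp add: group_hom_def group_hom_axioms_def)
  define PA where "PA = {a \<in> carrier A. c\<iota> a \<in> P}"
  have PA: "pos_cone A PA" and NA: "nneg A PA = {a \<in> carrier A. c\<iota> a \<in> nneg G P}"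
    using pos_cone_vimage[OF P A c\<iota>] unfolding PA_def by auto
  \<comment> \<open>Left multiplication by \<open>y0\<close> carries \<open>QA\<close> into the
    nonnegative part of \<open>PA\<close>, as conjugating
    \<open>\<iota> y0 \<otimes> \<iota> a\<close> by \<open>y\<close> gives
    \<open>\<iota> a \<otimes> y\<close>.\<close>
  define QA where "QA = {a \<in> carrier A. \<iota> a \<otimes> y \<in> nneg G P}"
  \<comment> \<open>Hence \<open>QA\<close> is stable under right multiplication by every
    \<open>k\<close> with \<open>c\<iota> k\<close> nonnegative.\<close>
  have mult_c: "\<iota> (a \<otimes>\<^bsub>A\<^esub> k) \<otimes> y = (\<iota> a \<otimes> y) \<otimes> c\<iota> k" if "a \<in> carrier A" "k \<in> carrier A" for a k
    using that y unfolding c\<iota>_def c_def by (simp add: m_assoc mult_inv_cancel inv_mult_cancel)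
  \<comment> \<open>The path from 1 to \<open>k\<close> is found inside \<open>K\<close> and then
    translated by \<open>a\<close>, so one finite set serves all cosets of \<open>K\<close>. As
    \<open>\<K>\<close> is finite, all excursions share one step bound.\<close>
  have "\<exists>F. finite F \<and> F \<subseteq> carrier A \<and>
      (\<forall>a\<in>QA. \<forall>k\<in>K. c\<iota> k \<in> nneg G P \<longrightarrow> (a, a \<otimes>\<^bsub>A\<^esub> k) \<in> (fstep A F QA)\<^sup>*)" if KK: "K \<in> \<K>" for K
  proof -
    let ?K = "A\<lparr>carrier := K\<rparr>"
    have K: "subgroup K A" "prieto_fin ?K" using K[OF KK] by simp_all
    have Ks: "K \<subseteq> carrier A" using K(1) by (rule subgroup.subset)
    have gK: "group ?K" using A.subgroup_imp_group K(1) by simp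
    then interpret K: group ?K .
    have hK: "c\<iota> \<in> hom ?K G" "inj_on c\<iota> (carrier ?K)"
    proof -
      show "c\<iota> \<in> hom ?K G" by (rule homI) (simp_all add: subsetD[OF Ks])
      show "inj_on c\<iota> (carrier ?K)" using c\<iota>(2) Ks by (auto intro: inj_on_subset)
    qed
    obtain F where F': "finite F" "F \<subseteq> carrier ?K"
      "\<forall>k\<in>{a \<in> carrier ?K. c\<iota> a \<in> nneg G P}.
        (\<one>\<^bsub>?K\<^esub>, k) \<in> (fstep ?K F {a \<in> carrier ?K. c\<iota> a \<in> nneg G P})\<^sup>*"
      using K.coset_fsteps[OF pos_cone_vimage(1)[OF P gK hK] K(2)]
      unfolding pos_cone_vimage(2)[OF P gK hK] by (elim exE conjE)
    then have F: "finite F" "F \<subseteq> K"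
      "\<forall>k\<in>K. c\<iota> k \<in> nneg G P \<longrightarrow> (\<one>\<^bsub>A\<^esub>, k) \<in> (fstep ?K F {k \<in> K. c\<iota> k \<in> nneg G P})\<^sup>*"
      by simp_all
    have *: "fstep ?K F S = fstep A F S" for S unfolding fstep_def by simp
    have "(a, a \<otimes>\<^bsub>A\<^esub> k) \<in> (fstep A F QA)\<^sup>*" if "a \<in> QA" "k \<in> K" "c\<iota> k \<in> nneg G P" for a k
    proof -
      have a: "a \<in> carrier A" "\<iota> a \<otimes> y \<in> nneg G P" using that unfolding QA_def by auto
      have "(a \<otimes>\<^bsub>A\<^esub> \<one>\<^bsub>A\<^esub>, a \<otimes>\<^bsub>A\<^esub> k) \<in> (fstep A F QA)\<^sup>*"
      proof (rule A.fsteps_translate[OF _ a(1)])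
        show "(\<one>\<^bsub>A\<^esub>, k) \<in> (fstep A F {k \<in> K. c\<iota> k \<in> nneg G P})\<^sup>*"
          using F(3) that(2,3) unfolding * by blast
        fix s assume s: "s \<in> {k \<in> K. c\<iota> k \<in> nneg G P}"
        then have "s \<in> carrier A" using Ks by auto
        then show "a \<otimes>\<^bsub>A\<^esub> s \<in> QA" unfolding QA_def using mult_c[OF a(1), of s] Nm[OF a(2)] s a(1) by auto
      qed (use Ks F in auto)
      then show ?thesis using a by simp
    qed
    then have "\<forall>a\<in>QA. \<forall>k\<in>K. c\<iota> k \<in> nneg G P \<longrightarrow> (a, a \<otimes>\<^bsub>A\<^esub> k) \<in> (fstep A F QA)\<^sup>*"
      by simp
    moreover have "F \<subseteq> carrier A" using F(2) Ks by (rule order_trans)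
    ultimately show ?thesis using F(1) by (intro exI[of _ F] conjI)
  qed
  then have "\<forall>K\<in>\<K>. \<exists>F. finite F \<and> F \<subseteq> carrier A \<and>
      (\<forall>a\<in>QA. \<forall>k\<in>K. c\<iota> k \<in> nneg G P \<longrightarrow> (a, a \<otimes>\<^bsub>A\<^esub> k) \<in> (fstep A F QA)\<^sup>*)"
    by (intro ballI)
  from bchoice[OF this] obtain FF where "\<forall>K\<in>\<K>. finite (FF K) \<and> FF K \<subseteq> carrier A \<and>
      (\<forall>a\<in>QA. \<forall>k\<in>K. c\<iota> k \<in> nneg G P \<longrightarrow> (a, a \<otimes>\<^bsub>A\<^esub> k) \<in> (fstep A (FF K) QA)\<^sup>*)" ..
  then have FF: "\<And>K. K \<in> \<K> \<Longrightarrow> finite (FF K) \<and> FF K \<subseteq> carrier A \<and>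
      (\<forall>a\<in>QA. \<forall>k\<in>K. c\<iota> k \<in> nneg G P \<longrightarrow> (a, a \<otimes>\<^bsub>A\<^esub> k) \<in> (fstep A (FF K) QA)\<^sup>*)" by blast
  \<comment> \<open>Three sources of steps: paths inside cosets, generators of \<open>G\<close> that
    lie in \<open>A\<close>, and \<open>y0\<close> for joining \<open>a\<close> to
    \<open>a y0\<close> at the two ends.\<close>
  define F0 where "F0 = \<Union> (FF ` \<K>) \<union> {a \<in> carrier A. \<iota> a \<in> Y} \<union> {y0}"
  define FA where "FA = F0 \<union> m_inv A ` F0"
  have "finite {a \<in> carrier A. \<iota> a \<in> Y}"
  proof (rule finite_imageD)
    show "finite (\<iota> ` {a \<in> carrier A. \<iota> a \<in> Y})"
      by (rule finite_subset[OF _ Y_closed(2)]) auto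
    show "inj_on \<iota> {a \<in> carrier A. \<iota> a \<in> Y}" by (rule inj_on_subset[OF inj]) auto
  qed
  then have F0: "finite F0" unfolding F0_def using FF finite_K by simp
  have "FF K \<subseteq> carrier A" if "K \<in> \<K>" for K using FF[OF that] by simp
  then have F0c: "F0 \<subseteq> carrier A" unfolding F0_def using y0(1) by blast
  then have FA: "finite FA" "FA \<subseteq> carrier A" "\<And>f. f \<in> FA \<Longrightarrow> inv\<^bsub>A\<^esub> f \<in> FA"
    unfolding FA_def using F0 F0c by auto
  have QA: "QA \<subseteq> carrier A" unfolding QA_def by auto
  have in_coset: "(h, h') \<in> (fstep A FA QA)\<^sup>*"
    if Zl: "Z l = a <#\<^bsub>A\<^esub> K" "K \<in> \<K>" "a \<in> carrier A" "h \<in> Z l" "h' \<in> Z l" "h \<in> QA" "h' \<in> QA" for h h' l a K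
  proof -
    have K: "subgroup K A" using K Zl by auto
    obtain k k' where k: "h = a \<otimes>\<^bsub>A\<^esub> k" "h' = a \<otimes>\<^bsub>A\<^esub> k'" "k \<in> K" "k' \<in> K"
      using Zl unfolding l_coset_def by auto
    have kc: "k \<in> carrier A" "k' \<in> carrier A" using k K subgroup.subset by blast+
    define d where "d = inv\<^bsub>A\<^esub> k \<otimes>\<^bsub>A\<^esub> k'"
    have d: "d \<in> K" "inv\<^bsub>A\<^esub> d \<in> K" "d \<in> carrier A"
      using k kc K unfolding d_def by (auto simp: subgroup.m_closed subgroup.m_inv_closed)
    have hd: "h' = h \<otimes>\<^bsub>A\<^esub> d" "h = h' \<otimes>\<^bsub>A\<^esub> inv\<^bsub>A\<^esub> d"
      unfolding k d_def using kc Zl by (simp_all add: A.m_assoc A.inv_mult_group A.mult_inv_cancel A.inv_mult_cancel)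
    have sub: "FF K \<subseteq> FA" unfolding FA_def F0_def using Zl by auto
    have "c\<iota> (inv\<^bsub>A\<^esub> d) = inv (c\<iota> d)" using d by simp
    \<comment> \<open>The conjugated order is total on \<open>K\<close>, so one of the two points is
      reached from the other by a nonnegative multiplier; symmetry of \<open>FA\<close> allows the
      path to be reversed.\<close>
    then consider "c\<iota> d \<in> nneg G P" | "c\<iota> (inv\<^bsub>A\<^esub> d) \<in> nneg G P"
      using nneg_total[OF P, of "c\<iota> d"] d by auto
    then show ?thesis
    proof cases
      case 1
      then have "(h, h') \<in> (fstep A (FF K) QA)\<^sup>*" unfolding hd(1) using FF Zl d by blast
      then show ?thesis by (rule fstep_rtrancl_mono) (use sub in auto)
    next
      case 2
      then have "(h', h' \<otimes>\<^bsub>A\<^esub> inv\<^bsub>A\<^esub> d) \<in> (fstep A (FF K) QA)\<^sup>*" using FF Zl d by blast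
      then have "(h', h) \<in> (fstep A FA QA)\<^sup>*"
        unfolding hd(2)[symmetric] by (rule fstep_rtrancl_mono) (use sub in auto)
      then show ?thesis using QA FA by (intro A.fsteps_sym[of h']) auto
    qed
  qed
  obtain u' v' where uv': "u' \<in> PA" "v' \<in> PA" "(u', v') \<notin> (fstep A FA (nneg A PA))\<^sup>*"
    using A_steps[OF PA FA(1,2)] by blast
  have uv'c: "u' \<in> carrier A" "v' \<in> carrier A" using uv' unfolding PA_def by auto
  \<comment> \<open>Conjugation by \<open>y0\<close> inside \<open>A\<close> realizes
    \<open>c\<iota>\<close>, so \<open>s u'\<close> and \<open>s v'\<close> map into
    \<open>P\<close> although \<open>u'\<close> and \<open>v'\<close> are only known to lie in
    \<open>PA\<close>.\<close>
  define s where "s = (\<lambda>u. inv\<^bsub>A\<^esub> y0 \<otimes>\<^bsub>A\<^esub> u \<otimes>\<^bsub>A\<^esub> y0)"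
  have s: "s a \<in> carrier A" "\<iota> (s a) = c\<iota> a" "y0 \<otimes>\<^bsub>A\<^esub> s a = a \<otimes>\<^bsub>A\<^esub> y0" if "a \<in> carrier A" for a
    using that y0(1) unfolding s_def c\<iota>_def c_def y_def by (simp_all add: m_assoc A.m_assoc A.mult_inv_cancel A.inv_mult_cancel)
  have sP: "\<iota> (s a) \<in> P" "s a \<in> QA" if "a \<in> PA" for a
  proof -
    show 1: "\<iota> (s a) \<in> P" using that s(2)[of a] unfolding PA_def by auto
    then have "\<iota> (s a) \<otimes> y \<in> nneg G P" using Nm yN Niff by auto
    then show "s a \<in> QA" using s(1)[of a] that unfolding QA_def PA_def by auto
  qed
  define Q where "Q = {h \<in> carrier G. h \<otimes> y \<in> nneg G P}"
  have QA_Q: "a \<in> QA \<longleftrightarrow> \<iota> a \<in> Q" if "a \<in> carrier A" for a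
    using that unfolding QA_def Q_def by auto
  have "(\<iota> (s u'), \<iota> (s v')) \<notin> (fstep G F (nneg G P))\<^sup>*"
  proof
    assume "(\<iota> (s u'), \<iota> (s v')) \<in> (fstep G F (nneg G P))\<^sup>*"
    then have refined: "(\<iota> (s u'), \<iota> (s v')) \<in> (fstep G Y Q)\<^sup>*"
    proof (rule fsteps_refine[OF _ Y_closed(1) _ n])
      fix g w assume gw: "g \<in> nneg G P" "w \<in> wball G Y n"
      then have "g \<in> carrier G" "w \<in> carrier G" using Nc W by auto
      then show "g \<otimes> w \<in> Q" unfolding Q_def using Nm[OF gw(1) wy[OF gw(2)]] y by (simp add: m_assoc)
    qed (use Nc in auto)
    let ?R = "(fstep A FA QA)\<^sup>*"
    \<comment> \<open>Invariant of the shadow path in \<open>A\<close>: while the original path is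
      at a point of \<open>A\<close>, the shadow is at the same point; while it is in branch
      \<open>l\<close>, the shadow waits at a point of \<open>Z l\<close>, from which
      \<open>in_coset\<close> leads to the point of return.\<close>
    have "q \<in> carrier G \<and> (\<forall>a\<in>carrier A. q = \<iota> a \<longrightarrow> (s u', a) \<in> ?R) \<and>
       (\<forall>l. lab q = Some l \<longrightarrow> (\<exists>h\<in>Z l. h \<in> QA \<and> (s u', h) \<in> ?R))"
      if "(\<iota> (s u'), q) \<in> (fstep G Y Q)\<^sup>*" for q
      using that
    proof induction
      case base
      have su: "s u' \<in> carrier A" using s uv'c by auto
      then have "lab (\<iota> (s u')) = None" using lab_None[of "\<iota> (s u')"] by auto
      moreover have "a = s u'" if "a \<in> carrier A" "\<iota> (s u') = \<iota> a" for a
        using that su inj by (auto dest: inj_onD)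
      ultimately show ?case using su by auto
    next
      case (step q q')
      then obtain x where x: "q \<in> Q" "q' \<in> Q" "x \<in> Y" "q' = q \<otimes> x" unfolding fstep_def by auto
      have qc: "q \<in> carrier G" "q' \<in> carrier G" using x unfolding Q_def by auto
      show ?case
      proof (cases "lab q")
        case None
        then obtain b where b: "b \<in> carrier A" "q = \<iota> b" using lab_None qc by auto
        have bR: "(s u', b) \<in> ?R" using b step.IH by auto
        have bQ: "b \<in> QA" using b x QA_Q by auto
        show ?thesis
        proof (cases "lab q'")
          case None
          have "(s u', a) \<in> ?R" if a: "a \<in> carrier A" "q' = \<iota> a" for a
          proof -
            have xc: "x \<in> carrier G" using x Y_closed by auto
            let ?x = "inv\<^bsub>A\<^esub> b \<otimes>\<^bsub>A\<^esub> a"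
            have "\<iota> ?x = inv q \<otimes> q'" using a b by simp
            also have "\<dots> = x" unfolding x(4) using qc xc by (simp add: mult_inv_cancel inv_mult_cancel)
            finally have "?x \<in> FA" unfolding FA_def F0_def using x(3) a b by auto
            moreover have "a = b \<otimes>\<^bsub>A\<^esub> ?x" using a b by (simp add: A.mult_inv_cancel A.inv_mult_cancel)
            moreover have "a \<in> QA" using a x QA_Q by auto
            ultimately have "(b, a) \<in> fstep A FA QA" unfolding fstep_def using bQ by blast
            then show ?thesis using bR by auto
          qed
          then show ?thesis using qc None by auto
        next
          case (Some l)
          have "q \<in> \<iota> ` Z l" using exit[OF qc(1) x(3) None] Some x(4) by auto
          moreover have "Z l \<subseteq> carrier A" using Z_closed[OF qc(2) Some] .
          ultimately have "b \<in> Z l" using b inj by (auto dest: inj_onD)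
          moreover have "q' \<noteq> \<iota> a" if "a \<in> carrier A" for a using Some lab_None[OF qc(2)] that by auto
          ultimately show ?thesis using Some bQ bR qc by auto
        qed
      next
        case (Some l)
        then obtain h where h: "h \<in> Z l" "h \<in> QA" "(s u', h) \<in> ?R" using step.IH by auto
        show ?thesis
        proof (cases "lab q'")
          case None
          obtain d K where dK: "d \<in> carrier A" "K \<in> \<K>" "Z l = d <#\<^bsub>A\<^esub> K" using coset[OF qc(1) Some] by auto
          have Zc: "Z l \<subseteq> carrier A" using Z_closed[OF qc(1) Some] .
          have "(s u', a) \<in> ?R" if a: "a \<in> carrier A" "q' = \<iota> a" for a
          proof -
            have "q' \<in> \<iota> ` Z l" using enter[OF qc(1) x(3) Some] None x(4) by auto
            then have "a \<in> Z l" using a Zc inj by (auto dest: inj_onD)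
            moreover have "a \<in> QA" using a x QA_Q by auto
            ultimately show ?thesis using in_coset[OF dK(3,2,1) h(1) _ h(2)] h(3) by (meson rtrancl_trans)
          qed
          then show ?thesis using qc None by auto
        next
          case (Some l')
          then have "l' = l" using stay[OF qc(1) x(3) \<open>lab q = Some l\<close>] x(4) by auto
          moreover have "q' \<noteq> \<iota> a" if "a \<in> carrier A" for a using Some lab_None[OF qc(2)] that by auto
          ultimately show ?thesis using Some h qc by auto
        qed
      qed
    qed
    from this[OF refined] have "(s u', s v') \<in> (fstep A FA QA)\<^sup>*" using s(1)[OF uv'c(2)] by auto
    \<comment> \<open>Translation by \<open>y0\<close> turns the shadow path in \<open>QA\<close>
      into a path of nonnegative elements for \<open>PA\<close>.\<close>
    moreover have trans: "y0 \<otimes>\<^bsub>A\<^esub> a \<in> nneg A PA" if "a \<in> QA" for a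
    proof -
      have "c\<iota> (y0 \<otimes>\<^bsub>A\<^esub> a) = \<iota> a \<otimes> y"
        using that y y0 unfolding QA_def c\<iota>_def c_def y_def by (auto simp: m_assoc mult_inv_cancel inv_mult_cancel)
      then show ?thesis using that y0 unfolding NA QA_def by auto
    qed
    ultimately have "(y0 \<otimes>\<^bsub>A\<^esub> s u', y0 \<otimes>\<^bsub>A\<^esub> s v') \<in> (fstep A FA (nneg A PA))\<^sup>*"
      using A.fsteps_translate[of "s u'" "s v'" FA QA y0] y0(1) QA FA(2) by auto
    then have "(u' \<otimes>\<^bsub>A\<^esub> y0, v' \<otimes>\<^bsub>A\<^esub> y0) \<in> (fstep A FA (nneg A PA))\<^sup>*" using s(3) uv'c by simp
    \<comment> \<open>The translated shadow path runs from \<open>u' y0\<close> to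
      \<open>v' y0\<close>; single steps by \<open>y0\<close> attach it to \<open>u'\<close> and
      \<open>v'\<close>.\<close>
    moreover have end_step: "(a, a \<otimes>\<^bsub>A\<^esub> y0) \<in> fstep A FA (nneg A PA)" if "a \<in> PA" for a
    proof -
      have "a \<in> carrier A" using that unfolding PA_def by simp
      then have "a \<otimes>\<^bsub>A\<^esub> y0 \<in> nneg A PA" using trans[OF sP(2)[OF that]] s(3)[of a] by simp
      moreover have "a \<in> nneg A PA" using that A.nneg_iff[OF PA] by auto
      moreover have "y0 \<in> FA" unfolding FA_def F0_def by auto
      ultimately show ?thesis unfolding fstep_def by auto
    qed
    moreover have "(v' \<otimes>\<^bsub>A\<^esub> y0, v') \<in> (fstep A FA (nneg A PA))\<^sup>*"
      by (rule A.fsteps_sym[of v'])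
        (use end_step[OF uv'(2)] FA in \<open>auto simp: nneg_def\<close>)
    ultimately have "(u', v') \<in> (fstep A FA (nneg A PA))\<^sup>*"
      using end_step[OF uv'(1)] by (meson converse_rtrancl_into_rtrancl rtrancl_trans)
    then show False using uv' by simp
  qed
  then show ?thesis using sP uv' by blast
qed

text \<open>Sets bounded above are stable under subsets, finite unions and left translations. This
  turns the covering of \<open>G\<close> by translates of a half space into unboundedness of both
  sides.\<close>

lemma bounded_case:
  assumes P: "pos_cone G P" and F: "finite F" "F \<subseteq> carrier G" and "P \<noteq> {}"
    and bdd: "\<And>x. x \<in> carrier G \<Longrightarrow>
      \<exists>m\<in>carrier G. \<forall>a\<in>carrier A. inv (\<iota> a \<otimes> x) \<otimes> m \<in> P"
  shows "\<exists>u\<in>P. \<exists>v\<in>P. (u, v) \<notin> (fstep G F (nneg G P))\<^sup>*"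
proof -
  note Pc = cone_closed[OF P] and Niff = nneg_iff[OF P] and Nc = nneg_closed[OF P] and Nm = nneg_mult[OF P]
  define B where "B = (\<lambda>S. \<exists>m\<in>carrier G. \<forall>s\<in>S. inv s \<otimes> m \<in> nneg G P)"
  have not_B: "\<exists>s\<in>S. inv m \<otimes> s \<in> P" if nB: "\<not> B S" "S \<subseteq> carrier G" "m \<in> carrier G" for S m
  proof -
    obtain s where s: "s \<in> S" "inv s \<otimes> m \<notin> nneg G P" using nB unfolding B_def by auto
    then have "inv (inv s \<otimes> m) \<in> P" using inv_mem_cone_iff[OF P, of "inv s \<otimes> m"] nB by auto
    moreover have "inv (inv s \<otimes> m) = inv m \<otimes> s" using s nB by (simp add: inv_mult_group subset_iff)
    ultimately show ?thesis using s by auto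
  qed
  have B_translate: "B ((\<lambda>s. f \<otimes> s) ` S)" if BS: "B S" and S: "S \<subseteq> carrier G" and f: "f \<in> carrier G" for S f
  proof -
    obtain m where m: "m \<in> carrier G" "\<forall>s\<in>S. inv s \<otimes> m \<in> nneg G P" using BS unfolding B_def by auto
    have "inv (f \<otimes> s) \<otimes> (f \<otimes> m) \<in> nneg G P" if "s \<in> S" for s
    proof -
      have sc: "s \<in> carrier G" using that S by auto
      have "inv (f \<otimes> s) \<otimes> (f \<otimes> m) = inv s \<otimes> m"
        using sc f m(1) by (simp add: inv_mult_group m_assoc mult_inv_cancel inv_mult_cancel)
      then show ?thesis using m(2) that by simp
    qed
    then show ?thesis unfolding B_def using f m(1) by (intro bexI[of _ "f \<otimes> m"]) auto
  qed
  have B_Un: "B (S \<union> T)" if BB: "B S" "B T" "S \<subseteq> carrier G" "T \<subseteq> carrier G" for S T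
  proof -
    obtain m where m: "m \<in> carrier G" "\<forall>s\<in>S. inv s \<otimes> m \<in> nneg G P" using BB unfolding B_def by auto
    obtain m' where m': "m' \<in> carrier G" "\<forall>s\<in>T. inv s \<otimes> m' \<in> nneg G P" using BB unfolding B_def by auto
    obtain M where M: "M \<in> carrier G" "\<forall>f\<in>{m, m'}. inv f \<otimes> M \<in> nneg G P"
      using finite_upper_bound[OF P, of "{m, m'}"] m m' by auto
    have "inv s \<otimes> M \<in> nneg G P" if "s \<in> S \<union> T" for s
      using that
    proof
      assume "s \<in> S"
      then show ?thesis
        using nneg_trans[OF P, of s m M] m M \<open>S \<subseteq> carrier G\<close> by auto
    next
      assume "s \<in> T"
      then show ?thesis
        using nneg_trans[OF P, of s m' M] m' M \<open>T \<subseteq> carrier G\<close> by auto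
    qed
    then show ?thesis unfolding B_def using M(1) by auto
  qed
  have B_mono: "B S" if "B T" "S \<subseteq> T" for S T using that unfolding B_def by blast
  have not_BG: "\<not> B (carrier G)"
  proof
    assume "B (carrier G)"
    then obtain m where m: "m \<in> carrier G" "\<forall>s\<in>carrier G. inv s \<otimes> m \<in> nneg G P" unfolding B_def by auto
    \<comment> \<open>A bound \<open>m\<close> of the whole group would be exceeded by
      \<open>m p\<close>.\<close>
    obtain p where p: "p \<in> P" using \<open>P \<noteq> {}\<close> by auto
    then have pc: "p \<in> carrier G" using Pc by auto
    have "inv (m \<otimes> p) \<otimes> m \<in> nneg G P" using m pc by auto
    moreover have "inv (m \<otimes> p) \<otimes> m = inv p" using m pc by (simp add: inv_mult_group m_assoc)
    ultimately have "inv p \<in> nneg G P" by simp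
    then show False using inv_mem_cone_iff[OF P, of "inv p"] p pc by simp
  qed
  \<comment> \<open>Half spaces exist only for a proper vertex group; if \<open>A\<close> were
    everything, the bound on \<open>A\<close> itself, taken at \<open>x = 1\<close>, would bound
    \<open>G\<close>.\<close>
  have "\<iota> ` carrier A \<noteq> carrier G"
  proof
    assume eq: "\<iota> ` carrier A = carrier G"
    obtain m where "m \<in> carrier G" "\<forall>a\<in>carrier A. inv (\<iota> a \<otimes> \<one>) \<otimes> m \<in> P"
      using bdd[OF one_closed] by blast
    then have "B (\<iota> ` carrier A)"
      unfolding B_def Niff by (intro bexI[of _ m]) auto
    then have "B (carrier G)" unfolding eq .
    then show False using not_BG by simp
  qed
  from halves[OF this] obtain l0 f f1 f2 where h0: "f \<in> carrier G" "f1 \<in> carrier G" "f2 \<in> carrier G"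
    "\<forall>h\<in>carrier G. lab h = Some l0 \<longrightarrow> lab (f \<otimes> h) \<noteq> Some l0"
    "\<forall>g\<in>carrier G. \<exists>h\<in>carrier G. lab h = Some l0 \<and> (g = f1 \<otimes> h \<or> g = f2 \<otimes> h)"
    by (elim exE bexE conjE)
  then have h: "f \<in> carrier G" "f1 \<in> carrier G" "f2 \<in> carrier G"
    "\<And>h. h \<in> carrier G \<Longrightarrow> lab h = Some l0 \<Longrightarrow> lab (f \<otimes> h) \<noteq> Some l0"
    "\<And>g. g \<in> carrier G \<Longrightarrow> \<exists>h\<in>carrier G. lab h = Some l0 \<and> (g = f1 \<otimes> h \<or> g = f2 \<otimes> h)"
    by simp_all
  define H where "H = {h \<in> carrier G. lab h = Some l0}"
  have Hc: "H \<subseteq> carrier G" unfolding H_def by auto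
  have not_BH: "\<not> B H"
  proof
    assume "B H"
    then have "B ((\<lambda>s. f1 \<otimes> s) ` H \<union> (\<lambda>s. f2 \<otimes> s) ` H)"
      using h Hc by (intro B_Un B_translate) auto
    moreover have "carrier G \<subseteq> (\<lambda>s. f1 \<otimes> s) ` H \<union> (\<lambda>s. f2 \<otimes> s) ` H"
      using h(5) unfolding H_def by blast
    ultimately show False using not_BG B_mono by blast
  qed
  \<comment> \<open>The complement contains the translate \<open>f H\<close>, so a bound for it
    would translate back to a bound for \<open>H\<close>.\<close>
  have not_BcoH: "\<not> B (carrier G - H)"
  proof
    assume "B (carrier G - H)"
    moreover have "(\<lambda>s. f \<otimes> s) ` H \<subseteq> carrier G - H" using h(1,4) unfolding H_def by auto
    ultimately have "B ((\<lambda>s. f \<otimes> s) ` H)" using B_mono by blast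
    then have "B ((\<lambda>s. inv f \<otimes> s) ` (\<lambda>s. f \<otimes> s) ` H)"
      by (rule B_translate) (use h(1) Hc in auto)
    moreover have "(\<lambda>s. inv f \<otimes> s) ` (\<lambda>s. f \<otimes> s) ` H = H"
      unfolding image_image using h(1) Hc inv_mult_cancel[OF h(1)] by (auto simp: subset_iff image_iff)
    ultimately show False using not_BH by simp
  qed
  obtain n where n: "F \<subseteq> wball G Y n" using finite_subset_wball[OF gens F] by auto
  have W: "finite (wball G Y n)" "wball G Y n \<subseteq> carrier G"
    using finite_wball wball_closed Y_closed by auto
  \<comment> \<open>A single \<open>m\<close> strictly above all translates
    \<open>A (inv w)\<close>. The inverse occurs because a point \<open>m p w\<close> of
    \<open>A\<close> is later solved for \<open>m p\<close>.\<close>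
  have "\<exists>m\<in>carrier G. \<forall>w\<in>W. \<forall>a\<in>carrier A. inv (\<iota> a \<otimes> inv w) \<otimes> m \<in> P"
    if W: "finite W" "W \<subseteq> carrier G" for W
  proof -
    have "\<forall>w\<in>W. \<exists>m. m \<in> carrier G \<and> (\<forall>a\<in>carrier A. inv (\<iota> a \<otimes> inv w) \<otimes> m \<in> P)"
      using bdd W(2) by blast
    from bchoice[OF this] obtain M where M: "\<And>w. w \<in> W \<Longrightarrow> M w \<in> carrier G"
      "\<And>w a. w \<in> W \<Longrightarrow> a \<in> carrier A \<Longrightarrow> inv (\<iota> a \<otimes> inv w) \<otimes> M w \<in> P"
      by blast
    obtain m where m: "m \<in> carrier G" "\<forall>f\<in>M ` W. inv f \<otimes> m \<in> nneg G P"
      using finite_upper_bound[OF P, of "M ` W"] W(1) M(1) by blast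
    have "inv (\<iota> a \<otimes> inv w) \<otimes> m \<in> P" if wa: "w \<in> W" "a \<in> carrier A" for w a
    proof -
      let ?x = "inv (\<iota> a \<otimes> inv w)"
      have w: "w \<in> carrier G" using wa(1) W(2) by blast
      then have c: "?x \<in> carrier G" "M w \<in> carrier G" using wa M(1) by simp_all
      have "?x \<otimes> m = (?x \<otimes> M w) \<otimes> (inv (M w) \<otimes> m)"
        using m_assoc[OF c] mult_inv_cancel[OF c(2)] c m(1) by simp
      moreover have "?x \<otimes> M w \<in> P" using M(2)[OF wa] .
      moreover have "inv (M w) \<otimes> m \<in> nneg G P" using m(2) wa(1) by blast
      ultimately show ?thesis using cone_mult_nneg[OF P] by simp
    qed
    then show ?thesis using m(1) by auto
  qed
  from this[OF W] obtain m where m: "m \<in> carrier G"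
    "\<And>w a. w \<in> wball G Y n \<Longrightarrow> a \<in> carrier A \<Longrightarrow> inv (\<iota> a \<otimes> inv w) \<otimes> m \<in> P" by auto
  \<comment> \<open>Both sides of the boundary are unbounded, so each contains a point above
    \<open>m\<close>; division by \<open>m\<close> puts the two points into
    \<open>P\<close>.\<close>
  obtain u where u: "u \<in> H" "inv m \<otimes> u \<in> P" using not_B[OF not_BH Hc m(1)] by auto
  obtain v where v: "v \<in> carrier G - H" "inv m \<otimes> v \<in> P" using not_B[OF not_BcoH _ m(1)] by auto
  define Q where "Q = {p \<otimes> w |p w. p \<in> nneg G P \<and> w \<in> wball G Y n}"
  have "(inv m \<otimes> u, inv m \<otimes> v) \<notin> (fstep G F (nneg G P))\<^sup>*"
  proof
    assume "(inv m \<otimes> u, inv m \<otimes> v) \<in> (fstep G F (nneg G P))\<^sup>*"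
    then have "(inv m \<otimes> u, inv m \<otimes> v) \<in> (fstep G Y Q)\<^sup>*"
      by (rule fsteps_refine[OF _ Y_closed(1) _ n]) (use Nc in \<open>auto simp: Q_def\<close>)
    moreover have "m \<otimes> (inv m \<otimes> u) = u" "m \<otimes> (inv m \<otimes> v) = v"
      using m(1) u v Hc by (auto simp: m_assoc[symmetric])
    ultimately have "\<exists>(q, q')\<in>fstep G Y Q. q \<in> {q. m \<otimes> q \<in> H} \<and> q' \<notin> {q. m \<otimes> q \<in> H}"
      using u v by (intro rtrancl_crossing[of "inv m \<otimes> u" "inv m \<otimes> v"]) auto
    then obtain q q' where q: "(q, q') \<in> fstep G Y Q" "m \<otimes> q \<in> H" "m \<otimes> q' \<notin> H" by auto
    then obtain x where x: "q' \<in> Q" "q \<in> Q" "x \<in> Y" "q' = q \<otimes> x" unfolding fstep_def by auto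
    have qc: "q \<in> carrier G" "q' \<in> carrier G" "x \<in> carrier G"
      using x W Nc Y_closed unfolding Q_def by auto
    have mq: "m \<otimes> q' = (m \<otimes> q) \<otimes> x" using x(4) qc m(1) by (simp add: m_assoc)
    have "lab (m \<otimes> q') = None"
    proof (cases "lab (m \<otimes> q')")
      case (Some l)
      then show ?thesis
        using stay[of "m \<otimes> q" x l0 l] q(2,3) qc m(1) mq x(3) unfolding H_def by auto
    qed
    then obtain a where a: "a \<in> carrier A" "m \<otimes> q' = \<iota> a" using lab_None[of "m \<otimes> q'"] qc m(1) by auto
    obtain p w where pw: "p \<in> nneg G P" "w \<in> wball G Y n" "q' = p \<otimes> w" using x(1) unfolding Q_def by auto
    have c: "p \<in> carrier G" "w \<in> carrier G" using pw Nc W by auto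
    \<comment> \<open>The crossing point satisfies \<open>m p w = \<iota> a\<close>, so
      \<open>m p\<close> lies in \<open>A (inv w)\<close> and is at least \<open>m\<close>, against
      the choice of \<open>m\<close>.\<close>
    have "inv (\<iota> a \<otimes> inv w) \<otimes> m = inv p"
      unfolding a(2)[symmetric] pw(3) using c m(1) by (simp add: m_assoc inv_mult_group mult_inv_cancel inv_mult_cancel)
    then have "inv p \<in> P" using m(2)[OF pw(2) a(1)] by simp
    then show False using inv_mem_cone_iff[OF P c(1)] pw(1) by simp
  qed
  then show ?thesis using u v by blast
qed

text \<open>If \<open>A x\<close> is cofinal for \<open>P\<close>, then \<open>A\<close> is cofinal
  for \<open>x P x^-1\<close>: conjugation by \<open>x\<close> turns
  \<open>inv m \<otimes> \<iota> a\<close> into the quotient of \<open>\<iota> a \<otimes> x\<close>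
  by \<open>m \<otimes> x\<close>.\<close>

lemma hucha:
  assumes lo: "left_orderable G"
  shows "hucha G"
proof (rule huchaI[OF lo gens])
  fix P F assume P: "pos_cone G P" and F: "finite F" "F \<subseteq> carrier G"
  \<comment> \<open>Even for the empty step set \<open>A_steps\<close> yields elements of the pulled
    back cone, so \<open>P'\<close> is nonempty.\<close>
  have ne: "P' \<noteq> {}" if P': "pos_cone G P'" for P'
    using A_steps[OF pos_cone_vimage(1)[OF P' A hom inj], of "{}"] by auto
  have "\<exists>u\<in>P. \<exists>v\<in>P. (u, v) \<notin> (fstep G F (nneg G P))\<^sup>*"
  proof (cases "\<exists>x\<in>carrier G. \<forall>m\<in>carrier G. \<exists>a\<in>carrier A. inv m \<otimes> (\<iota> a \<otimes> x) \<in> nneg G P")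
    case False
    have "\<exists>m\<in>carrier G. \<forall>a\<in>carrier A. inv (\<iota> a \<otimes> x) \<otimes> m \<in> P" if x: "x \<in> carrier G" for x
    proof -
      obtain m where m: "m \<in> carrier G" "\<forall>a\<in>carrier A. inv m \<otimes> (\<iota> a \<otimes> x) \<notin> nneg G P"
        using False x by auto
      have "inv (\<iota> a \<otimes> x) \<otimes> m \<in> P" if "a \<in> carrier A" for a
      proof -
        have "inv (inv m \<otimes> (\<iota> a \<otimes> x)) \<in> P"
          using inv_mem_cone_iff[OF P, of "inv m \<otimes> (\<iota> a \<otimes> x)"] m that x by auto
        then show ?thesis using m(1) that x by (simp add: inv_mult_group[of "inv m"])
      qed
      then show ?thesis using m(1) by auto
    qed
    then show ?thesis using bounded_case[OF P F ne[OF P]] by blast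
  next
    case True
    then obtain x where x: "x \<in> carrier G"
      "\<And>m. m \<in> carrier G \<Longrightarrow> \<exists>a\<in>carrier A. inv m \<otimes> (\<iota> a \<otimes> x) \<in> nneg G P" by auto
    define c where "c = (\<lambda>g. inv x \<otimes> g \<otimes> x)"
    define P' where "P' = {g \<in> carrier G. c g \<in> P}"
    have P': "pos_cone G P'" and N': "nneg G P' = {g \<in> carrier G. c g \<in> nneg G P}"
      using pos_cone_vimage[OF P is_group conj_hom[OF x(1)]] unfolding P'_def c_def by auto
    define F' where "F' = (\<lambda>g. x \<otimes> g \<otimes> inv x) ` F"
    have F': "finite F'" "F' \<subseteq> carrier G" unfolding F'_def using F x by auto
    have "\<exists>a\<in>carrier A. inv m \<otimes> \<iota> a \<in> nneg G P'" if m: "m \<in> carrier G" for m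
    proof -
      obtain a where a: "a \<in> carrier A" "inv (m \<otimes> x) \<otimes> (\<iota> a \<otimes> x) \<in> nneg G P" using x(2)[of "m \<otimes> x"] m x(1) by blast
      then have "c (inv m \<otimes> \<iota> a) \<in> nneg G P"
        unfolding c_def using m x(1) by (simp add: inv_mult_group m_assoc)
      then show ?thesis unfolding N' using a m by auto
    qed
    from cofinal_case[OF P' F' this] obtain u v where
      uv: "u \<in> P'" "v \<in> P'" "(u, v) \<notin> (fstep G F' (nneg G P'))\<^sup>*" by blast
    have inverse: "x \<otimes> c g \<otimes> inv x = g" "c (x \<otimes> g \<otimes> inv x) = g" if "g \<in> carrier G" for g
      using that x(1) unfolding c_def by (simp_all add: m_assoc mult_inv_cancel inv_mult_cancel)
    have "(c u, c v) \<notin> (fstep G F (nneg G P))\<^sup>*"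
    proof
      assume "(c u, c v) \<in> (fstep G F (nneg G P))\<^sup>*"
      then have "(x \<otimes> c u \<otimes> inv x, x \<otimes> c v \<otimes> inv x) \<in> (fstep G F' (nneg G P'))\<^sup>*"
      proof (induction rule: rtrancl_induct)
        case (step v w)
        then obtain f where f: "v \<in> nneg G P" "w \<in> nneg G P" "f \<in> F" "w = v \<otimes> f" unfolding fstep_def by auto
        have cl: "v \<in> carrier G" "w \<in> carrier G" "f \<in> carrier G"
          using f F(2) nneg_closed[OF P] by auto
        have "x \<otimes> w \<otimes> inv x = (x \<otimes> v \<otimes> inv x) \<otimes> (x \<otimes> f \<otimes> inv x)"
          unfolding f(4) using cl x(1) by (simp add: m_assoc mult_inv_cancel inv_mult_cancel)
        then have "(x \<otimes> v \<otimes> inv x, x \<otimes> w \<otimes> inv x) \<in> fstep G F' (nneg G P')"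
          unfolding fstep_def F'_def N' using f(1-3) inverse(2)[of v] inverse(2)[of w] cl x(1) by force
        then show ?case using step by auto
      qed simp
      then show False using uv inverse(1) unfolding P'_def by auto
    qed
    then show ?thesis using uv unfolding P'_def by blast
  qed
  then show "\<exists>u\<in>P. \<exists>v\<in>P. (u, v) \<notin> (fstep G F (carrier G - inv_set G P))\<^sup>*"
    unfolding nneg_def .
qed

end


section \<open>Normal forms\<close>

lemma (in group) l_coset_repr:
  assumes "subgroup H G" and "m \<in> carrier G" and "r \<in> m <# H"
  shows "r \<in> carrier G" and "inv r \<otimes> m \<in> H"
proof -
  obtain k where k: "k \<in> H" "r = m \<otimes> k" using assms(3) unfolding l_coset_def by auto
  have kc: "k \<in> carrier G" using k(1) assms(1) subgroup.subset by blast
  show "r \<in> carrier G" unfolding k(2) using assms(2) kc by simp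
  have "inv r \<otimes> m = inv k" unfolding k(2) using assms(2) kc by (simp add: inv_mult_group m_assoc)
  then show "inv r \<otimes> m \<in> H" using assms(1) k(1) by (simp add: subgroup.m_inv_closed)
qed

lemma (in group) l_coset_mult_right:
  assumes "subgroup H G" and "m \<in> carrier G" and "k \<in> H"
  shows "(m \<otimes> k) <# H = m <# H"
proof -
  have kc: "k \<in> carrier G" using assms subgroup.subset by blast
  have "m <# (k <# H) = (m \<otimes> k) <# H"
    using lcos_m_assoc[of H m k] assms(1,2) kc subgroup.subset by blast
  moreover have "k <# H = H" using coset_join3[OF kc assms(1,3)] .
  ultimately show ?thesis by simp
qed

text \<open>Bass--Serre data with edges \<^term>\<open>True\<close> and \<^term>\<open>False\<close>, which are inverse to each
  other; the edge \<open>e\<close> starts at the vertex \<open>src e\<close>. All vertex groups \<open>U v\<close> live in one ambient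
  group. A state \<open>(L, m)\<close> stands for the groupoid normal form with syllables \<open>L\<close>, the head of \<open>L\<close>
  being the last one, followed by the vertex group element \<open>m\<close>.\<close>

locale bass_serre = group D for D (structure) +
  fixes src :: "bool \<Rightarrow> 'v" and U :: "'v \<Rightarrow> 'a set" and K :: "bool \<Rightarrow> 'a set" and \<theta> :: "bool \<Rightarrow> 'a \<Rightarrow> 'a"
  assumes U: "subgroup (U v) D"
    and K: "subgroup (K e) D"
    and K_U: "K e \<subseteq> U (src e)"
    and \<theta>_closed: "c \<in> K e \<Longrightarrow> \<theta> e c \<in> K (\<not> e)"
    and \<theta>_mult: "c \<in> K e \<Longrightarrow> d \<in> K e \<Longrightarrow> \<theta> e (c \<otimes> d) = \<theta> e c \<otimes> \<theta> e d"
    and \<theta>_inv: "c \<in> K e \<Longrightarrow> \<theta> (\<not> e) (\<theta> e c) = c"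
begin

section \<open>Coset representatives of the edge groups\<close>

definition rep :: "bool \<Rightarrow> 'a \<Rightarrow> 'a" where
  "rep e m = (if m \<in> K e then \<one> else (SOME r. r \<in> m <# K e))"

definition rem :: "bool \<Rightarrow> 'a \<Rightarrow> 'a" where
  "rem e m = inv (rep e m) \<otimes> m"

lemma U_carrier: "m \<in> U v \<Longrightarrow> m \<in> carrier D"
  using U subgroup.subset by blast

lemma K_carrier: "m \<in> K e \<Longrightarrow> m \<in> carrier D"
  using K subgroup.subset by blast

lemma U_mult: "m \<in> U v \<Longrightarrow> k \<in> U v \<Longrightarrow> m \<otimes> k \<in> U v"
  using U by (simp add: subgroup.m_closed)

lemma K_mult: "m \<in> K e \<Longrightarrow> k \<in> K e \<Longrightarrow> m \<otimes> k \<in> K e"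
  using K by (simp add: subgroup.m_closed)

lemma U_one: "\<one> \<in> U v"
  using U by (simp add: subgroup.one_closed)

lemma K_one: "\<one> \<in> K e"
  using K by (simp add: subgroup.one_closed)

lemma K_in_U: "c \<in> K e \<Longrightarrow> c \<in> U (src e)"
  using K_U by blast

lemma \<theta>_in_U: "c \<in> K e \<Longrightarrow> \<theta> e c \<in> U (src (\<not> e))"
  using K_in_U \<theta>_closed by blast

lemma \<theta>_one: "\<theta> e \<one> = \<one>"
proof -
  have "\<theta> e \<one> \<otimes> \<theta> e \<one> = \<theta> e \<one>" using \<theta>_mult[OF K_one K_one, of e] by simp
  then show ?thesis using K_carrier[OF \<theta>_closed[OF K_one[of e]]] by (metis r_cancel_one)
qed

lemma rep_in_coset: "m \<in> carrier D \<Longrightarrow> rep e m \<in> m <# K e"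
proof (cases "m \<in> K e")
  case True
  then show ?thesis
    using coset_join3[OF K_carrier K] K_one unfolding rep_def by simp
next
  case False
  assume m: "m \<in> carrier D"
  have "m \<otimes> \<one> \<in> m <# K e" unfolding l_coset_def using K_one by blast
  then show ?thesis unfolding rep_def using False by (simp add: someI[of "\<lambda>r. r \<in> m <# K e"])
qed

lemma rep_carrier: "m \<in> carrier D \<Longrightarrow> rep e m \<in> carrier D"
  and rem_K: "m \<in> carrier D \<Longrightarrow> rem e m \<in> K e"
  using l_coset_repr[OF K _ rep_in_coset] unfolding rem_def by auto

lemma rep_rem: "m \<in> carrier D \<Longrightarrow> rep e m \<otimes> rem e m = m"
  using rep_carrier[of m e] unfolding rem_def by (simp add: m_assoc[symmetric])

text \<open>The choice in \<open>rep\<close> is made from the coset and not from \<open>m\<close>,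
  so a right factor in \<open>K e\<close> is absorbed entirely by \<open>rem\<close>.\<close>

lemma rep_mult: "m \<in> carrier D \<Longrightarrow> k \<in> K e \<Longrightarrow> rep e (m \<otimes> k) = rep e m"
proof -
  assume m: "m \<in> carrier D" and k: "k \<in> K e"
  have kc: "k \<in> carrier D" "inv k \<in> K e" using k K_carrier K by (auto simp: subgroup.m_inv_closed)
  have "m \<otimes> k \<in> K e \<longleftrightarrow> m \<in> K e"
  proof
    assume "m \<otimes> k \<in> K e"
    then have "(m \<otimes> k) \<otimes> inv k \<in> K e" using kc K_mult by blast
    then show "m \<in> K e" using m kc by (simp add: m_assoc)
  qed (use k K_mult in auto)
  then show ?thesis unfolding rep_def l_coset_mult_right[OF K m k] by simp
qed

lemma rem_mult: "m \<in> carrier D \<Longrightarrow> k \<in> K e \<Longrightarrow> rem e (m \<otimes> k) = rem e m \<otimes> k"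
  using rep_carrier[of m e] K_carrier[of k e] unfolding rem_def by (simp add: rep_mult m_assoc)

lemma rep_of_K: "m \<in> K e \<Longrightarrow> rep e m = \<one>"
  by (simp add: rep_def)

lemma rep_eq_one: "m \<in> carrier D \<Longrightarrow> rep e m = \<one> \<Longrightarrow> m \<in> K e"
  using rem_K[of m e] unfolding rem_def by simp

lemma rep_rep: "m \<in> carrier D \<Longrightarrow> rep e (rep e m) = rep e m"
  using rep_mult[OF rep_carrier[of m e] rem_K[of m e]] rep_rem[of m e] by simp

lemma rep_U: "m \<in> U (src e) \<Longrightarrow> rep e m \<in> U (src e)"
proof -
  assume m: "m \<in> U (src e)"
  have "inv (rem e m) \<in> U (src e)"
    using rem_K[OF U_carrier[OF m], of e] U K_in_U by (simp add: subgroup.m_inv_closed)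
  then have "m \<otimes> inv (rem e m) \<in> U (src e)" using m U_mult by blast
  moreover have "m \<otimes> inv (rem e m) = rep e m"
    using rep_rem[OF U_carrier[OF m], of e] rep_carrier[OF U_carrier[OF m], of e]
      rem_K[OF U_carrier[OF m], of e] K_carrier by (metis inv_solve_right U_carrier m)
  ultimately show ?thesis by simp
qed

section \<open>Reduced words and the right action of letters\<close>

fun endv :: "'v \<Rightarrow> ('a \<times> bool) list \<Rightarrow> 'v" where
  "endv v [] = v"
| "endv v ((r, e) # L) = src (\<not> e)"

text \<open>The last conjunct forbids backtracking: because \<open>rep e r = r\<close>, the
  condition \<open>r \<noteq> \<one>\<close> says that \<open>r\<close> lies outside
  \<open>K e\<close>.\<close>

fun valid :: "'v \<Rightarrow> ('a \<times> bool) list \<Rightarrow> bool" where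
  "valid v [] \<longleftrightarrow> True"
| "valid v ((r, e) # L) \<longleftrightarrow> valid v L \<and> src e = endv v L \<and> r \<in> U (src e) \<and> rep e r = r \<and>
     (L \<noteq> [] \<and> snd (hd L) = (\<not> e) \<longrightarrow> r \<noteq> \<one>)"

text \<open>All paths start at the base vertex \<open>src True\<close>, which is the vertex of
  \<open>A\<close> in both applications; \<open>v\<close> is the vertex at which they end.\<close>

definition \<Omega> :: "'v \<Rightarrow> (('a \<times> bool) list \<times> 'a) set" where
  "\<Omega> v = {(L, m). valid (src True) L \<and> endv (src True) L = v \<and> m \<in> U v}"

text \<open>The vertex element splits as \<open>rep\<close> times \<open>rem\<close>; the remainder
  lies in the edge group and is moved across the edge by \<open>\<theta>\<close>.\<close>

definition push :: "bool \<Rightarrow> ('a \<times> bool) list \<times> 'a \<Rightarrow> ('a \<times> bool) list \<times> 'a" where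
  "push e s = ((rep e (snd s), e) # fst s, \<theta> e (rem e (snd s)))"

text \<open>Right multiplication by the edge \<open>e\<close>. It cancels against a preceding
  inverse edge precisely when the element between them lies in \<open>K e\<close>.\<close>

fun T :: "bool \<Rightarrow> ('a \<times> bool) list \<times> 'a \<Rightarrow> ('a \<times> bool) list \<times> 'a" where
  "T e ([], m) = push e ([], m)"
| "T e ((r, e') # L, m) =
     (if e' = (\<not> e) \<and> m \<in> K e then (L, r \<otimes> \<theta> e m) else push e ((r, e') # L, m))"

definition act :: "'a \<Rightarrow> ('a \<times> bool) list \<times> 'a \<Rightarrow> ('a \<times> bool) list \<times> 'a" where
  "act a s = (fst s, snd s \<otimes> a)"

lemma act_\<Omega>: "s \<in> \<Omega> v \<Longrightarrow> a \<in> U v \<Longrightarrow> act a s \<in> \<Omega> v"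
  unfolding \<Omega>_def act_def by (auto intro: U_mult)

lemma act_act: "s \<in> \<Omega> v \<Longrightarrow> a \<in> U v \<Longrightarrow> b \<in> U v \<Longrightarrow> act b (act a s) = act (a \<otimes> b) s"
  unfolding \<Omega>_def act_def by (auto simp: m_assoc U_carrier)

lemma act_one: "s \<in> \<Omega> v \<Longrightarrow> act \<one> s = s"
  unfolding \<Omega>_def act_def by (auto dest: U_carrier)

lemma T_cases:
  assumes "s \<in> \<Omega> (src e)"
  obtains (pop) r L m where "s = ((r, \<not> e) # L, m)" "m \<in> K e" "T e s = (L, r \<otimes> \<theta> e m)"
    "valid (src True) ((r, \<not> e) # L)"
  | (push) L m where "s = (L, m)" "T e s = push e s" "valid (src True) L" "endv (src True) L = src e" "m \<in> U (src e)"
    "L \<noteq> [] \<Longrightarrow> snd (hd L) = (\<not> e) \<Longrightarrow> m \<notin> K e"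
proof -
  obtain L m where s: "s = (L, m)" by fastforce
  have v: "valid (src True) L" "endv (src True) L = src e" "m \<in> U (src e)" using assms unfolding s \<Omega>_def by auto
  show ?thesis
  proof (cases L)
    case Nil
    then show ?thesis using s v by (intro that(2)) auto
  next
    case (Cons x L')
    obtain r e' where x: "x = (r, e')" by fastforce
    show ?thesis
    proof (cases "e' = (\<not> e) \<and> m \<in> K e")
      case True
      then show ?thesis using s v Cons x by (intro that(1)) auto
    next
      case False
      then show ?thesis using s v Cons x by (intro that(2)) auto
    qed
  qed
qed

lemma push_\<Omega>:
  assumes "(L, m) \<in> \<Omega> (src e)" and "L \<noteq> [] \<Longrightarrow> snd (hd L) = (\<not> e) \<Longrightarrow> m \<notin> K e"
  shows "push e (L, m) \<in> \<Omega> (src (\<not> e))"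
proof -
  have v: "valid (src True) L" "endv (src True) L = src e" "m \<in> U (src e)" using assms(1) unfolding \<Omega>_def by auto
  note mc = U_carrier[OF v(3)]
  have "L \<noteq> [] \<and> snd (hd L) = (\<not> e) \<longrightarrow> rep e m \<noteq> \<one>" using assms(2) rep_eq_one[OF mc] by blast
  then show ?thesis
    using v rep_U[OF v(3)] rep_rep[OF mc] \<theta>_in_U[OF rem_K[OF mc]] unfolding push_def \<Omega>_def by simp
qed

lemma T_\<Omega>: "s \<in> \<Omega> (src e) \<Longrightarrow> T e s \<in> \<Omega> (src (\<not> e))"
proof (erule T_cases)
  fix r L m assume *: "m \<in> K e" "T e s = (L, r \<otimes> \<theta> e m)" "valid (src True) ((r, \<not> e) # L)"
  then have "r \<otimes> \<theta> e m \<in> U (src (\<not> e))" by (intro U_mult \<theta>_in_U) auto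
  then show ?thesis using * unfolding \<Omega>_def by simp
next
  fix L m assume "s = (L, m)" "T e s = push e s" "valid (src True) L" "endv (src True) L = src e"
    "m \<in> U (src e)" "L \<noteq> [] \<Longrightarrow> snd (hd L) = (\<not> e) \<Longrightarrow> m \<notin> K e"
  then show ?thesis using push_\<Omega>[of L m e] unfolding \<Omega>_def by simp
qed

text \<open>A pop is undone by a push, since the stored \<open>r\<close> is already the chosen
  representative and reducedness prevents a second pop. A push is undone by a pop, since the element
  carried across lies in \<open>K (\<not> e)\<close>.\<close>

lemma T_T: "s \<in> \<Omega> (src e) \<Longrightarrow> T (\<not> e) (T e s) = s"
proof (erule T_cases)
  fix r L m assume *: "s = ((r, \<not> e) # L, m)" "m \<in> K e" "T e s = (L, r \<otimes> \<theta> e m)"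
    "valid (src True) ((r, \<not> e) # L)"
  have r: "r \<in> carrier D" "rep (\<not> e) r = r" using *(4) U_carrier by auto
  have \<theta>: "\<theta> e m \<in> K (\<not> e)" using \<theta>_closed *(2) by blast
  have 1: "rep (\<not> e) (r \<otimes> \<theta> e m) = r" using rep_mult[OF r(1) \<theta>] r by simp
  have "rem (\<not> e) (r \<otimes> \<theta> e m) = rem (\<not> e) r \<otimes> \<theta> e m" using rem_mult[OF r(1) \<theta>] .
  moreover have "rem (\<not> e) r = \<one>" unfolding rem_def r(2) using r by simp
  ultimately have 2: "rem (\<not> e) (r \<otimes> \<theta> e m) = \<theta> e m" using \<theta> K_carrier by simp
  have "push (\<not> e) (L, r \<otimes> \<theta> e m) = s"
    unfolding push_def *(1) using 1 2 \<theta>_inv[OF *(2)] by simp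
  moreover have "T (\<not> e) (L, r \<otimes> \<theta> e m) = push (\<not> e) (L, r \<otimes> \<theta> e m)"
  proof (cases L)
    case (Cons x L')
    have "r \<otimes> \<theta> e m \<notin> K (\<not> e)" if "snd x = e"
    proof
      assume "r \<otimes> \<theta> e m \<in> K (\<not> e)"
      then have "r = \<one>" using rep_of_K 1 by simp
      then show False using *(4) that Cons by (cases x) auto
    qed
    then show ?thesis using Cons by (cases x) auto
  qed simp
  ultimately show ?thesis using *(3) by simp
next
  fix L m assume *: "s = (L, m)" "T e s = push e s" "m \<in> U (src e)"
  have mc: "m \<in> carrier D" using * U_carrier by blast
  have "\<theta> e (rem e m) \<in> K (\<not> e)" using \<theta>_closed rem_K[OF mc] by blast
  then show ?thesis unfolding *(2) unfolding *(1) push_def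
    using \<theta>_inv[OF rem_K[OF mc]] rep_rem[OF mc] by simp
qed

text \<open>The edge relation \<open>c e = e \<theta>(c)\<close> holds on states because a right
  factor \<open>c\<close> from \<open>K e\<close> changes neither the representative nor the
  decision between push and pop.\<close>

lemma T_act:
  assumes "s \<in> \<Omega> (src e)" and c: "c \<in> K e"
  shows "T e (act c s) = act (\<theta> e c) (T e s)"
  using assms(1)
proof (cases rule: T_cases)
  case (pop r L m)
  have "r \<in> carrier D" using pop(4) U_carrier by auto
  moreover have "\<theta> e m \<in> carrier D" "\<theta> e c \<in> carrier D" using \<theta>_closed pop(2) c K_carrier by blast+
  ultimately show ?thesis
    unfolding pop(3) unfolding pop(1) act_def using \<theta>_mult[OF pop(2) c] K_mult[OF pop(2) c] by (simp add: m_assoc)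
next
  case (push L m)
  have mc: "m \<in> carrier D" using push U_carrier by blast
  have "L \<noteq> [] \<Longrightarrow> snd (hd L) = (\<not> e) \<Longrightarrow> m \<otimes> c \<notin> K e"
    using push(6) rep_mult[OF mc c] rep_of_K rep_eq_one[OF mc] by metis
  then have "T e (L, m \<otimes> c) = push e (L, m \<otimes> c)" by (cases L) auto
  then show ?thesis unfolding push(2) unfolding push(1) act_def push_def
    using rep_mult[OF mc c] rem_mult[OF mc c] \<theta>_mult[OF rem_K[OF mc] c] by simp
qed

lemma T_of_Nil: "T e ([], m) = ([(rep e m, e)], \<theta> e (rem e m))"
  by (simp add: push_def)

text \<open>A reduced word read letter by letter is rebuilt without cancellation; this is what makes
  normal forms unique.\<close>

lemma T_extend:
  assumes "valid v ((r, e) # L)"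
  shows "T e (L, r) = ((r, e) # L, \<one>)"
proof -
  have r: "r \<in> carrier D" "rep e r = r" using assms U_carrier by auto
  then have "rem e r = \<one>" unfolding rem_def by simp
  moreover have "r \<notin> K e" if "L \<noteq> []" "snd (hd L) = (\<not> e)" using assms that rep_of_K[of r e] r by auto
  then have "T e (L, r) = push e (L, r)" by (cases L) auto
  ultimately show ?thesis using r \<theta>_one by (simp add: push_def)
qed

text \<open>Syllables come and go at the head of the list, so its last entry, the first syllable of
  the word, persists until the list becomes empty.\<close>

lemma T_last:
  assumes "fst s \<noteq> []" and "fst (T e s) \<noteq> []"
  shows "last (fst (T e s)) = last (fst s)"
  using assms by (cases "(e, s)" rule: T.cases) (auto simp: push_def)

text \<open>The recursion of \<open>valid\<close> peels off the final syllable; left multiplication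
  needs the initial one.\<close>

lemma valid_snoc:
  "valid v (L @ [(r, e)]) \<longleftrightarrow> src e = v \<and> r \<in> U (src e) \<and> rep e r = r \<and> valid (src (\<not> e)) L \<and>
     (L \<noteq> [] \<and> snd (last L) = (\<not> e) \<longrightarrow> fst (last L) \<noteq> \<one>)"
  and endv_snoc: "endv v (L @ [(r, e)]) = endv (src (\<not> e)) L"
proof -
  show endv: "endv v (L @ [(r, e)]) = endv (src (\<not> e)) L" for L by (cases L) auto
  show "valid v (L @ [(r, e)]) \<longleftrightarrow> src e = v \<and> r \<in> U (src e) \<and> rep e r = r \<and> valid (src (\<not> e)) L \<and>
     (L \<noteq> [] \<and> snd (last L) = (\<not> e) \<longrightarrow> fst (last L) \<noteq> \<one>)"
  proof (induction L)
    case (Cons x L)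
    obtain r' e' where x: "x = (r', e')" by fastforce
    show ?case
    proof (cases L)
      case Nil
      then show ?thesis using x by auto
    next
      case (Cons y L')
      then have "L \<noteq> []" "hd (L @ [(r, e)]) = hd L" by auto
      then show ?thesis using Cons.IH x endv by auto
    qed
  qed auto
qed

end

text \<open>Evaluation of states in a group; an amalgam is the case where the edge elements \<open>\<tau>\<close> are trivial.\<close>

locale bass_serre_eval = bass_serre D src U K \<theta> + G: group G
  for D :: "('a, 'b) monoid_scheme" (structure) and src :: "bool \<Rightarrow> 'v" and U K \<theta>
    and G :: "('g, 'h) monoid_scheme" (structure) +
  fixes j :: "'v \<Rightarrow> 'a \<Rightarrow> 'g" and \<tau> :: "bool \<Rightarrow> 'g"
  assumes j_closed: "a \<in> U v \<Longrightarrow> j v a \<in> carrier G"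
    and j_mult: "a \<in> U v \<Longrightarrow> b \<in> U v \<Longrightarrow> j v (a \<otimes>\<^bsub>D\<^esub> b) = j v a \<otimes>\<^bsub>G\<^esub> j v b"
    and \<tau>_closed: "\<tau> e \<in> carrier G"
    and \<tau>_inv: "\<tau> (\<not> e) \<otimes>\<^bsub>G\<^esub> \<tau> e = \<one>\<^bsub>G\<^esub>"
    and j_\<tau>: "c \<in> K e \<Longrightarrow> j (src e) c \<otimes>\<^bsub>G\<^esub> \<tau> e = \<tau> e \<otimes>\<^bsub>G\<^esub> j (src (\<not> e)) (\<theta> e c)"
begin

lemma j_one: "j v \<one>\<^bsub>D\<^esub> = \<one>\<^bsub>G\<^esub>"
proof -
  have "j v \<one>\<^bsub>D\<^esub> \<otimes>\<^bsub>G\<^esub> j v \<one>\<^bsub>D\<^esub> = j v \<one>\<^bsub>D\<^esub>" using j_mult[OF U_one U_one, of v] by simp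
  then show ?thesis using j_closed[OF U_one] by (metis G.r_cancel_one)
qed

fun ev :: "('a \<times> bool) list \<Rightarrow> 'g" where
  "ev [] = \<one>\<^bsub>G\<^esub>"
| "ev ((r, e) # L) = ev L \<otimes>\<^bsub>G\<^esub> (j (src e) r \<otimes>\<^bsub>G\<^esub> \<tau> e)"

definition E :: "('a \<times> bool) list \<times> 'a \<Rightarrow> 'g" where
  "E s = ev (fst s) \<otimes>\<^bsub>G\<^esub> j (endv (src True) (fst s)) (snd s)"

lemma ev_closed: "valid v L \<Longrightarrow> ev L \<in> carrier G"
  by (induction v L rule: valid.induct) (auto simp: j_closed \<tau>_closed)

lemma E_closed: "s \<in> \<Omega> v \<Longrightarrow> E s \<in> carrier G"
  unfolding \<Omega>_def E_def by (auto simp: j_closed dest: ev_closed)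

lemma E_act: "s \<in> \<Omega> v \<Longrightarrow> a \<in> U v \<Longrightarrow> E (act a s) = E s \<otimes>\<^bsub>G\<^esub> j v a"
  unfolding \<Omega>_def E_def act_def by (auto simp: j_closed j_mult G.m_assoc dest: ev_closed)

text \<open>In the cancelling case \<open>j_\<tau>\<close> carries \<open>m\<close> across the edge,
  after which the two mutually inverse edge elements meet.\<close>

lemma E_T:
  assumes "s \<in> \<Omega> (src e)"
  shows "E (T e s) = E s \<otimes>\<^bsub>G\<^esub> \<tau> e"
  using assms
proof (cases rule: T_cases)
  case (pop r L m)
  have r: "r \<in> U (src (\<not> e))" "endv (src True) L = src (\<not> e)" "ev L \<in> carrier G" using pop(4) ev_closed by auto
  note c = j_closed[OF r(1)] j_closed[OF K_in_U[OF pop(2)]] j_closed[OF \<theta>_in_U[OF pop(2)]]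
  have "E s \<otimes>\<^bsub>G\<^esub> \<tau> e = ev L \<otimes>\<^bsub>G\<^esub> (j (src (\<not> e)) r \<otimes>\<^bsub>G\<^esub> \<tau> (\<not> e)) \<otimes>\<^bsub>G\<^esub> (j (src e) m \<otimes>\<^bsub>G\<^esub> \<tau> e)"
    unfolding E_def pop(1) using r c \<tau>_closed by (simp add: G.m_assoc)
  also have "\<dots> = ev L \<otimes>\<^bsub>G\<^esub> (j (src (\<not> e)) r \<otimes>\<^bsub>G\<^esub> ((\<tau> (\<not> e) \<otimes>\<^bsub>G\<^esub> \<tau> e) \<otimes>\<^bsub>G\<^esub> j (src (\<not> e)) (\<theta> e m)))"
    unfolding j_\<tau>[OF pop(2)] using r c \<tau>_closed by (simp add: G.m_assoc)
  also have "\<dots> = E (T e s)"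
    unfolding \<tau>_inv pop(3) E_def using r c j_mult[OF r(1) \<theta>_in_U[OF pop(2)]] by simp
  finally show ?thesis by simp
next
  case (push L m)
  have mc: "m \<in> carrier D" using push U_carrier by blast
  note r = rep_U[OF push(5)] and k = rem_K[OF mc, of e]
  note c = j_closed[OF r] j_closed[OF K_in_U[OF k]] j_closed[OF \<theta>_in_U[OF k]] ev_closed[OF push(3)] \<tau>_closed
  have "j (src e) m = j (src e) (rep e m) \<otimes>\<^bsub>G\<^esub> j (src e) (rem e m)"
    using j_mult[OF r K_in_U[OF k]] rep_rem[OF mc] by simp
  then have "E s \<otimes>\<^bsub>G\<^esub> \<tau> e = ev L \<otimes>\<^bsub>G\<^esub> (j (src e) (rep e m) \<otimes>\<^bsub>G\<^esub> (j (src e) (rem e m) \<otimes>\<^bsub>G\<^esub> \<tau> e))"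
    unfolding E_def push(1) using push(4) c by (simp add: G.m_assoc)
  also have "\<dots> = E (T e s)"
    unfolding j_\<tau>[OF k] push(2) unfolding push(1) E_def push_def using c by (simp add: G.m_assoc)
  finally show ?thesis by simp
qed

lemma ev_snoc:
  assumes "valid (src (\<not> e)) L" and "r \<in> U (src e)"
  shows "ev (L @ [(r, e)]) = j (src e) r \<otimes>\<^bsub>G\<^esub> (\<tau> e \<otimes>\<^bsub>G\<^esub> ev L)"
  using assms(1)
proof (induction L)
  case Nil
  then show ?case using assms(2) j_closed \<tau>_closed by simp
next
  case (Cons x L)
  obtain r' e' where x: "x = (r', e')" by fastforce
  have "ev L \<in> carrier G" "j (src e') r' \<in> carrier G" using Cons.prems x ev_closed j_closed by auto
  then show ?case using Cons x assms(2) j_closed \<tau>_closed by (simp add: G.m_assoc)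
qed

lemma E_snoc:
  assumes "valid (src (\<not> e)) L" and "r \<in> U (src e)" and "m \<in> U (endv (src (\<not> e)) L)"
  shows "E (L @ [(r, e)], m) =
    j (src e) r \<otimes>\<^bsub>G\<^esub> (\<tau> e \<otimes>\<^bsub>G\<^esub> (ev L \<otimes>\<^bsub>G\<^esub> j (endv (src (\<not> e)) L) m))"
  unfolding E_def using ev_snoc[OF assms(1,2)] endv_snoc[of "src True" L r e] assms j_closed \<tau>_closed ev_closed[OF assms(1)]
  by (simp add: G.m_assoc)

end

section \<open>Unique normal forms and the branches at the base vertex\<close>

locale bass_serre_nf = bass_serre_eval D src U K \<theta> G j \<tau>
  for D :: "('a, 'b) monoid_scheme" (structure) and src :: "bool \<Rightarrow> 'v" and U K \<theta>
    and G :: "('g, 'h) monoid_scheme" (structure) and j \<tau> +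
  fixes nf
  assumes nf_\<Omega>: "g \<in> carrier G \<Longrightarrow> nf g \<in> \<Omega> (src True)"
    and E_nf: "g \<in> carrier G \<Longrightarrow> E (nf g) = g"
    and nf_E: "s \<in> \<Omega> (src True) \<Longrightarrow> nf (E s) = s"
begin

text \<open>The last list entry is the first syllable. Its representative and its edge determine the
  tree edge by which the branch is attached to the base vertex.\<close>

definition lab where
  "lab g = (if fst (nf g) = [] then None else Some (last (fst (nf g))))"

lemma nf_act: "g \<in> carrier G \<Longrightarrow> a \<in> U (src True) \<Longrightarrow> nf (g \<otimes>\<^bsub>G\<^esub> j (src True) a) = act a (nf g)"
  using E_act[OF nf_\<Omega>] nf_E[OF act_\<Omega>[OF nf_\<Omega>]] E_nf by metis

lemma lab_j: "g \<in> carrier G \<Longrightarrow> a \<in> U (src True) \<Longrightarrow> lab (g \<otimes>\<^bsub>G\<^esub> j (src True) a) = lab g"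
  unfolding lab_def by (simp add: nf_act act_def)

text \<open>Distinct elements of the base vertex group are distinct states without syllables, so
  uniqueness of normal forms embeds the group.\<close>

lemma inj_j: "inj_on (j (src True)) (U (src True))"
proof (rule inj_onI)
  fix a b assume a: "a \<in> U (src True)" "b \<in> U (src True)" "j (src True) a = j (src True) b"
  have "E ([], a) = E ([], b)" unfolding E_def using a j_closed by simp
  moreover have "([], a) \<in> \<Omega> (src True)" "([], b) \<in> \<Omega> (src True)" unfolding \<Omega>_def using a by auto
  ultimately show "a = b" using nf_E by (metis snd_conv)
qed

lemma lab_None: "g \<in> carrier G \<Longrightarrow> lab g = None \<longleftrightarrow> g \<in> j (src True) ` U (src True)"
proof
  assume g: "g \<in> carrier G" and "lab g = None"
  then have "fst (nf g) = []" unfolding lab_def by (simp split: if_splits)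
  then have "snd (nf g) \<in> U (src True)" "E (nf g) = j (src True) (snd (nf g))"
    using nf_\<Omega>[OF g] j_closed unfolding \<Omega>_def E_def by auto
  then show "g \<in> j (src True) ` U (src True)" using E_nf[OF g] by auto
next
  assume "g \<in> j (src True) ` U (src True)"
  then obtain a where a: "a \<in> U (src True)" "g = j (src True) a" by auto
  have "E ([], a) = g" unfolding E_def using a j_closed by simp
  moreover have "([], a) \<in> \<Omega> (src True)" unfolding \<Omega>_def using a by auto
  ultimately have "nf g = ([], a)" using nf_E by metis
  then show "lab g = None" unfolding lab_def by simp
qed

lemma lab_E: "(L, m) \<in> \<Omega> (src True) \<Longrightarrow> lab (E (L, m)) = (if L = [] then None else Some (last L))"
  unfolding lab_def by (simp add: nf_E)

lemma E_Nil: "a \<in> U (src True) \<Longrightarrow> E ([], a) = j (src True) a"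
  unfolding E_def using j_closed by simp

lemma nf_T:
  assumes "g \<in> carrier G" and "src e = src True" and "src (\<not> e) = src True"
  shows "nf (g \<otimes>\<^bsub>G\<^esub> \<tau> e) = T e (nf g)"
  using E_T[of "nf g" e] nf_E[of "T e (nf g)"] T_\<Omega>[of "nf g" e] nf_\<Omega>[OF assms(1)] E_nf[OF assms(1)] assms(2,3)
  by simp

lemma lab_SomeD:
  assumes "g \<in> carrier G" and "lab g = Some l"
  obtains L m where "g = E (L @ [l], m)" "(L @ [l], m) \<in> \<Omega> (src True)"
proof -
  have "fst (nf g) \<noteq> []" "last (fst (nf g)) = l" using assms(2) unfolding lab_def by (auto split: if_splits)
  then have "fst (nf g) = butlast (fst (nf g)) @ [l]" by (metis append_butlast_last_id)
  then have "nf g = (butlast (fst (nf g)) @ [l], snd (nf g))" by (metis prod.collapse)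
  then show ?thesis using that E_nf[OF assms(1)] nf_\<Omega>[OF assms(1)] by metis
qed

text \<open>Changing the first representative keeps a word reduced, because reducedness constrains
  only the later ones. Thus \<open>r\<close> moves the branch \<open>(\<one>, e)\<close> into the
  branch \<open>(r, e)\<close>.\<close>

lemma lab_translate:
  assumes "g \<in> carrier G" and "lab g = Some (\<one>, e)" and "r \<in> U (src True)" and "rep e r = r"
  shows "lab (j (src True) r \<otimes>\<^bsub>G\<^esub> g) = Some (r, e)"
proof -
  obtain L m where g: "g = E (L @ [(\<one>, e)], m)" "(L @ [(\<one>, e)], m) \<in> \<Omega> (src True)"
    using lab_SomeD[OF assms(1,2)] .
  have L: "src e = src True" "valid (src (\<not> e)) L" "m \<in> U (endv (src (\<not> e)) L)"
    "L \<noteq> [] \<and> snd (last L) = (\<not> e) \<longrightarrow> fst (last L) \<noteq> \<one>" "endv (src (\<not> e)) L = src True"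
    using g(2) unfolding \<Omega>_def by (auto simp: valid_snoc endv_snoc)
  have *: "(L @ [(r, e)], m) \<in> \<Omega> (src True)"
    using L assms(3,4) unfolding \<Omega>_def by (auto simp: valid_snoc endv_snoc)
  have c: "ev L \<in> carrier G" "j (src True) m \<in> carrier G" "j (src True) r \<in> carrier G"
    using ev_closed[OF L(2)] L(3,5) j_closed assms(3) by auto
  have "E (L @ [(r, e)], m) = j (src True) r \<otimes>\<^bsub>G\<^esub> g"
    unfolding g(1) using E_snoc[OF L(2) _ L(3)] U_one assms(3) L(1,5) j_one c \<tau>_closed by simp
  then show ?thesis using lab_E[OF *] by simp
qed

lemma state_of:
  assumes "g \<in> carrier G"
  obtains L m where "g = E (L, m)" "valid (src True) L" "endv (src True) L = src True" "m \<in> U (src True)"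
    "lab g = (if L = [] then None else Some (last L))"
proof -
  obtain L m where n: "nf g = (L, m)" by fastforce
  show ?thesis
    by (rule that[of L m]) (use E_nf[OF assms] nf_\<Omega>[OF assms] n in \<open>auto simp: \<Omega>_def lab_def\<close>)
qed

text \<open>The decomposition into representative and remainder exhibits the coset of
  \<open>K e\<close> at which a branch entered from \<open>g\<close> is attached.\<close>

lemma exit_mem:
  assumes "g \<in> carrier G" and "fst (nf g) = []"
  shows "g = j (src True) (rep e (snd (nf g)) \<otimes> rem e (snd (nf g)))"
proof -
  have m: "snd (nf g) \<in> U (src True)" using nf_\<Omega>[OF assms(1)] unfolding \<Omega>_def by auto
  have "nf g = ([], snd (nf g))" using assms(2) by (metis prod.collapse)
  then show ?thesis using E_nf[OF assms(1)] E_Nil[OF m] rep_rem[OF U_carrier[OF m], of e] by metis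
qed

end

section \<open>Groups given by presentations\<close>

locale presentation =
  fixes L :: "'l \<Rightarrow> bool" and R :: "'l list \<Rightarrow> 'l list \<Rightarrow> bool"
  assumes R_letters: "R u v \<Longrightarrow> (\<forall>l\<in>set u. L l) \<and> (\<forall>l\<in>set v. L l)"
begin

definition cls :: "'l list \<Rightarrow> 'l list set" where
  "cls w = {v. pres_eq L R w v}"

lemma pres_eq_letters: "pres_eq L R u v \<Longrightarrow> (\<forall>l\<in>set u. L l) \<and> (\<forall>l\<in>set v. L l)"
  by (induction rule: pres_eq.induct) (use R_letters in auto)

lemma cls_eq_iff: "\<forall>l\<in>set v. L l \<Longrightarrow> cls u = cls v \<longleftrightarrow> pres_eq L R u v"
proof
  assume "\<forall>l\<in>set v. L l" "cls u = cls v"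
  then show "pres_eq L R u v" using pres_eq.refl[of v L R] unfolding cls_def by blast
next
  assume "pres_eq L R u v"
  then show "cls u = cls v" unfolding cls_def by (blast intro: pres_eq.sym pres_eq.trans)
qed

lemma cls_R: "R u v \<Longrightarrow> cls u = cls v"
  using cls_eq_iff R_letters pres_eq.base[of R u v L] by metis

lemma carrier_pres: "carrier (pres_monoid L R) = cls ` {w. \<forall>l\<in>set w. L l}"
  unfolding pres_monoid_def quotient_def cls_def by auto

lemma one_pres: "\<one>\<^bsub>pres_monoid L R\<^esub> = cls []"
  unfolding pres_monoid_def cls_def by simp

text \<open>The product of classes in \<open>pres_monoid\<close> ranges over all representatives;
  closure of the congruence under contexts reduces it to one concatenation.\<close>

lemma mult_pres:
  assumes "\<forall>l\<in>set u. L l" and "\<forall>l\<in>set v. L l"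
  shows "cls u \<otimes>\<^bsub>pres_monoid L R\<^esub> cls v = cls (u @ v)"
proof -
  have "pres_eq L R (u @ v) (u' @ v')" if "pres_eq L R u u'" "pres_eq L R v v'" for u' v'
  proof -
    have "pres_eq L R ([] @ u @ v) ([] @ u' @ v)" using that assms by (intro pres_eq.ctxt) auto
    moreover have "pres_eq L R (u' @ v @ []) (u' @ v' @ [])"
      using that pres_eq_letters by (intro pres_eq.ctxt) auto
    ultimately show ?thesis by (auto intro: pres_eq.trans)
  qed
  then have "pres_eq L R (u @ v) w \<longleftrightarrow>
      (\<exists>u'. pres_eq L R u u' \<and> (\<exists>v'. pres_eq L R v v' \<and> pres_eq L R (u' @ v') w))" for w
    using pres_eq.refl[OF assms(1)] pres_eq.refl[OF assms(2)]
    by (blast intro: pres_eq.sym pres_eq.trans)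
  then show ?thesis unfolding pres_monoid_def cls_def by auto
qed

text \<open>An action of the letters on which both sides of each relation agree factors through the
  presentation. Agreement is asked only on the invariant set \<open>S\<close>, later the set of
  reduced states.\<close>

lemma foldl_pres_eq:
  assumes "pres_eq L R u v"
    and S: "\<And>s l. s \<in> S \<Longrightarrow> L l \<Longrightarrow> f s l \<in> S"
    and R: "\<And>s u v. s \<in> S \<Longrightarrow> R u v \<Longrightarrow> foldl f s u = foldl f s v"
    and "s \<in> S"
  shows "foldl f s u = foldl f s v"
  using assms(1,4)
proof (induction arbitrary: s rule: pres_eq.induct)
  case (ctxt u v w1 w2)
  have "foldl f s w1 \<in> S" using ctxt(2,5) by (induction w1 arbitrary: s) (auto intro: S)
  then show ?case using ctxt by simp
qed (use R in auto)

lemma foldl_closed: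
  assumes "\<And>s l. s \<in> S \<Longrightarrow> L l \<Longrightarrow> f s l \<in> S" and "\<forall>l\<in>set w. L l" and "s \<in> S"
  shows "foldl f s w \<in> S"
  using assms(2,3) by (induction w arbitrary: s) (auto intro: assms(1))

lemma cls_Cons: "\<forall>l'\<in>set (l # w). L l' \<Longrightarrow> cls (l # w) = cls [l] \<otimes>\<^bsub>pres_monoid L R\<^esub> cls w"
  using mult_pres[of "[l]" w] by simp

lemma cls_closed: "\<forall>l\<in>set w. L l \<Longrightarrow> cls w \<in> carrier (pres_monoid L R)"
  unfolding carrier_pres by auto

lemma fin_gen_setI:
  assumes "group (pres_monoid L R)" and "finite Y" and "Y \<subseteq> carrier (pres_monoid L R)"
    and "\<And>y. y \<in> Y \<Longrightarrow> inv\<^bsub>pres_monoid L R\<^esub> y \<in> Y"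
    and "\<And>l. L l \<Longrightarrow> cls [l] \<in> generate (pres_monoid L R) Y"
  shows "fin_gen_set (pres_monoid L R) Y"
proof -
  interpret group "pres_monoid L R" by fact
  have "cls w \<in> generate (pres_monoid L R) Y" if "\<forall>l\<in>set w. L l" for w
    using that
  proof (induction w)
    case Nil
    show ?case unfolding one_pres[symmetric] by (rule generate.one)
  next
    case (Cons l w)
    then show ?case unfolding cls_Cons[OF Cons.prems] by (intro generate.eng assms(5)) auto
  qed
  then have "carrier (pres_monoid L R) \<subseteq> generate (pres_monoid L R) Y" unfolding carrier_pres by auto
  moreover have "generate (pres_monoid L R) Y \<subseteq> carrier (pres_monoid L R)"
    using generate_incl[OF assms(3)] .
  ultimately show ?thesis unfolding fin_gen_set_def using assms(2-4) by auto
qed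

end

lemma (in group) hom_image_in_generate:
  assumes "group H" and "f \<in> hom H G" and "fin_gen_set H Y" and "a \<in> carrier H"
    and "f ` Y \<subseteq> Z"
  shows "f a \<in> generate G Z"
proof -
  interpret f: group_hom H G f using assms is_group by (simp add: group_hom_def group_hom_axioms_def)
  have Y: "Y \<subseteq> carrier H" "a \<in> generate H Y" using assms unfolding fin_gen_set_def by auto
  then have "f a \<in> generate G (f ` Y)" using f.generate_img by blast
  then show ?thesis using mono_generate[OF assms(5)] by blast
qed


section \<open>HNN extensions\<close>

text \<open>\<open>A_steps\<close> and \<open>C_prieto\<close> are the Hucha and Prieto hypotheses
  in the language of finite step sets.\<close>

locale hucha_prieto = A: group A for A :: "('a, 'b) monoid_scheme" (structure) +
  fixes C :: "'a set"
  assumes fg: "finitely_generated A" and lo: "left_orderable A" and C: "subgroup C A"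
    and A_steps: "\<And>P F. pos_cone A P \<Longrightarrow> finite F \<Longrightarrow> F \<subseteq> carrier A \<Longrightarrow>
      \<exists>u\<in>P. \<exists>v\<in>P. (u, v) \<notin> (fstep A F (nneg A P))\<^sup>*"
    and C_prieto: "prieto_fin (A\<lparr>carrier := C\<rparr>)"
begin

text \<open>A step path inside a cone is also one inside its nonnegative part, which
  \<open>A_steps\<close> excludes for a suitable pair.\<close>

lemma prieto_subgroup_proper:
  assumes "prieto_fin (A\<lparr>carrier := H\<rparr>)"
  shows "H \<noteq> carrier A"
proof
  assume "H = carrier A"
  then have pr: "prieto_fin A" using assms by simp
  obtain P where P: "pos_cone A P" using lo unfolding left_orderable_def by auto
  then obtain F where F: "finite F" "F \<subseteq> carrier A" "\<forall>u\<in>P. \<forall>v\<in>P. (u, v) \<in> (fstep A F P)\<^sup>*"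
    using pr unfolding prieto_fin_def by metis
  obtain u v where uv: "u \<in> P" "v \<in> P" "(u, v) \<notin> (fstep A F (nneg A P))\<^sup>*"
    using A_steps[OF P F(1,2)] by blast
  have "(u, v) \<in> (fstep A F (nneg A P))\<^sup>*"
    by (rule fstep_rtrancl_mono[of u v A F P]) (use F(3) uv A.nneg_iff[OF P] in auto)
  then show False using uv by simp
qed

end

text \<open>The edge \<^term>\<open>True\<close> is \<open>t\<close>; as \<open>\<phi> c t = t c\<close>, its edge group is \<open>\<phi> ` C\<close>.\<close>

definition hnn_sub :: "'a set \<Rightarrow> ('a \<Rightarrow> 'a) \<Rightarrow> bool \<Rightarrow> 'a set" where
  "hnn_sub C \<phi> e = (if e then \<phi> ` C else C)"

definition hnn_map :: "'a set \<Rightarrow> ('a \<Rightarrow> 'a) \<Rightarrow> bool \<Rightarrow> 'a \<Rightarrow> 'a" where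
  "hnn_map C \<phi> e = (if e then inv_into C \<phi> else \<phi>)"

locale hnn_extension = hucha_prieto A C for A :: "('a, 'b) monoid_scheme" (structure) and C +
  fixes \<phi> :: "'a \<Rightarrow> 'a"
  assumes \<phi>: "\<phi> \<in> hom (A\<lparr>carrier := C\<rparr>) A" and \<phi>_inj: "inj_on \<phi> C"
    and G_lo: "left_orderable (HNN A C \<phi>)"
begin

lemma C_carrier: "c \<in> C \<Longrightarrow> c \<in> carrier A"
  using C subgroup.subset by blast

lemma C_group: "group (A\<lparr>carrier := C\<rparr>)"
  using A.subgroup_imp_group[OF C] .

sublocale \<phi>: group_hom "A\<lparr>carrier := C\<rparr>" A \<phi>
  using C_group \<phi> A.is_group by (simp add: group_hom_def group_hom_axioms_def)

lemma \<phi>_closed: "c \<in> C \<Longrightarrow> \<phi> c \<in> carrier A"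
  using \<phi>.hom_closed by simp

lemma \<phi>_mult: "c \<in> C \<Longrightarrow> d \<in> C \<Longrightarrow> \<phi> (c \<otimes> d) = \<phi> c \<otimes> \<phi> d"
  using \<phi>.hom_mult by simp

lemma \<phi>_image: "subgroup (\<phi> ` C) A"
  using \<phi>.img_is_subgroup by simp

sublocale bass_serre A "\<lambda>_. ()" "\<lambda>_. carrier A" "hnn_sub C \<phi>" "hnn_map C \<phi>"
proof (intro_locales, rule bass_serre_axioms.intro)
  fix e :: bool and c d :: 'a and v :: unit
  show "subgroup (carrier A) A" by (rule A.subgroup_self)
  show K: "subgroup (hnn_sub C \<phi> e) A" unfolding hnn_sub_def using \<phi>_image C by simp
  show "hnn_sub C \<phi> e \<subseteq> carrier A" using subgroup.subset[OF K] .
  assume c: "c \<in> hnn_sub C \<phi> e"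
  show "hnn_map C \<phi> e c \<in> hnn_sub C \<phi> (\<not> e)"
    using c inv_into_into[of c \<phi> C] unfolding hnn_sub_def hnn_map_def by (auto split: if_splits)
  show "hnn_map C \<phi> (\<not> e) (hnn_map C \<phi> e c) = c"
    using c \<phi>_inj unfolding hnn_sub_def hnn_map_def by (auto split: if_splits simp: f_inv_into_f)
  assume d: "d \<in> hnn_sub C \<phi> e"
  show "hnn_map C \<phi> e (c \<otimes> d) = hnn_map C \<phi> e c \<otimes> hnn_map C \<phi> e d"
  proof (cases e)
    case True
    then obtain c' d' where c': "c = \<phi> c'" "c' \<in> C" "d = \<phi> d'" "d' \<in> C"
      using c d unfolding hnn_sub_def by auto
    then have "c \<otimes> d = \<phi> (c' \<otimes> d')" using \<phi>_mult by simp
    moreover have "c' \<otimes> d' \<in> C" using c' C by (simp add: subgroup.m_closed)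
    ultimately show ?thesis using c' True \<phi>_inj unfolding hnn_map_def by simp
  next
    case False
    then show ?thesis using c d \<phi>_mult unfolding hnn_sub_def hnn_map_def by simp
  qed
qed

sublocale presentation "hnn_letter A" "hnn_rel A C \<phi>"
  by standard (erule hnn_rel.cases; auto simp: hnn_letter_def \<phi>_closed C_carrier)

abbreviation "G \<equiv> HNN A C \<phi>"

lemma G_def: "G = pres_monoid (hnn_letter A) (hnn_rel A C \<phi>)"
  by (simp add: HNN_def)

sublocale G: group G
  using G_lo unfolding left_orderable_def by simp

lemma letters: "hnn_letter A (Inl a) \<longleftrightarrow> a \<in> carrier A" "hnn_letter A (Inr e)"
  by (simp_all add: hnn_letter_def)

lemma mult_cls: "\<forall>l\<in>set u. hnn_letter A l \<Longrightarrow> \<forall>l\<in>set v. hnn_letter A l \<Longrightarrow>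
    cls u \<otimes>\<^bsub>G\<^esub> cls v = cls (u @ v)"
  unfolding G_def by (rule mult_pres)

lemma one_cls: "\<one>\<^bsub>G\<^esub> = cls []"
  unfolding G_def by (rule one_pres)

lemma cls_carrier: "\<forall>l\<in>set w. hnn_letter A l \<Longrightarrow> cls w \<in> carrier G"
  unfolding G_def by (rule cls_closed)

lemma t_inv: "cls [Inr (\<not> e)] \<otimes>\<^bsub>G\<^esub> cls [Inr e] = \<one>\<^bsub>G\<^esub>"
  using mult_cls[of "[Inr (\<not> e)]" "[Inr e]"] cls_R[OF hnn_rel.tinv1] cls_R[OF hnn_rel.tinv2]
  by (cases e) (auto simp: letters one_cls)

lemma t_conj: "c \<in> C \<Longrightarrow>
    cls [Inr True] \<otimes>\<^bsub>G\<^esub> (cls [Inl c] \<otimes>\<^bsub>G\<^esub> cls [Inr False]) = cls [Inl (\<phi> c)]"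
  using cls_R[OF hnn_rel.conj, of c] by (simp add: mult_cls letters C_carrier)

sublocale bass_serre_eval A "\<lambda>_. ()" "\<lambda>_. carrier A" "hnn_sub C \<phi>" "hnn_map C \<phi>" G
  "\<lambda>_ a. cls [Inl a]" "\<lambda>e. cls [Inr e]"
proof (intro_locales, rule bass_serre_eval_axioms.intro)
  fix a b :: 'a and e :: bool
  show "cls [Inr e] \<in> carrier G" by (simp add: cls_carrier letters)
  show "cls [Inr (\<not> e)] \<otimes>\<^bsub>G\<^esub> cls [Inr e] = \<one>\<^bsub>G\<^esub>" by (rule t_inv)
  show "cls [Inl a] \<otimes>\<^bsub>G\<^esub> cls [Inr e] = cls [Inr e] \<otimes>\<^bsub>G\<^esub> cls [Inl (hnn_map C \<phi> e a)]"
    if a: "a \<in> hnn_sub C \<phi> e"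
  proof (cases e)
    case True
    then obtain c where c: "c \<in> C" "a = \<phi> c" using a unfolding hnn_sub_def by auto
    let ?t = "cls [Inr True]" and ?t' = "cls [Inr False]" and ?c = "cls [Inl c]"
    have cl: "?t \<in> carrier G" "?t' \<in> carrier G" "?c \<in> carrier G" using c C_carrier by (auto simp: cls_carrier letters)
    have "cls [Inl a] \<otimes>\<^bsub>G\<^esub> ?t = ?t \<otimes>\<^bsub>G\<^esub> (?c \<otimes>\<^bsub>G\<^esub> (?t' \<otimes>\<^bsub>G\<^esub> ?t))"
      using t_conj[OF c(1)] c cl by (simp add: G.m_assoc[symmetric])
    also have "\<dots> = ?t \<otimes>\<^bsub>G\<^esub> ?c" using t_inv[of True] cl by simp
    finally show ?thesis using True c \<phi>_inj unfolding hnn_map_def by simp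
  next
    case False
    then have c: "a \<in> C" using a unfolding hnn_sub_def by simp
    let ?t = "cls [Inr True]" and ?t' = "cls [Inr False]" and ?c = "cls [Inl a]"
    have cl: "?t \<in> carrier G" "?t' \<in> carrier G" "?c \<in> carrier G" using c C_carrier by (auto simp: cls_carrier letters)
    have "?t' \<otimes>\<^bsub>G\<^esub> cls [Inl (\<phi> a)] = (?t' \<otimes>\<^bsub>G\<^esub> ?t) \<otimes>\<^bsub>G\<^esub> (?c \<otimes>\<^bsub>G\<^esub> ?t')"
      using t_conj[OF c] cl by (simp add: G.m_assoc)
    also have "\<dots> = ?c \<otimes>\<^bsub>G\<^esub> ?t'" using t_inv[of True] cl by simp
    finally show ?thesis using False unfolding hnn_map_def by simp
  qed
  assume a: "a \<in> carrier A"
  show "cls [Inl a] \<in> carrier G" using a by (simp add: cls_carrier letters)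
  assume b: "b \<in> carrier A"
  show "cls [Inl (a \<otimes> b)] = cls [Inl a] \<otimes>\<^bsub>G\<^esub> cls [Inl b]"
    using a b cls_R[OF hnn_rel.mul, of a b] by (simp add: mult_cls letters)
qed

section \<open>Van der Waerden's action for HNN extensions\<close>

definition move :: "('a \<times> bool) list \<times> 'a \<Rightarrow> 'a + bool \<Rightarrow> ('a \<times> bool) list \<times> 'a" where
  "move s l = (case l of Inl a \<Rightarrow> act a s | Inr e \<Rightarrow> T e s)"

text \<open>The word picked from the class is irrelevant, as \<open>nf_cls\<close> shows, because
  relators act trivially on reduced states.\<close>

definition nf :: "('a + bool) list set \<Rightarrow> ('a \<times> bool) list \<times> 'a" where
  "nf g = foldl move ([], \<one>) (SOME w. w \<in> g)"

lemma move_simps [simp]: "move s (Inl a) = act a s" "move s (Inr e) = T e s"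
  by (simp_all add: move_def)

lemma move_\<Omega>: "s \<in> \<Omega> () \<Longrightarrow> hnn_letter A l \<Longrightarrow> move s l \<in> \<Omega> ()"
  using act_\<Omega>[of s "()"] T_\<Omega>[of s] unfolding move_def hnn_letter_def by (auto split: sum.splits)

lemma move_rel: "s \<in> \<Omega> () \<Longrightarrow> hnn_rel A C \<phi> u v \<Longrightarrow> foldl move s u = foldl move s v"
proof (erule hnn_rel.cases)
  fix c assume s: "s \<in> \<Omega> ()" and c: "u = [Inr True, Inl c, Inr False]" "v = [Inl (\<phi> c)]" "c \<in> C"
  \<comment> \<open>After \<open>t\<close> has acted, \<open>t c t^-1\<close> is read at the edge
    \<open>False\<close>, where \<open>C\<close> is the edge group and \<open>\<phi>\<close> the
    edge map.\<close>
  have "T False (act c (T True s)) = act (hnn_map C \<phi> False c) (T False (T True s))"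
    using T_act[where s = "T True s" and e = False and c = c] T_\<Omega>[of s True] s c unfolding hnn_sub_def by simp
  also have "\<dots> = act (\<phi> c) s" using T_T[of s True] s unfolding hnn_map_def by simp
  finally show ?thesis using c by simp
qed (use T_T[of s True] T_T[of s False] act_act[of s "()"] act_one[of s "()"] in auto)

lemma start_\<Omega>: "([], \<one>) \<in> \<Omega> ()"
  unfolding \<Omega>_def by simp

lemma nf_cls:
  assumes "\<forall>l\<in>set w. hnn_letter A l"
  shows "nf (cls w) = foldl move ([], \<one>) w"
proof -
  have "w \<in> cls w" unfolding cls_def using pres_eq.refl[OF assms] by simp
  then have "pres_eq (hnn_letter A) (hnn_rel A C \<phi>) w (SOME v. v \<in> cls w)"
    using someI[of "\<lambda>v. v \<in> cls w"] unfolding cls_def by blast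
  from foldl_pres_eq[of w _ "\<Omega> ()" move, OF this move_\<Omega> move_rel start_\<Omega>]
  show ?thesis unfolding nf_def by simp
qed

lemma E_foldl:
  assumes "s \<in> \<Omega> ()" and "\<forall>l\<in>set w. hnn_letter A l"
  shows "E (foldl move s w) = E s \<otimes>\<^bsub>G\<^esub> cls w"
  using assms
proof (induction w arbitrary: s)
  case Nil
  then show ?case using E_closed by (simp flip: one_cls)
next
  case (Cons l w)
  have "E (move s l) = E s \<otimes>\<^bsub>G\<^esub> cls [l]"
    using Cons.prems E_act[of s "()"] E_T[of s] unfolding move_def hnn_letter_def by (auto split: sum.splits)
  moreover have "cls [l] \<otimes>\<^bsub>G\<^esub> cls w = cls (l # w)" using Cons.prems by (simp add: mult_cls)
  ultimately show ?case
    using Cons move_\<Omega> E_closed[of s] cls_carrier[of "[l]"] cls_carrier[of w] by (simp add: G.m_assoc)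
qed

fun word :: "('a \<times> bool) list \<Rightarrow> ('a + bool) list" where
  "word [] = []"
| "word ((r, e) # L) = word L @ [Inl r, Inr e]"

lemma word:
  assumes "valid () L"
  shows "(\<forall>l\<in>set (word L). hnn_letter A l) \<and> foldl move ([], \<one>) (word L) = (L, \<one>) \<and> ev L = cls (word L)"
  using assms
proof (induction L rule: word.induct)
  case 1
  then show ?case by (simp add: one_cls)
next
  case (2 r e L)
  then have r: "r \<in> carrier A" "valid () L" by auto
  have "foldl move ([], \<one>) (word ((r, e) # L)) = T e (L, r)" using 2 r by (simp add: act_def)
  then show ?case using 2 r T_extend[of "()" r e L] by (simp add: mult_cls letters)
qed

sublocale bass_serre_nf A "\<lambda>_. ()" "\<lambda>_. carrier A" "hnn_sub C \<phi>" "hnn_map C \<phi>" G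
  "\<lambda>_ a. cls [Inl a]" "\<lambda>e. cls [Inr e]" nf
proof (intro_locales, rule bass_serre_nf_axioms.intro)
  fix g assume "g \<in> carrier G"
  then obtain w where w: "\<forall>l\<in>set w. hnn_letter A l" "g = cls w" unfolding G_def carrier_pres by auto
  show "nf g \<in> \<Omega> ()" unfolding w(2) nf_cls[OF w(1)]
    by (rule foldl_closed[OF move_\<Omega> w(1) start_\<Omega>])
  have "E ([], \<one>) = \<one>\<^bsub>G\<^esub>" unfolding E_def using j_one by simp
  then show "E (nf g) = g"
    unfolding w(2) nf_cls[OF w(1)] using E_foldl[OF start_\<Omega> w(1)] cls_carrier[OF w(1)] by simp
next
  fix s assume "s \<in> \<Omega> ()"
  then obtain L m where s: "s = (L, m)" "valid () L" "m \<in> carrier A" unfolding \<Omega>_def by auto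
  note w = word[OF s(2)]
  have "E s = cls (word L @ [Inl m])" unfolding E_def s using w s(3) by (simp add: mult_cls letters)
  then show "nf (E s) = s" using nf_cls[of "word L @ [Inl m]"] w s by (simp add: letters act_def)
qed

text \<open>Left multiplication by an edge element puts \<open>(\<one>, e)\<close> in front of the
  word; only a first syllable \<open>(\<one>, \<not> e)\<close> could cancel with it.\<close>

lemma prepend_t:
  assumes g: "g \<in> carrier G" and "lab g \<noteq> Some (\<one>, \<not> e)"
  shows "lab (cls [Inr e] \<otimes>\<^bsub>G\<^esub> g) = Some (\<one>, e)"
proof -
  obtain L m where s: "g = E (L, m)" "valid () L" "m \<in> carrier A" "lab g = (if L = [] then None else Some (last L))"
    using state_of[OF g] by auto
  have "fst (last L) \<noteq> \<one>" if "L \<noteq> []" "snd (last L) = (\<not> e)"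
    using that s(4) assms(2) by (cases "last L") auto
  then have "(L @ [(\<one>, e)], m) \<in> \<Omega> ()"
    using s rep_of_K[OF K_one] unfolding \<Omega>_def by (simp add: valid_snoc)
  moreover have "E (L @ [(\<one>, e)], m) = cls [Inr e] \<otimes>\<^bsub>G\<^esub> g"
    using E_snoc[of L \<one> m e] s(1-3) ev_closed[OF s(2)] j_one j_closed \<tau>_closed unfolding E_def by simp
  ultimately show ?thesis using lab_E[of "L @ [(\<one>, e)]" m] by simp
qed

text \<open>The half space consists of the words starting with \<open>(\<one>, False)\<close>, that
  is, with \<open>t^-1\<close>. A nontrivial representative \<open>r\<close> moves it off itself.
  Left multiplication by \<open>t^-1\<close> sends into it every word that does not start with
  \<open>t\<close>, and a representative \<open>b\<close> first turns the other words into such;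
  hence the covering translates are by \<open>t\<close> and \<open>b^-1 t\<close>.\<close>

lemma hucha_HNN: "hucha G"
proof -
  obtain YA where YA: "fin_gen_set A YA" using fg unfolding finitely_generated_def by auto
  then have YAc: "YA \<subseteq> carrier A" "finite YA" "\<And>a. a \<in> YA \<Longrightarrow> inv a \<in> YA" unfolding fin_gen_set_def by auto
  let ?\<iota> = "\<lambda>a. cls [Inl a]" and ?t = "\<lambda>e. cls [Inr e]"
  define Y where "Y = ?\<iota> ` YA \<union> {?t True, ?t False}"
  have hom: "?\<iota> \<in> hom A G" by (rule homI) (use j_closed j_mult in auto)
  interpret \<iota>: group_hom A G ?\<iota>
    using hom A.is_group G.is_group by (simp add: group_hom_def group_hom_axioms_def)
  have t_inv': "inv\<^bsub>G\<^esub> (?t e) = ?t (\<not> e)" for e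
    using G.inv_equality[OF \<tau>_inv \<tau>_closed \<tau>_closed] .
  have Yc: "Y \<subseteq> carrier G" unfolding Y_def using YAc j_closed \<tau>_closed by auto
  have Y: "fin_gen_set G Y"
  proof (rule fin_gen_setI[folded G_def])
    show "group G" by (rule G.is_group)
    show "finite Y" unfolding Y_def using YAc by auto
    show "Y \<subseteq> carrier G" by (rule Yc)
    have "inv\<^bsub>G\<^esub> (?\<iota> a) \<in> Y" if "a \<in> YA" for a
    proof -
      have "inv\<^bsub>G\<^esub> (?\<iota> a) = ?\<iota> (inv a)" using that YAc by auto
      then show ?thesis unfolding Y_def using YAc(3)[OF that] by simp
    qed
    then show "inv\<^bsub>G\<^esub> y \<in> Y" if "y \<in> Y" for y
      using that t_inv'[of True] t_inv'[of False] unfolding Y_def by auto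
    show "cls [l] \<in> generate G Y" if l: "hnn_letter A l" for l
    proof (cases l)
      case (Inl a)
      have "?\<iota> ` YA \<subseteq> Y" unfolding Y_def by blast
      then show ?thesis
        using G.hom_image_in_generate[OF A.is_group hom YA, of a Y] l Inl by (simp add: letters)
    next
      case (Inr e)
      then show ?thesis unfolding Y_def by (cases e) (auto intro: generate.incl)
    qed
  qed
  have nfT: "nf (g \<otimes>\<^bsub>G\<^esub> ?t e) = T e (nf g)" if "g \<in> carrier G" for g e using nf_T that by simp
  have Y_cases: "(\<exists>a\<in>carrier A. y = ?\<iota> a) \<or> (\<exists>e. y = ?t e)" if "y \<in> Y" for y
    using that YAc unfolding Y_def by auto
  have \<phi>_prieto: "prieto_fin (A\<lparr>carrier := \<phi> ` C\<rparr>)"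
    using prieto_fin_image[OF C_group A.is_group \<phi> _ C_prieto] \<phi>_inj by simp
  \<comment> \<open>Both edge groups are Prieto and therefore proper, so each edge has a nontrivial
    coset representative.\<close>
  have proper: "\<exists>r\<in>carrier A. rep e r = r \<and> r \<noteq> \<one>" for e
  proof -
    have "hnn_sub C \<phi> e \<noteq> carrier A"
      unfolding hnn_sub_def using prieto_subgroup_proper C_prieto \<phi>_prieto by auto
    then obtain a where "a \<in> carrier A" "a \<notin> hnn_sub C \<phi> e" using K_carrier by blast
    then show ?thesis using rep_carrier rep_rep rep_eq_one by blast
  qed
  interpret tree_labelling G A ?\<iota> Y lab "\<lambda>(r, e). r <#\<^bsub>A\<^esub> hnn_sub C \<phi> e" "{C, \<phi> ` C}"
  proof (intro_locales, rule tree_labelling_axioms.intro)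
    show "group A" by (rule A.is_group)
    show "?\<iota> \<in> hom A G" by (rule hom)
    show "inj_on ?\<iota> (carrier A)" using inj_j .
    show "fin_gen_set G Y" by (rule Y)
    show "lab g = None \<longleftrightarrow> g \<in> ?\<iota> ` carrier A" if "g \<in> carrier G" for g using lab_None[OF that] .
    show "g \<in> ?\<iota> ` (case l of (r, e) \<Rightarrow> r <#\<^bsub>A\<^esub> hnn_sub C \<phi> e)"
      if g: "g \<in> carrier G" and y: "y \<in> Y" and None: "lab g = None" and Some: "lab (g \<otimes>\<^bsub>G\<^esub> y) = Some l" for g y l
    proof -
      obtain e where e: "y = ?t e" using Y_cases[OF y] lab_j[OF g] None Some by auto
      have n: "fst (nf g) = []" using None unfolding lab_def by (simp split: if_splits)
      then have "nf g = ([], snd (nf g))" by (metis prod.collapse)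
      then have "lab (g \<otimes>\<^bsub>G\<^esub> y) = Some (rep e (snd (nf g)), e)"
        unfolding lab_def e nfT[OF g] by (metis T_of_Nil fst_conv last.simps list.distinct(1))
      then have l: "l = (rep e (snd (nf g)), e)" using Some by simp
      have "snd (nf g) \<in> carrier A" using nf_\<Omega>[OF g] unfolding \<Omega>_def by auto
      then have "rep e (snd (nf g)) \<otimes> rem e (snd (nf g)) \<in> rep e (snd (nf g)) <#\<^bsub>A\<^esub> hnn_sub C \<phi> e"
        using rem_K unfolding l_coset_def by blast
      then show ?thesis unfolding l prod.case using exit_mem[OF g n, of e] by (rule rev_image_eqI)
    qed
    show "l' = l" if g: "g \<in> carrier G" and y: "y \<in> Y" and "lab g = Some l" "lab (g \<otimes>\<^bsub>G\<^esub> y) = Some l'" for g y l l'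
    proof -
      consider a where "a \<in> carrier A" "y = ?\<iota> a" | e where "y = ?t e" using Y_cases[OF y] by auto
      then show ?thesis
      proof cases
        case 1
        then show ?thesis using lab_j[OF g] that by simp
      next
        case (2 e)
        then show ?thesis using that(3,4) T_last[of "nf g" e] unfolding lab_def 2 nfT[OF g] by (auto split: if_splits)
      qed
    qed
    show "\<exists>a\<in>carrier A. \<exists>K\<in>{C, \<phi> ` C}. (case l of (r, e) \<Rightarrow> r <#\<^bsub>A\<^esub> hnn_sub C \<phi> e) = a <#\<^bsub>A\<^esub> K"
      if g: "g \<in> carrier G" and l: "lab g = Some l" for g l
    proof -
      obtain L m where "(L @ [l], m) \<in> \<Omega> ()" using lab_SomeD[OF g l] by blast
      then have "fst l \<in> carrier A" unfolding \<Omega>_def by (cases l) (auto simp: valid_snoc)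
      then show ?thesis by (cases l) (auto simp: hnn_sub_def)
    qed
    show "finite {C, \<phi> ` C}" by simp
    show "subgroup K A \<and> prieto_fin (A\<lparr>carrier := K\<rparr>)" if "K \<in> {C, \<phi> ` C}" for K
      using that C C_prieto \<phi>_image \<phi>_prieto by auto
    show "\<exists>u\<in>P. \<exists>v\<in>P. (u, v) \<notin> (fstep A F (nneg A P))\<^sup>*"
      if "pos_cone A P" "finite F" "F \<subseteq> carrier A" for P F using A_steps[OF that] .
    obtain r where r: "r \<in> carrier A" "rep False r = r" "r \<noteq> \<one>" using proper by blast
    obtain b where b: "b \<in> carrier A" "rep True b = b" "b \<noteq> \<one>" using proper by blast
    note c = \<iota>.hom_closed[OF r(1)] \<iota>.hom_closed[OF b(1)] \<tau>_closed[of True] \<tau>_closed[of False]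
    have disj: "lab (?\<iota> r \<otimes>\<^bsub>G\<^esub> h) \<noteq> Some (\<one>, False)" if "h \<in> carrier G" "lab h = Some (\<one>, False)" for h
      using lab_translate[OF that r(1,2)] r(3) by simp
    have cover: "\<exists>h\<in>carrier G. lab h = Some (\<one>, False) \<and>
        (g = ?t True \<otimes>\<^bsub>G\<^esub> h \<or> g = inv\<^bsub>G\<^esub> (?\<iota> b) \<otimes>\<^bsub>G\<^esub> ?t True \<otimes>\<^bsub>G\<^esub> h)" if g: "g \<in> carrier G" for g
    proof (cases "lab g = Some (\<one>, True)")
      case False
      have "g = ?t True \<otimes>\<^bsub>G\<^esub> (?t False \<otimes>\<^bsub>G\<^esub> g)"
        using g c \<tau>_inv[of False] by (simp add: G.m_assoc[symmetric])
      then show ?thesis using prepend_t[OF g, of False] False g c by (intro bexI[of _ "?t False \<otimes>\<^bsub>G\<^esub> g"]) auto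
    next
      case True
      let ?h = "?t False \<otimes>\<^bsub>G\<^esub> (?\<iota> b \<otimes>\<^bsub>G\<^esub> g)"
      have "lab (?\<iota> b \<otimes>\<^bsub>G\<^esub> g) \<noteq> Some (\<one>, True)" using lab_translate[OF g True b(1,2)] b(3) by simp
      then have "lab ?h = Some (\<one>, False)" using prepend_t[of "?\<iota> b \<otimes>\<^bsub>G\<^esub> g" False] g c by simp
      moreover have "g = inv\<^bsub>G\<^esub> (?\<iota> b) \<otimes>\<^bsub>G\<^esub> ?t True \<otimes>\<^bsub>G\<^esub> ?h"
      proof -
        have "inv\<^bsub>G\<^esub> (?\<iota> b) \<otimes>\<^bsub>G\<^esub> ?t True \<otimes>\<^bsub>G\<^esub> ?h
            = inv\<^bsub>G\<^esub> (?\<iota> b) \<otimes>\<^bsub>G\<^esub> ((?t True \<otimes>\<^bsub>G\<^esub> ?t False) \<otimes>\<^bsub>G\<^esub> (?\<iota> b \<otimes>\<^bsub>G\<^esub> g))"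
          using g c by (simp add: G.m_assoc del: \<iota>.hom_inv)
        then show ?thesis using g c \<tau>_inv[of False] by (simp add: G.inv_mult_cancel del: \<iota>.hom_inv)
      qed
      ultimately show ?thesis using g c by (intro bexI[of _ ?h]) auto
    qed
    have f2: "inv\<^bsub>G\<^esub> (?\<iota> b) \<otimes>\<^bsub>G\<^esub> ?t True \<in> carrier G" using c by (simp del: \<iota>.hom_inv)
    show "\<exists>l0. \<exists>f\<in>carrier G. \<exists>f1\<in>carrier G. \<exists>f2\<in>carrier G.
      (\<forall>h\<in>carrier G. lab h = Some l0 \<longrightarrow> lab (f \<otimes>\<^bsub>G\<^esub> h) \<noteq> Some l0) \<and>
      (\<forall>g\<in>carrier G. \<exists>h\<in>carrier G. lab h = Some l0 \<and> (g = f1 \<otimes>\<^bsub>G\<^esub> h \<or> g = f2 \<otimes>\<^bsub>G\<^esub> h))"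
      by (rule exI[of _ "(\<one>, False)"], rule bexI[OF _ c(1)], rule bexI[OF _ c(3)], rule bexI[OF _ f2])
        (intro conjI ballI impI; rule disj cover; assumption)
  qed
  show ?thesis using hucha[OF G_lo] .
qed

end


section \<open>Amalgamated products\<close>

text \<open>All vertex groups of \<open>bass_serre\<close> lie in one ambient group, so
  \<open>A\<close> and \<open>B\<close> are placed in their direct product as the two
  factors.\<close>

definition amalg_vertex ::
  "('a, 'b) monoid_scheme \<Rightarrow> ('c, 'd) monoid_scheme \<Rightarrow> bool \<Rightarrow> ('a \<times> 'c) set" where
  "amalg_vertex A B v = (if v then carrier A \<times> {\<one>\<^bsub>B\<^esub>} else {\<one>\<^bsub>A\<^esub>} \<times> carrier B)"

definition amalg_edge ::
  "('a, 'b) monoid_scheme \<Rightarrow> 'a set \<Rightarrow> ('c, 'd) monoid_scheme \<Rightarrow> ('a \<Rightarrow> 'c) \<Rightarrow> bool \<Rightarrow> ('a \<times> 'c) set" where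
  "amalg_edge A C B \<psi> e = (if e then C \<times> {\<one>\<^bsub>B\<^esub>} else {\<one>\<^bsub>A\<^esub>} \<times> \<psi> ` C)"

definition amalg_map ::
  "('a, 'b) monoid_scheme \<Rightarrow> 'a set \<Rightarrow> ('c, 'd) monoid_scheme \<Rightarrow> ('a \<Rightarrow> 'c) \<Rightarrow> bool \<Rightarrow> 'a \<times> 'c \<Rightarrow> 'a \<times> 'c" where
  "amalg_map A C B \<psi> e x = (if e then (\<one>\<^bsub>A\<^esub>, \<psi> (fst x)) else (inv_into C \<psi> (snd x), \<one>\<^bsub>B\<^esub>))"

lemma subgroup_Times:
  assumes "group A" and "group B" and "subgroup H A" and "subgroup K B"
  shows "subgroup (H \<times> K) (A \<times>\<times> B)"
proof (rule group.subgroupI[OF DirProd_group[OF assms(1,2)]])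
  show "H \<times> K \<subseteq> carrier (A \<times>\<times> B)"
    using subgroup.subset[OF assms(3)] subgroup.subset[OF assms(4)] by auto
  show "H \<times> K \<noteq> {}" using subgroup.one_closed[OF assms(3)] subgroup.one_closed[OF assms(4)] by blast
next
  fix x assume "x \<in> H \<times> K"
  then obtain h k where x: "x = (h, k)" "h \<in> H" "k \<in> K" by auto
  have "h \<in> carrier A" "k \<in> carrier B"
    using x subgroup.subset[OF assms(3)] subgroup.subset[OF assms(4)] by blast+
  then show "inv\<^bsub>A \<times>\<times> B\<^esub> x \<in> H \<times> K"
    unfolding x(1) using inv_DirProd[OF assms(1,2)] x assms(3,4) by (simp add: subgroup.m_inv_closed)
next
  fix x y assume "x \<in> H \<times> K" "y \<in> H \<times> K"
  then obtain h k h' k' where "x = (h, k)" "y = (h', k')" "h \<in> H" "k \<in> K" "h' \<in> H" "k' \<in> K" by auto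
  then show "x \<otimes>\<^bsub>A \<times>\<times> B\<^esub> y \<in> H \<times> K" using assms(3,4) by (simp add: subgroup.m_closed)
qed

locale amalgam = hucha_prieto A C + B: group B
  for A :: "('a, 'b) monoid_scheme" (structure) and C and B :: "('c, 'd) monoid_scheme" (structure) +
  fixes \<psi> :: "'a \<Rightarrow> 'c"
  assumes B_fg: "finitely_generated B"
    and \<psi>: "\<psi> \<in> hom (A\<lparr>carrier := C\<rparr>) B" and \<psi>_inj: "inj_on \<psi> C"
    and G_lo: "left_orderable (AMALG A C B \<psi>)"
begin

lemma C_carrier: "c \<in> C \<Longrightarrow> c \<in> carrier A"
  using C subgroup.subset by blast

lemma C_group: "group (A\<lparr>carrier := C\<rparr>)"
  using A.subgroup_imp_group[OF C] .

sublocale \<psi>: group_hom "A\<lparr>carrier := C\<rparr>" B \<psi>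
  using C_group \<psi> B.is_group by (simp add: group_hom_def group_hom_axioms_def)

lemma \<psi>_closed: "c \<in> C \<Longrightarrow> \<psi> c \<in> carrier B"
  using \<psi>.hom_closed by simp

lemma \<psi>_mult: "c \<in> C \<Longrightarrow> d \<in> C \<Longrightarrow> \<psi> (c \<otimes>\<^bsub>A\<^esub> d) = \<psi> c \<otimes>\<^bsub>B\<^esub> \<psi> d"
  using \<psi>.hom_mult by simp

lemma \<psi>_image: "subgroup (\<psi> ` C) B"
  using \<psi>.img_is_subgroup by simp

abbreviation "U' \<equiv> amalg_vertex A B"
abbreviation "K' \<equiv> amalg_edge A C B \<psi>"
abbreviation "\<theta>' \<equiv> amalg_map A C B \<psi>"

sublocale D: group "A \<times>\<times> B"
  by (rule DirProd_group[OF A.is_group B.is_group])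

sublocale bass_serre "A \<times>\<times> B" "\<lambda>e. e" U' K' \<theta>'
proof (intro_locales, rule bass_serre_axioms.intro)
  fix e v :: bool and c d :: "'a \<times> 'c"
  show "subgroup (U' v) (A \<times>\<times> B)" unfolding amalg_vertex_def
    using subgroup_Times[OF A.is_group B.is_group] A.subgroup_self B.subgroup_self A.triv_subgroup B.triv_subgroup
    by simp
  show "subgroup (K' e) (A \<times>\<times> B)" unfolding amalg_edge_def
    using subgroup_Times[OF A.is_group B.is_group] C \<psi>_image A.triv_subgroup B.triv_subgroup by simp
  show "K' e \<subseteq> U' e" unfolding amalg_vertex_def amalg_edge_def using C_carrier \<psi>_closed by auto
  assume c: "c \<in> K' e"
  show "\<theta>' e c \<in> K' (\<not> e)"
    using c inv_into_into[of _ \<psi> C] unfolding amalg_edge_def amalg_map_def by (auto split: if_splits)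
  show "\<theta>' (\<not> e) (\<theta>' e c) = c"
    using c \<psi>_inj unfolding amalg_edge_def amalg_map_def by (auto split: if_splits simp: f_inv_into_f)
  assume d: "d \<in> K' e"
  show "\<theta>' e (c \<otimes>\<^bsub>A \<times>\<times> B\<^esub> d) = \<theta>' e c \<otimes>\<^bsub>A \<times>\<times> B\<^esub> \<theta>' e d"
  proof (cases e)
    case True
    then show ?thesis using c d \<psi>_mult unfolding amalg_edge_def amalg_map_def by auto
  next
    case False
    then obtain c' d' where c': "c = (\<one>\<^bsub>A\<^esub>, \<psi> c')" "c' \<in> C" "d = (\<one>\<^bsub>A\<^esub>, \<psi> d')" "d' \<in> C"
      using c d unfolding amalg_edge_def by auto
    then have "\<psi> c' \<otimes>\<^bsub>B\<^esub> \<psi> d' = \<psi> (c' \<otimes>\<^bsub>A\<^esub> d')" using \<psi>_mult by simp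
    moreover have "c' \<otimes>\<^bsub>A\<^esub> d' \<in> C" using c' C by (simp add: subgroup.m_closed)
    ultimately show ?thesis using c' False \<psi>_inj unfolding amalg_map_def by simp
  qed
qed

sublocale presentation "amalg_letter A B" "amalg_rel A C B \<psi>"
  by standard (erule amalg_rel.cases; auto simp: amalg_letter_def \<psi>_closed C_carrier)

abbreviation "G \<equiv> AMALG A C B \<psi>"

lemma G_def: "G = pres_monoid (amalg_letter A B) (amalg_rel A C B \<psi>)"
  by (simp add: AMALG_def)

sublocale G: group G
  using G_lo unfolding left_orderable_def by simp

lemma letters: "amalg_letter A B (Inl a) \<longleftrightarrow> a \<in> carrier A" "amalg_letter A B (Inr b) \<longleftrightarrow> b \<in> carrier B"
  by (simp_all add: amalg_letter_def)

lemma mult_cls: "\<forall>l\<in>set u. amalg_letter A B l \<Longrightarrow> \<forall>l\<in>set v. amalg_letter A B l \<Longrightarrow>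
    cls u \<otimes>\<^bsub>G\<^esub> cls v = cls (u @ v)"
  unfolding G_def by (rule mult_pres)

lemma one_cls: "\<one>\<^bsub>G\<^esub> = cls []"
  unfolding G_def by (rule one_pres)

lemma cls_carrier: "\<forall>l\<in>set w. amalg_letter A B l \<Longrightarrow> cls w \<in> carrier G"
  unfolding G_def by (rule cls_closed)

definition letter :: "bool \<Rightarrow> 'a \<times> 'c \<Rightarrow> 'a + 'c" where
  "letter v x = (if v then Inl (fst x) else Inr (snd x))"

lemma letter: "x \<in> U' v \<Longrightarrow> amalg_letter A B (letter v x)"
  unfolding letter_def amalg_vertex_def by (auto simp: letters)

lemma base_letter: "a \<in> carrier A \<Longrightarrow> (a, \<one>\<^bsub>B\<^esub>) \<in> U' True" "b \<in> carrier B \<Longrightarrow> (\<one>\<^bsub>A\<^esub>, b) \<in> U' False"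
  unfolding amalg_vertex_def by simp_all

sublocale bass_serre_eval "A \<times>\<times> B" "\<lambda>e. e" U' K' \<theta>' G "\<lambda>v x. cls [letter v x]" "\<lambda>_. \<one>\<^bsub>G\<^esub>"
proof (intro_locales, rule bass_serre_eval_axioms.intro)
  fix x y :: "'a \<times> 'c" and v e :: bool
  show "\<one>\<^bsub>G\<^esub> \<in> carrier G" by simp
  show "\<one>\<^bsub>G\<^esub> \<otimes>\<^bsub>G\<^esub> \<one>\<^bsub>G\<^esub> = \<one>\<^bsub>G\<^esub>" by simp
  show "cls [letter e x] \<otimes>\<^bsub>G\<^esub> \<one>\<^bsub>G\<^esub> = \<one>\<^bsub>G\<^esub> \<otimes>\<^bsub>G\<^esub> cls [letter (\<not> e) (\<theta>' e x)]" if x: "x \<in> K' e"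
  proof -
    have c: "cls [letter e x] \<in> carrier G" "cls [letter (\<not> e) (\<theta>' e x)] \<in> carrier G"
      using letter[OF K_in_U[OF x]] letter[OF \<theta>_in_U[OF x]] by (simp_all add: cls_carrier)
    have "cls [letter e x] = cls [letter (\<not> e) (\<theta>' e x)]"
    proof (cases e)
      case True
      then show ?thesis using x cls_R[OF amalg_rel.ident, of "fst x"]
        unfolding letter_def amalg_edge_def amalg_map_def by auto
    next
      case False
      then obtain c where "c \<in> C" "x = (\<one>\<^bsub>A\<^esub>, \<psi> c)" using x unfolding amalg_edge_def by auto
      then show ?thesis using False \<psi>_inj cls_R[OF amalg_rel.ident, of c]
        unfolding letter_def amalg_map_def by simp
    qed
    then show ?thesis using c by simp
  qed
  assume x: "x \<in> U' v"
  show "cls [letter v x] \<in> carrier G" using letter[OF x] by (simp add: cls_carrier)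
  assume y: "y \<in> U' v"
  show "cls [letter v (x \<otimes>\<^bsub>A \<times>\<times> B\<^esub> y)] = cls [letter v x] \<otimes>\<^bsub>G\<^esub> cls [letter v y]"
  proof (cases v)
    case True
    then show ?thesis using x y cls_R[OF amalg_rel.mulA, of "fst x" "fst y"]
      unfolding letter_def amalg_vertex_def by (auto simp: mult_cls letters)
  next
    case False
    then show ?thesis using x y cls_R[OF amalg_rel.mulB, of "snd x" "snd y"]
      unfolding letter_def amalg_vertex_def by (auto simp: mult_cls letters)
  qed
qed

section \<open>Van der Waerden's action for amalgamated products\<close>

definition move :: "(('a \<times> 'c) \<times> bool) list \<times> ('a \<times> 'c) \<Rightarrow> 'a + 'c \<Rightarrow>
    (('a \<times> 'c) \<times> bool) list \<times> ('a \<times> 'c)" where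
  "move s l = (case l of Inl a \<Rightarrow> act (a, \<one>\<^bsub>B\<^esub>) s | Inr b \<Rightarrow> T False (act (\<one>\<^bsub>A\<^esub>, b) (T True s)))"

definition start :: "(('a \<times> 'c) \<times> bool) list \<times> ('a \<times> 'c)" where
  "start = ([], (\<one>\<^bsub>A\<^esub>, \<one>\<^bsub>B\<^esub>))"

definition nf :: "('a + 'c) list set \<Rightarrow> (('a \<times> 'c) \<times> bool) list \<times> ('a \<times> 'c)" where
  "nf g = foldl move start (SOME w. w \<in> g)"

lemma move_simps [simp]:
  "move s (Inl a) = act (a, \<one>\<^bsub>B\<^esub>) s"
  "move s (Inr b) = T False (act (\<one>\<^bsub>A\<^esub>, b) (T True s))"
  by (simp_all add: move_def)

lemma T_True: "s \<in> \<Omega> True \<Longrightarrow> T True s \<in> \<Omega> False"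
  and T_False: "s \<in> \<Omega> False \<Longrightarrow> T False s \<in> \<Omega> True"
  using T_\<Omega>[of s True] T_\<Omega>[of s False] by simp_all

lemma T_True_False: "s \<in> \<Omega> False \<Longrightarrow> T True (T False s) = s"
  and T_False_True: "s \<in> \<Omega> True \<Longrightarrow> T False (T True s) = s"
  using T_T[of s True] T_T[of s False] by simp_all

text \<open>A letter of \<open>B\<close> crosses to the other vertex, acts there and crosses back,
  so every letter returns to the vertex of \<open>A\<close>.\<close>

lemma move_\<Omega>: "s \<in> \<Omega> True \<Longrightarrow> amalg_letter A B l \<Longrightarrow> move s l \<in> \<Omega> True"
  using act_\<Omega>[of s True] act_\<Omega>[of "T True s" False] T_True[of s] T_False base_letter
  by (cases l) (auto simp: letters)

lemma move_rel: "s \<in> \<Omega> True \<Longrightarrow> amalg_rel A C B \<psi> u v \<Longrightarrow> foldl move s u = foldl move s v"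
proof (erule amalg_rel.cases)
  fix a a' assume s: "s \<in> \<Omega> True" and "u = [Inl a, Inl a']" "v = [Inl (a \<otimes>\<^bsub>A\<^esub> a')]"
    "a \<in> carrier A" "a' \<in> carrier A"
  then show ?thesis using act_act[OF s, of "(a, \<one>\<^bsub>B\<^esub>)" "(a', \<one>\<^bsub>B\<^esub>)"] base_letter by simp
next
  fix b b' assume s: "s \<in> \<Omega> True" and "u = [Inr b, Inr b']" "v = [Inr (b \<otimes>\<^bsub>B\<^esub> b')]"
    "b \<in> carrier B" "b' \<in> carrier B"
  then show ?thesis
    using act_act[OF T_True[OF s], of "(\<one>\<^bsub>A\<^esub>, b)" "(\<one>\<^bsub>A\<^esub>, b')"] base_letter
      T_True_False[of "act (\<one>\<^bsub>A\<^esub>, b) (T True s)"] act_\<Omega>[OF T_True[OF s], of "(\<one>\<^bsub>A\<^esub>, b)"] by simp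
next
  assume s: "s \<in> \<Omega> True" and "u = [Inl \<one>\<^bsub>A\<^esub>]" "v = []"
  then show ?thesis using act_one[OF s] by simp
next
  assume s: "s \<in> \<Omega> True" and "u = [Inr \<one>\<^bsub>B\<^esub>]" "v = []"
  then show ?thesis using act_one[OF T_True[OF s]] T_False_True[OF s] by simp
next
  fix c assume s: "s \<in> \<Omega> True" and c: "u = [Inl c]" "v = [Inr (\<psi> c)]" "c \<in> C"
  have cK: "(c, \<one>\<^bsub>B\<^esub>) \<in> K' True" using c unfolding amalg_edge_def by simp
  \<comment> \<open>By the edge relation, acting with \<open>c\<close> before the crossing equals
    acting with \<open>\<psi> c\<close> after it.\<close>
  have "T True (act (c, \<one>\<^bsub>B\<^esub>) s) = act (\<one>\<^bsub>A\<^esub>, \<psi> c) (T True s)"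
    using T_act[OF _ cK, of s] s unfolding amalg_map_def by simp
  moreover have "act (c, \<one>\<^bsub>B\<^esub>) s \<in> \<Omega> True" using act_\<Omega>[OF s] K_in_U[OF cK] by simp
  ultimately show ?thesis using T_False_True[of "act (c, \<one>\<^bsub>B\<^esub>) s"] c by simp
qed

lemma start_\<Omega>: "start \<in> \<Omega> True"
  unfolding \<Omega>_def start_def using base_letter by simp

lemma nf_cls:
  assumes "\<forall>l\<in>set w. amalg_letter A B l"
  shows "nf (cls w) = foldl move start w"
proof -
  have "w \<in> cls w" unfolding cls_def using pres_eq.refl[OF assms] by simp
  then have "pres_eq (amalg_letter A B) (amalg_rel A C B \<psi>) w (SOME v. v \<in> cls w)"
    using someI[of "\<lambda>v. v \<in> cls w"] unfolding cls_def by blast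
  from foldl_pres_eq[of w _ "\<Omega> True" move, OF this move_\<Omega> move_rel start_\<Omega>]
  show ?thesis unfolding nf_def by simp
qed

lemma E_move:
  assumes s: "s \<in> \<Omega> True" and l: "amalg_letter A B l"
  shows "E (move s l) = E s \<otimes>\<^bsub>G\<^esub> cls [l]"
proof (cases l)
  case (Inl a)
  then show ?thesis using E_act[OF s base_letter(1)] l unfolding letter_def by (simp add: letters)
next
  case (Inr b)
  then have b: "(\<one>\<^bsub>A\<^esub>, b) \<in> U' False" using l base_letter by (simp add: letters)
  note s' = act_\<Omega>[OF T_True[OF s] b]
  have "E (move s l) = E (T True s) \<otimes>\<^bsub>G\<^esub> cls [letter False (\<one>\<^bsub>A\<^esub>, b)]"
    using E_T[of "act (\<one>\<^bsub>A\<^esub>, b) (T True s)" False] E_act[OF T_True[OF s] b] s' Inr E_closed[OF s'] by simp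
  then show ?thesis using E_T[of s True] s E_closed[OF s] Inr unfolding letter_def by simp
qed

lemma E_foldl:
  assumes "s \<in> \<Omega> True" and "\<forall>l\<in>set w. amalg_letter A B l"
  shows "E (foldl move s w) = E s \<otimes>\<^bsub>G\<^esub> cls w"
  using assms
proof (induction w arbitrary: s)
  case Nil
  then show ?case using E_closed by (simp flip: one_cls)
next
  case (Cons l w)
  have "cls [l] \<otimes>\<^bsub>G\<^esub> cls w = cls (l # w)" using Cons.prems by (simp add: mult_cls)
  then show ?case
    using Cons E_move move_\<Omega> E_closed[of s] cls_carrier[of "[l]"] cls_carrier[of w] by (simp add: G.m_assoc)
qed

fun word :: "(('a \<times> 'c) \<times> bool) list \<Rightarrow> ('a + 'c) list" where
  "word [] = []"
| "word ((r, e) # L) = word L @ [letter e r]"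

text \<open>Folding always stops at the vertex of \<open>A\<close>, so a reduced word that ends at
  the vertex of \<open>B\<close> is compared after one more crossing. Edges contribute no
  letters.\<close>

lemma word:
  assumes "valid True L"
  shows "(\<forall>l\<in>set (word L). amalg_letter A B l) \<and> ev L = cls (word L) \<and>
    (if endv True L then foldl move start (word L) else T True (foldl move start (word L)))
      = (L, (\<one>\<^bsub>A\<^esub>, \<one>\<^bsub>B\<^esub>))"
  using assms
proof (induction L rule: word.induct)
  case 1
  then show ?case by (simp add: start_def flip: one_cls)
next
  case (2 r e L)
  let ?s = "foldl move start (word L)"
  have r: "r \<in> U' e" "valid True L" "endv True L = e" using 2 by auto
  note IH = "2.IH"[OF r(2)]
  have 1: "\<forall>l\<in>set (word ((r, e) # L)). amalg_letter A B l" using IH letter[OF r(1)] by auto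
  have 3: "ev ((r, e) # L) = cls (word ((r, e) # L))"
    using IH letter[OF r(1)] cls_carrier[of "[letter e r]"] by (simp add: mult_cls)
  have T: "T e (L, r) = ((r, e) # L, (\<one>\<^bsub>A\<^esub>, \<one>\<^bsub>B\<^esub>))" using T_extend[OF "2.prems"] by simp
  show ?case
  proof (cases e)
    case True
    then obtain a where a: "r = (a, \<one>\<^bsub>B\<^esub>)" "a \<in> carrier A" using r unfolding amalg_vertex_def by auto
    have "?s = (L, (\<one>\<^bsub>A\<^esub>, \<one>\<^bsub>B\<^esub>))" using IH r True by simp
    then have "foldl move start (word ((r, e) # L)) = (L, r)"
      using a True by (simp add: letter_def act_def)
    then show ?thesis using 1 3 T True by simp
  next
    case False
    then obtain b where b: "r = (\<one>\<^bsub>A\<^esub>, b)" "b \<in> carrier B" using r unfolding amalg_vertex_def by auto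
    have "T True ?s = (L, (\<one>\<^bsub>A\<^esub>, \<one>\<^bsub>B\<^esub>))" using IH r False by simp
    then have "foldl move start (word ((r, e) # L)) = T False (L, r)"
      using b False by (simp add: letter_def act_def)
    then show ?thesis using 1 3 T False by simp
  qed
qed

sublocale bass_serre_nf "A \<times>\<times> B" "\<lambda>e. e" U' K' \<theta>' G "\<lambda>v x. cls [letter v x]" "\<lambda>_. \<one>\<^bsub>G\<^esub>" nf
proof (intro_locales, rule bass_serre_nf_axioms.intro)
  fix g assume "g \<in> carrier G"
  then obtain w where w: "\<forall>l\<in>set w. amalg_letter A B l" "g = cls w" unfolding G_def carrier_pres by auto
  show "nf g \<in> \<Omega> True" unfolding w(2) nf_cls[OF w(1)]
    by (rule foldl_closed[OF move_\<Omega> w(1) start_\<Omega>])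
  have "E start = \<one>\<^bsub>G\<^esub>" unfolding E_def start_def using j_one by simp
  then show "E (nf g) = g"
    unfolding w(2) nf_cls[OF w(1)] using E_foldl[OF start_\<Omega> w(1)] cls_carrier[OF w(1)] by simp
next
  fix s assume "s \<in> \<Omega> True"
  then obtain L m where s: "s = (L, m)" "valid True L" "m \<in> U' True" "endv True L" unfolding \<Omega>_def by auto
  note w = word[OF s(2)]
  obtain a where a: "m = (a, \<one>\<^bsub>B\<^esub>)" "a \<in> carrier A" using s unfolding amalg_vertex_def by auto
  have "E s = cls (word L @ [letter True m])"
    unfolding E_def s using w s letter[OF s(3)] by (simp add: mult_cls)
  then show "nf (E s) = s"
    using nf_cls[of "word L @ [letter True m]"] w s letter[OF s(3)] a by (simp add: letter_def act_def)
qed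

text \<open>From the base vertex, \<open>b\<close> is written as a trivial representative, a
  crossing, \<open>b\<close> itself and a crossing back. Only a trivial first representative of
  \<open>g\<close> would cancel against the crossing back.\<close>

lemma prepend_B:
  assumes g: "g \<in> carrier G" and "lab g \<noteq> Some ((\<one>\<^bsub>A\<^esub>, \<one>\<^bsub>B\<^esub>), True)"
    and b: "b \<in> U' False" "rep False b = b" "b \<noteq> (\<one>\<^bsub>A\<^esub>, \<one>\<^bsub>B\<^esub>)"
  shows "lab (cls [letter False b] \<otimes>\<^bsub>G\<^esub> g) = Some ((\<one>\<^bsub>A\<^esub>, \<one>\<^bsub>B\<^esub>), True)"
proof -
  let ?o = "(\<one>\<^bsub>A\<^esub>, \<one>\<^bsub>B\<^esub>)"
  obtain L m where s: "g = E (L, m)" "valid True L" "endv True L = True" "m \<in> U' True"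
    "lab g = (if L = [] then None else Some (last L))"
    using state_of[OF g] by auto
  have "fst (last L) \<noteq> ?o" if "L \<noteq> []" "snd (last L)"
    using that s(5) assms(2) by (cases "last L") auto
  then have L1: "valid False (L @ [(b, False)])" "endv False (L @ [(b, False)]) = True"
    using s b by (auto simp: valid_snoc endv_snoc)
  have o: "?o \<in> U' True" "rep True ?o = ?o"
    using U_one[of True] rep_of_K[OF K_one, of True] by simp_all
  have *: "((L @ [(b, False)]) @ [(?o, True)], m) \<in> \<Omega> True"
    unfolding \<Omega>_def using L1 o s(4) b(3) by (simp add: valid_snoc endv_snoc del: append_assoc)
  have c: "ev L \<in> carrier G" "cls [letter True m] \<in> carrier G" "cls [letter False b] \<in> carrier G"
    using ev_closed[OF s(2)] j_closed s(4) b(1) by auto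
  have "E ((L @ [(b, False)]) @ [(?o, True)], m) = ev (L @ [(b, False)]) \<otimes>\<^bsub>G\<^esub> cls [letter True m]"
    using E_snoc[of True "L @ [(b, False)]" ?o m] L1 o s(4) j_one[of True] c ev_closed[OF L1(1)]
    by (simp del: append_assoc)
  also have "\<dots> = cls [letter False b] \<otimes>\<^bsub>G\<^esub> g"
    using ev_snoc[of False L b] s(1-4) b(1) c unfolding E_def by (simp add: G.m_assoc)
  finally show ?thesis using lab_E[OF *] by simp
qed

text \<open>Every nonempty normal form starts with the edge \<open>True\<close>, so branches at
  \<open>A\<close> correspond to cosets of \<open>C\<close>. The half space is the branch at
  \<open>C\<close> itself: \<open>r\<close> in \<open>A\<close> outside \<open>C\<close> moves it
  off itself, and \<open>b\<close> in \<open>B\<close> outside the image of \<open>C\<close> moves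
  its complement into it.\<close>

lemma hucha_AMALG: "hucha G"
proof -
  obtain YA where YA: "fin_gen_set A YA" using fg unfolding finitely_generated_def by auto
  then have YAc: "YA \<subseteq> carrier A" "finite YA" "\<And>a. a \<in> YA \<Longrightarrow> inv\<^bsub>A\<^esub> a \<in> YA" unfolding fin_gen_set_def by auto
  obtain YB where YB: "fin_gen_set B YB" using B_fg unfolding finitely_generated_def by auto
  then have YBc: "YB \<subseteq> carrier B" "finite YB" "\<And>b. b \<in> YB \<Longrightarrow> inv\<^bsub>B\<^esub> b \<in> YB" unfolding fin_gen_set_def by auto
  let ?\<iota> = "\<lambda>a. cls [Inl a]" and ?\<kappa> = "\<lambda>b. cls [Inr b]"
  have \<iota>_j: "?\<iota> a = cls [letter True (a, \<one>\<^bsub>B\<^esub>)]" for a by (simp add: letter_def)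
  have \<kappa>_j: "?\<kappa> b = cls [letter False (\<one>\<^bsub>A\<^esub>, b)]" for b by (simp add: letter_def)
  define Y where "Y = ?\<iota> ` YA \<union> ?\<kappa> ` YB"
  have hom: "?\<iota> \<in> hom A G"
    by (rule homI) (use cls_R[OF amalg_rel.mulA] in \<open>auto simp: cls_carrier letters mult_cls\<close>)
  have hom': "?\<kappa> \<in> hom B G"
    by (rule homI) (use cls_R[OF amalg_rel.mulB] in \<open>auto simp: cls_carrier letters mult_cls\<close>)
  interpret \<iota>: group_hom A G ?\<iota>
    using hom A.is_group G.is_group by (simp add: group_hom_def group_hom_axioms_def)
  interpret \<kappa>: group_hom B G ?\<kappa>
    using hom' B.is_group G.is_group by (simp add: group_hom_def group_hom_axioms_def)
  have Y: "fin_gen_set G Y"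
  proof (rule fin_gen_setI[folded G_def])
    show "group G" by (rule G.is_group)
    show "finite Y" unfolding Y_def using YAc YBc by auto
    show "Y \<subseteq> carrier G" unfolding Y_def using YAc YBc by auto
    have 1: "inv\<^bsub>G\<^esub> (?\<iota> a) \<in> Y" if "a \<in> YA" for a
    proof -
      have "inv\<^bsub>G\<^esub> (?\<iota> a) = ?\<iota> (inv\<^bsub>A\<^esub> a)" using that YAc by auto
      then show ?thesis unfolding Y_def using YAc(3)[OF that] by simp
    qed
    have 2: "inv\<^bsub>G\<^esub> (?\<kappa> b) \<in> Y" if "b \<in> YB" for b
    proof -
      have "inv\<^bsub>G\<^esub> (?\<kappa> b) = ?\<kappa> (inv\<^bsub>B\<^esub> b)" using that YBc by auto
      then show ?thesis unfolding Y_def using YBc(3)[OF that] by simp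
    qed
    show "inv\<^bsub>G\<^esub> y \<in> Y" if "y \<in> Y" for y
      using that 1 2 unfolding Y_def by blast
    have sub: "?\<iota> ` YA \<subseteq> Y" "?\<kappa> ` YB \<subseteq> Y" unfolding Y_def by blast+
    show "cls [l] \<in> generate G Y" if l: "amalg_letter A B l" for l
    proof (cases l)
      case (Inl a)
      then show ?thesis
        using G.hom_image_in_generate[OF A.is_group hom YA, of a Y] l sub by (simp add: letters)
    next
      case (Inr b)
      then show ?thesis
        using G.hom_image_in_generate[OF B.is_group hom' YB, of b Y] l sub by (simp add: letters)
    qed
  qed
  have nf_move: "nf (g \<otimes>\<^bsub>G\<^esub> ?\<kappa> b) = move (nf g) (Inr b)" if "g \<in> carrier G" "b \<in> carrier B" for g b
    using E_move[OF nf_\<Omega>[OF that(1)], of "Inr b"] move_\<Omega>[OF nf_\<Omega>[OF that(1)], of "Inr b"]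
      nf_E E_nf that by (metis letters(2))
  have lab_\<iota>: "lab (g \<otimes>\<^bsub>G\<^esub> ?\<iota> a) = lab g" if "g \<in> carrier G" "a \<in> carrier A" for g a
    using lab_j[OF that(1) base_letter(1)[OF that(2)]] by (simp add: \<iota>_j)
  have Y_cases: "(\<exists>a\<in>carrier A. y = ?\<iota> a) \<or> (\<exists>b\<in>carrier B. y = ?\<kappa> b)" if "y \<in> Y" for y
    using that YAc YBc unfolding Y_def by auto
  have image: "?\<iota> ` carrier A = (\<lambda>x. cls [letter True x]) ` U' True"
    unfolding amalg_vertex_def letter_def by force
  have C_proper: "\<exists>r\<in>U' True. rep True r = r \<and> r \<noteq> (\<one>\<^bsub>A\<^esub>, \<one>\<^bsub>B\<^esub>)"
  proof -
    obtain a where "a \<in> carrier A" "a \<notin> C" using prieto_subgroup_proper[OF C_prieto] C_carrier by blast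
    then have a: "(a, \<one>\<^bsub>B\<^esub>) \<in> U' True" "(a, \<one>\<^bsub>B\<^esub>) \<notin> K' True" by (auto simp: amalg_vertex_def amalg_edge_def)
    show ?thesis
      using rep_U[of "(a, \<one>\<^bsub>B\<^esub>)" True] rep_rep[OF U_carrier[OF a(1)]] rep_eq_one[OF U_carrier[OF a(1)], of True] a
      by (intro bexI[of _ "rep True (a, \<one>\<^bsub>B\<^esub>)"]) auto
  qed
  \<comment> \<open>If \<open>C\<close> maps onto \<open>B\<close>, the amalgam collapses to
    \<open>A\<close>; the premise excludes this degenerate case.\<close>
  have B_proper: "\<exists>b\<in>U' False. rep False b = b \<and> b \<noteq> (\<one>\<^bsub>A\<^esub>, \<one>\<^bsub>B\<^esub>)" if ne: "?\<iota> ` carrier A \<noteq> carrier G"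
  proof -
    have "\<psi> ` C \<noteq> carrier B"
    proof
      assume eq: "\<psi> ` C = carrier B"
      have *: "cls [l] \<in> ?\<iota> ` carrier A" if "amalg_letter A B l" for l
      proof (cases l)
        case (Inr b)
        then have "b \<in> \<psi> ` C" using that eq by (simp add: letters)
        then obtain c where "c \<in> C" "b = \<psi> c" by auto
        then have "cls [l] = ?\<iota> c" using Inr cls_R[OF amalg_rel.ident, of c] by simp
        then show ?thesis using C_carrier[OF \<open>c \<in> C\<close>] by (rule image_eqI)
      qed (use that in \<open>auto simp: letters\<close>)
      have "cls w \<in> ?\<iota> ` carrier A" if "\<forall>l\<in>set w. amalg_letter A B l" for w
        using that
      proof (induction w)
        case Nil
        then show ?case using subgroup.one_closed[OF \<iota>.img_is_subgroup] by (simp add: one_cls)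
      next
        case (Cons l w)
        then show ?case
          using subgroup.m_closed[OF \<iota>.img_is_subgroup *[of l], of "cls w"] mult_cls[of "[l]" w] by simp
      qed
      then have "carrier G \<subseteq> ?\<iota> ` carrier A" unfolding G_def carrier_pres by auto
      then show False using ne by auto
    qed
    then obtain b where "b \<in> carrier B" "b \<notin> \<psi> ` C" using \<psi>_closed by blast
    then have b: "(\<one>\<^bsub>A\<^esub>, b) \<in> U' False" "(\<one>\<^bsub>A\<^esub>, b) \<notin> K' False" by (auto simp: amalg_vertex_def amalg_edge_def)
    show ?thesis
      using rep_U[of "(\<one>\<^bsub>A\<^esub>, b)" False] rep_rep[OF U_carrier[OF b(1)]] rep_eq_one[OF U_carrier[OF b(1)], of False] b
      by (intro bexI[of _ "rep False (\<one>\<^bsub>A\<^esub>, b)"]) auto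
  qed
  interpret tree_labelling G A ?\<iota> Y lab "\<lambda>l. fst (fst l) <#\<^bsub>A\<^esub> C" "{C}"
  proof (intro_locales, rule tree_labelling_axioms.intro)
    show "group A" by (rule A.is_group)
    show "?\<iota> \<in> hom A G" by (rule hom)
    show "inj_on ?\<iota> (carrier A)"
    proof (rule inj_onI)
      fix a a' assume "a \<in> carrier A" "a' \<in> carrier A" "?\<iota> a = ?\<iota> a'"
      then show "a = a'" using inj_onD[OF inj_j, of "(a, \<one>\<^bsub>B\<^esub>)" "(a', \<one>\<^bsub>B\<^esub>)"] base_letter by (simp add: \<iota>_j)
    qed
    show "fin_gen_set G Y" by (rule Y)
    show "lab g = None \<longleftrightarrow> g \<in> ?\<iota> ` carrier A" if "g \<in> carrier G" for g
      unfolding image using lab_None[OF that] .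
    show "g \<in> ?\<iota> ` (fst (fst l) <#\<^bsub>A\<^esub> C)"
      if g: "g \<in> carrier G" and y: "y \<in> Y" and None: "lab g = None" and Some: "lab (g \<otimes>\<^bsub>G\<^esub> y) = Some l" for g y l
    proof -
      obtain b where b: "y = ?\<kappa> b" "b \<in> carrier B" using Y_cases[OF y] lab_\<iota>[OF g] None Some by auto
      have n: "fst (nf g) = []" using None unfolding lab_def by (simp split: if_splits)
      \<comment> \<open>\<open>?s\<close> is the state at the vertex of \<open>B\<close> before
        crossing back. Its only syllable becomes the label unless the crossing back cancels
        it.\<close>
      let ?m = "snd (nf g)" and ?s = "act (\<one>\<^bsub>A\<^esub>, b) (T True (nf g))"
      have "nf g = ([], ?m)" using n by (metis prod.collapse)
      then have "fst ?s = [(rep True ?m, True)]" unfolding act_def by (metis T_of_Nil fst_conv)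
      moreover have "nf (g \<otimes>\<^bsub>G\<^esub> y) = T False ?s" using nf_move[OF g b(2)] b(1) by simp
      ultimately have l: "l = (rep True ?m, True)"
        using Some T_last[of ?s False] unfolding lab_def by (auto split: if_splits)
      have m: "?m \<in> U' True" using nf_\<Omega>[OF g] unfolding \<Omega>_def by auto
      have "rem True ?m \<in> C \<times> {\<one>\<^bsub>B\<^esub>}" using rem_K[OF U_carrier[OF m], of True] unfolding amalg_edge_def by simp
      then obtain c where c: "rem True ?m = (c, \<one>\<^bsub>B\<^esub>)" "c \<in> C" by auto
      have "g = ?\<iota> (fst (rep True ?m) \<otimes>\<^bsub>A\<^esub> c)"
        using exit_mem[OF g n, of True] c(1) by (cases "rep True ?m") (simp add: letter_def)
      moreover have "fst (rep True ?m) \<otimes>\<^bsub>A\<^esub> c \<in> fst (rep True ?m) <#\<^bsub>A\<^esub> C"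
        using c(2) unfolding l_coset_def by blast
      ultimately show ?thesis unfolding l fst_conv by (rule image_eqI)
    qed
    show "l' = l" if g: "g \<in> carrier G" and y: "y \<in> Y" and lab: "lab g = Some l" "lab (g \<otimes>\<^bsub>G\<^esub> y) = Some l'" for g y l l'
    proof -
      consider a where "a \<in> carrier A" "y = ?\<iota> a" | b where "b \<in> carrier B" "y = ?\<kappa> b" using Y_cases[OF y] by auto
      then show ?thesis
      proof cases
        case 1
        then show ?thesis using lab_\<iota>[OF g] that by simp
      next
        case (2 b)
        let ?s = "act (\<one>\<^bsub>A\<^esub>, b) (T True (nf g))"
        obtain L m where n: "nf g = (L, m)" by (cases "nf g")
        have L: "L \<noteq> []" "last L = l" using lab(1) n unfolding lab_def by (auto split: if_splits)
        have v: "valid True L" "endv True L = True" using nf_\<Omega>[OF g] n unfolding \<Omega>_def by auto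
        have "T True (nf g) \<in> \<Omega> False" using T_True nf_\<Omega>[OF g] by simp
        \<comment> \<open>A path ending at the vertex of \<open>B\<close> has at least one syllable,
          as the base vertex is that of \<open>A\<close>; so the first syllable survives both
          crossings.\<close>
        then have "endv True (fst (T True (nf g))) = False" unfolding \<Omega>_def by auto
        then have "fst (T True (nf g)) \<noteq> []" by auto
        then have s: "fst ?s \<noteq> []" "last (fst ?s) = l"
          using T_last[of "nf g" True] L n by (simp_all add: act_def)
        have "nf (g \<otimes>\<^bsub>G\<^esub> y) = T False ?s" using nf_move[OF g 2(1)] 2(2) by simp
        then show ?thesis using lab(2) T_last[of ?s False] s unfolding lab_def by (auto split: if_splits)
      qed
    qed
    show "\<exists>a\<in>carrier A. \<exists>K\<in>{C}. fst (fst l) <#\<^bsub>A\<^esub> C = a <#\<^bsub>A\<^esub> K"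
      if g: "g \<in> carrier G" and l: "lab g = Some l" for g l
    proof -
      obtain L m where "(L @ [l], m) \<in> \<Omega> True" using lab_SomeD[OF g l] by blast
      then have "fst l \<in> U' True" unfolding \<Omega>_def by (cases l) (auto simp: valid_snoc)
      then show ?thesis unfolding amalg_vertex_def by auto
    qed
    show "finite {C}" by simp
    show "subgroup K A \<and> prieto_fin (A\<lparr>carrier := K\<rparr>)" if "K \<in> {C}" for K
      using that C C_prieto by auto
    show "\<exists>u\<in>P. \<exists>v\<in>P. (u, v) \<notin> (fstep A F (nneg A P))\<^sup>*"
      if "pos_cone A P" "finite F" "F \<subseteq> carrier A" for P F using A_steps[OF that] .
    assume ne: "?\<iota> ` carrier A \<noteq> carrier G"
    let ?l = "((\<one>\<^bsub>A\<^esub>, \<one>\<^bsub>B\<^esub>), True)"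
    obtain r where r: "r \<in> U' True" "rep True r = r" "r \<noteq> (\<one>\<^bsub>A\<^esub>, \<one>\<^bsub>B\<^esub>)" using C_proper by blast
    obtain b where b: "b \<in> U' False" "rep False b = b" "b \<noteq> (\<one>\<^bsub>A\<^esub>, \<one>\<^bsub>B\<^esub>)" using B_proper[OF ne] by blast
    let ?r = "cls [letter True r]" and ?b = "cls [letter False b]"
    note c = j_closed[OF r(1)] j_closed[OF b(1)]
    have disj: "lab (?r \<otimes>\<^bsub>G\<^esub> h) \<noteq> Some ?l" if "h \<in> carrier G" "lab h = Some ?l" for h
      using lab_translate[OF that(1), of True r] that(2) r by simp
    have cover: "\<exists>h\<in>carrier G. lab h = Some ?l \<and> (g = \<one>\<^bsub>G\<^esub> \<otimes>\<^bsub>G\<^esub> h \<or> g = inv\<^bsub>G\<^esub> ?b \<otimes>\<^bsub>G\<^esub> h)"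
      if g: "g \<in> carrier G" for g
    proof (cases "lab g = Some ?l")
      case True
      then show ?thesis using g by auto
    next
      case False
      then have "lab (?b \<otimes>\<^bsub>G\<^esub> g) = Some ?l" using prepend_B[OF g _ b] by simp
      moreover have "g = inv\<^bsub>G\<^esub> ?b \<otimes>\<^bsub>G\<^esub> (?b \<otimes>\<^bsub>G\<^esub> g)" using g c by (simp add: G.m_assoc[symmetric])
      ultimately show ?thesis using g c by (intro bexI[of _ "?b \<otimes>\<^bsub>G\<^esub> g"]) auto
    qed
    show "\<exists>l0. \<exists>f\<in>carrier G. \<exists>f1\<in>carrier G. \<exists>f2\<in>carrier G.
      (\<forall>h\<in>carrier G. lab h = Some l0 \<longrightarrow> lab (f \<otimes>\<^bsub>G\<^esub> h) \<noteq> Some l0) \<and>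
      (\<forall>g\<in>carrier G. \<exists>h\<in>carrier G. lab h = Some l0 \<and> (g = f1 \<otimes>\<^bsub>G\<^esub> h \<or> g = f2 \<otimes>\<^bsub>G\<^esub> h))"
      by (rule exI[of _ ?l], rule bexI[OF _ c(1)], rule bexI[OF _ G.one_closed],
          rule bexI[OF _ G.inv_closed[OF c(2)]])
        (intro conjI ballI impI; rule disj cover; assumption)
  qed
  show ?thesis using hucha[OF G_lo] .
qed

end

section \<open>The combination theorem\<close>

theorem theorem1p6:
  fixes A :: "('a, 'b) monoid_scheme" and C :: "'a set"
    and \<phi> :: "'a \<Rightarrow> 'a"
    and B :: "('c, 'd) monoid_scheme" and \<psi> :: "'a \<Rightarrow> 'c"
  assumes "group A" and "finitely_generated A" and "subgroup C A"
    and "hucha_wrt A {C}"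
    and "prieto (A\<lparr>carrier := C\<rparr>)"
  shows "(\<phi> \<in> hom (A\<lparr>carrier := C\<rparr>) A \<and> inj_on \<phi> C \<and> left_orderable (HNN A C \<phi>)
            \<longrightarrow> hucha (HNN A C \<phi>))
       \<and> (group B \<and> finitely_generated B \<and> \<psi> \<in> hom (A\<lparr>carrier := C\<rparr>) B \<and> inj_on \<psi> C
            \<and> left_orderable (AMALG A C B \<psi>)
            \<longrightarrow> hucha (AMALG A C B \<psi>))"
proof -
  have "left_orderable A" using assms(4) unfolding hucha_wrt_def by simp
  then have base: "hucha_prieto A C"
    using assms hucha_wrt_finite_steps[OF assms(1,4)] prieto_imp_prieto_fin[OF assms(5)]
    unfolding hucha_prieto_def hucha_prieto_axioms_def nneg_def by simp
  show ?thesis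
  proof (intro conjI impI)
    assume "\<phi> \<in> hom (A\<lparr>carrier := C\<rparr>) A \<and> inj_on \<phi> C \<and> left_orderable (HNN A C \<phi>)"
    then have "hnn_extension A C \<phi>"
      using base unfolding hnn_extension_def hnn_extension_axioms_def by simp
    then show "hucha (HNN A C \<phi>)" by (rule hnn_extension.hucha_HNN)
  next
    assume "group B \<and> finitely_generated B \<and> \<psi> \<in> hom (A\<lparr>carrier := C\<rparr>) B \<and> inj_on \<psi> C
      \<and> left_orderable (AMALG A C B \<psi>)"
    then have "amalgam A C B \<psi>"
      using base unfolding amalgam_def amalgam_axioms_def by simp
    then show "hucha (AMALG A C B \<psi>)" by (rule amalgam.hucha_AMALG)
  qed
qed

end
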